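(* Assume $p(K)>0$. (1) For every $r\in(0,r(K,\partial)]$ and every $M\in\mathcal C^f$, $F_{sp,[r,r]}M=F_{[r,r]}M$. (2) For every $M\in\mathcal C^f$, $F_{sp,[r,r]}M\neq0$ for only finitely many $r$, and the natural morphism $\bigoplus_{r\in(0,r(K,\partial)]}F_{sp,[r,r]}M\to M$ is an isomorphism.
   Context: $K$ is a field of characteristic $0$, complete for a non-trivial non-archimedean absolute value $|\cdot|$, with a non-zero bounded derivation $\partial$. $p(K)$ is the residue characteristic, $\omega(K)=|p(K)|^{1/(p(K)-1)}$ if $p(K)>0$ (else $1$), $|\partial|_{sp,K}=\inf_{i\ge1}|\partial^i|_{op}^{1/i}$, $r(K,\partial)=\omega(K)/|\partial|_{sp,K}$. $K\langle T\rangle$ is the twisted polynomial ring $\{\sum_i a_iT^i\}$ with $Ta=aT+\partial(a)$; $\mathcal C^f$ is the category of left $K\langle T\rangle$-modules finite-dimensional over $K$. For irreducible $M\in\mathcal C^f$, choosing any norm on $M$, set $m(M)(r)=\dim_KM$ if $r=\omega(K)/|T|_{sp,M}$ ($|T|_{sp,M}$ the spectral norm of $x\mapsto Tx$) and $0$ otherwise; for general $M$, $m(M)$ is the sum over Jordan–Hölder factors (well defined, values on $(0,r(K,\partial)]$). $F_{sp,[r,r]}M$ is the largest submodule $N$ of $M$ with $\{r': m(N)(r')\ne0\}\subseteq\{r\}$. Make $K[[X]]$ a left $K\langle T\rangle$-module by $c\cdot F=g_0(c)F$ with $g_0(c)=\sum_{i\ge0}\frac{\partial^i(c)}{i!}X^i$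 and $T\cdot F=dF/dX$. For $r>0$ let $K[[X/r]]_0=\{\sum a_iX^i:\sup_i|a_i|r^i<\infty\}$, $K\{X/r\}=\bigcap_{0<s<r}K[[X/s]]_0$, $K\{X/r+\}=\bigcup_{s>r}K[[X/s]]_0$; for $r\le r(K,\partial)$ (resp. $r<r(K,\partial)$) $K\{X/r\}$ (resp. $K\{X/r+\}$) is a $K\langle T\rangle$-submodule of $K[[X]]$. For a left $K\langle T\rangle$-module $M$: $F_{[r,r(K,\partial)]}M=\{x\in M: s(x)\in K\{X/r\}\ \forall s\in\mathrm{Hom}_{K\langle T\rangle}(M,K[[X]])\}$; for $r<r(K,\partial)$, $F_{(0,r]}M=\bigcap_{s\in\mathrm{Hom}_{K\langle T\rangle}(M,K\{X/r+\})}\ker s$, and $F_{(0,r(K,\partial)]}M:=M$; $F_{[r,r]}M=F_{(0,r]}M\cap F_{[r,r(K,\partial)]}M$. *)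

theory Defs
  imports
    "HOL-Analysis.Analysis"
    "HOL-Library.Set_Algebras"
    "HOL-Computational_Algebra.Polynomial"
    "HOL-Computational_Algebra.Formal_Power_Series"
begin

section \<open>The differential field\<close>

text \<open>The absolute value is a parameter \<open>v\<close>, not a type class instance: the norm of the
  library's normed field classes restricts to the archimedean one on the reals.\<close>

locale nonarch_diff_field =
  fixes v :: "'k::field_char_0 \<Rightarrow> real" and d :: "'k \<Rightarrow> 'k"
  assumes v_nonneg: "0 \<le> v x"
    and v_eq_0_iff: "v x = 0 \<longleftrightarrow> x = 0"
    and v_mult: "v (x * y) = v x * v y"
    and v_ultra: "v (x + y) \<le> max (v x) (v y)"
    and v_nontrivial: "\<exists>x. x \<noteq> 0 \<and> v x \<noteq> 1"
    and v_complete: "Metric_space.mcomplete UNIV (\<lambda>x y. v (x - y))"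
    and d_add: "d (x + y) = d x + d y"
    and d_mult: "d (x * y) = d x * y + x * d y"
    and d_nonzero: "\<exists>x. d x \<noteq> 0"
    and d_bounded: "\<exists>C. \<forall>x. v (d x) \<le> C * v x"

text \<open>The characteristic of the residue field \<open>{v \<le> 1} / {v < 1}\<close>: a natural number \<open>n\<close>
  vanishes in it iff \<open>v n < 1\<close>.\<close>

definition residue_char :: "('k::field_char_0 \<Rightarrow> real) \<Rightarrow> nat" where
  "residue_char v =
    (if \<exists>n>0. v (of_nat n) < 1 then LEAST n. 0 < n \<and> v (of_nat n) < 1 else 0)"

definition omega :: "('k::field_char_0 \<Rightarrow> real) \<Rightarrow> real" where
  "omega v =
    (if residue_char v > 0
     then v (of_nat (residue_char v)) powr (1 / (real (residue_char v) - 1)) else 1)"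

definition op_norm :: "'a set \<Rightarrow> ('a \<Rightarrow> real) \<Rightarrow> ('a \<Rightarrow> 'a) \<Rightarrow> real" where
  "op_norm V \<nu> f = Sup {\<nu> (f x) / \<nu> x |x. x \<in> V \<and> \<nu> x \<noteq> 0}"

definition spectral_norm :: "'a set \<Rightarrow> ('a \<Rightarrow> real) \<Rightarrow> ('a \<Rightarrow> 'a) \<Rightarrow> real" where
  "spectral_norm V \<nu> f = (INF i\<in>{1::nat..}. op_norm V \<nu> (f ^^ i) powr (1 / real i))"

definition radius :: "('k::field_char_0 \<Rightarrow> real) \<Rightarrow> ('k \<Rightarrow> 'k) \<Rightarrow> real" where
  "radius v d = omega v / spectral_norm UNIV v d"


section \<open>Twisted polynomials and left modules over them\<close>

text \<open>\<open>K\<langle>T\<rangle>\<close> has the additive group of \<^typ>\<open>'k poly\<close>, with \<open>\<Sum>a\<^sub>i T\<^sup>i\<close> represented by the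
  polynomial with coefficients \<open>a\<^sub>i\<close>, and the multiplication forced by \<open>T a = a T + d a\<close>:
  left multiplication by \<open>T\<close> sends \<open>\<Sum>b\<^sub>j T\<^sup>j\<close> to \<open>\<Sum>b\<^sub>j T\<^sup>j\<^sup>+\<^sup>1 + \<Sum>d(b\<^sub>j) T\<^sup>j\<close>.\<close>

definition T_mult :: "('k::field_char_0 \<Rightarrow> 'k) \<Rightarrow> 'k poly \<Rightarrow> 'k poly" where
  "T_mult d q = pCons 0 q + map_poly d q"

definition tw_mult :: "('k::field_char_0 \<Rightarrow> 'k) \<Rightarrow> 'k poly \<Rightarrow> 'k poly \<Rightarrow> 'k poly" where
  "tw_mult d p q = (\<Sum>i\<le>degree p. smult (coeff p i) ((T_mult d ^^ i) q))"

locale KT_module =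
  fixes d :: "'k::field_char_0 \<Rightarrow> 'k"
    and act :: "'k poly \<Rightarrow> 'm::ab_group_add \<Rightarrow> 'm"
  assumes act_add_left: "act (p + q) x = act p x + act q x"
    and act_add_right: "act p (x + y) = act p x + act p y"
    and act_mult: "act (tw_mult d p q) x = act p (act q x)"
    and act_one: "act 1 x = x"

definition scal :: "('k::field_char_0 poly \<Rightarrow> 'm \<Rightarrow> 'm) \<Rightarrow> 'k \<Rightarrow> 'm \<Rightarrow> 'm" where
  "scal act c = act [:c:]"

definition T_op :: "('k::field_char_0 poly \<Rightarrow> 'm \<Rightarrow> 'm) \<Rightarrow> 'm \<Rightarrow> 'm" where
  "T_op act = act [:0, 1:]"

text \<open>The objects of \<open>\<C>\<^sup>f\<close>.\<close>

definition KT_module_fd ::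
    "('k::field_char_0 \<Rightarrow> 'k) \<Rightarrow> ('k poly \<Rightarrow> 'm::ab_group_add \<Rightarrow> 'm) \<Rightarrow> bool" where
  "KT_module_fd d act \<longleftrightarrow>
    KT_module d act \<and> (\<exists>B. finite B \<and> module.span (scal act) B = UNIV)"

definition KT_submodule ::
    "('k::field_char_0 poly \<Rightarrow> 'm::ab_group_add \<Rightarrow> 'm) \<Rightarrow> 'm set \<Rightarrow> bool" where
  "KT_submodule act N \<longleftrightarrow>
    0 \<in> N \<and> (\<forall>x\<in>N. \<forall>y\<in>N. x + y \<in> N) \<and> (\<forall>p. \<forall>x\<in>N. act p x \<in> N)"

definition KT_hom ::
    "('k::field_char_0 poly \<Rightarrow> 'm::ab_group_add \<Rightarrow> 'm) \<Rightarrow>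
     ('k poly \<Rightarrow> 'n::ab_group_add \<Rightarrow> 'n) \<Rightarrow> ('m \<Rightarrow> 'n) \<Rightarrow> bool" where
  "KT_hom act act' s \<longleftrightarrow>
    (\<forall>x y. s (x + y) = s x + s y) \<and> (\<forall>p x. s (act p x) = act' p (s x))"


section \<open>Jordan-Hoelder factors and the spectral filtration\<close>

text \<open>Subquotients \<open>N / L\<close> of a fixed module, for submodules \<open>L \<subseteq> N\<close>; the elements of
  \<open>N / L\<close> are the cosets \<open>x +o L\<close>. A module is its own subquotient \<open>UNIV / {0}\<close>.\<close>

definition quot_space :: "'m::ab_group_add set \<Rightarrow> 'm set \<Rightarrow> 'm set set" where
  "quot_space N L = (\<lambda>x. x +o L) ` N"

definition quot_map :: "'m::ab_group_add set \<Rightarrow> ('m \<Rightarrow> 'm) \<Rightarrow> 'm set \<Rightarrow> 'm set" where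
  "quot_map L f C = (\<Union>x\<in>C. f x +o L)"

definition quot_norm ::
    "('k::field_char_0 \<Rightarrow> real) \<Rightarrow> ('k poly \<Rightarrow> 'm::ab_group_add \<Rightarrow> 'm) \<Rightarrow>
     'm set \<Rightarrow> 'm set \<Rightarrow> ('m set \<Rightarrow> real) \<Rightarrow> bool" where
  "quot_norm v act N L \<nu> \<longleftrightarrow>
    (\<forall>x\<in>N. 0 \<le> \<nu> (x +o L)) \<and>
    (\<forall>x\<in>N. \<nu> (x +o L) = 0 \<longleftrightarrow> x \<in> L) \<and>
    (\<forall>c. \<forall>x\<in>N. \<nu> (scal act c x +o L) = v c * \<nu> (x +o L)) \<and>
    (\<forall>x\<in>N. \<forall>y\<in>N. \<nu> ((x + y) +o L) \<le> max (\<nu> (x +o L)) (\<nu> (y +o L)))"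

text \<open>All norms on a finite-dimensional \<open>N / L\<close> are equivalent, so the choice is irrelevant.\<close>

definition T_spectral_norm ::
    "('k::field_char_0 \<Rightarrow> real) \<Rightarrow> ('k poly \<Rightarrow> 'm::ab_group_add \<Rightarrow> 'm) \<Rightarrow>
     'm set \<Rightarrow> 'm set \<Rightarrow> real" where
  "T_spectral_norm v act N L =
    spectral_norm (quot_space N L) (SOME \<nu>. quot_norm v act N L \<nu>) (quot_map L (T_op act))"

definition quot_dim ::
    "('k::field_char_0 poly \<Rightarrow> 'm::ab_group_add \<Rightarrow> 'm) \<Rightarrow> 'm set \<Rightarrow> 'm set \<Rightarrow> nat" where
  "quot_dim act N L = vector_space.dim (scal act) N - vector_space.dim (scal act) L"

text \<open>Submodules of \<open>N / L\<close> correspond to submodules between \<open>L\<close> and \<open>N\<close>.\<close>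

definition irreducible_quot ::
    "('k::field_char_0 poly \<Rightarrow> 'm::ab_group_add \<Rightarrow> 'm) \<Rightarrow> 'm set \<Rightarrow> 'm set \<Rightarrow> bool" where
  "irreducible_quot act N L \<longleftrightarrow>
    KT_submodule act N \<and> KT_submodule act L \<and> L \<subset> N \<and>
    (\<forall>P. KT_submodule act P \<and> L \<subseteq> P \<and> P \<subseteq> N \<longrightarrow> P = L \<or> P = N)"

definition mult_irr ::
    "('k::field_char_0 \<Rightarrow> real) \<Rightarrow> ('k poly \<Rightarrow> 'm::ab_group_add \<Rightarrow> 'm) \<Rightarrow>
     'm set \<Rightarrow> 'm set \<Rightarrow> real \<Rightarrow> nat" where
  "mult_irr v act N L r =
    (if r = omega v / T_spectral_norm v act N L then quot_dim act N L else 0)"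

definition composition_series ::
    "('k::field_char_0 poly \<Rightarrow> 'm::ab_group_add \<Rightarrow> 'm) \<Rightarrow> 'm set \<Rightarrow> 'm set list \<Rightarrow> bool" where
  "composition_series act N Ns \<longleftrightarrow>
    Ns \<noteq> [] \<and> hd Ns = {0} \<and> last Ns = N \<and>
    (\<forall>i. Suc i < length Ns \<longrightarrow> irreducible_quot act (Ns ! Suc i) (Ns ! i))"

text \<open>The function \<open>m(N)\<close> of a submodule \<open>N\<close>. By Jordan-Hoelder the choice of the series is
  irrelevant.\<close>

definition spectral_mult ::
    "('k::field_char_0 \<Rightarrow> real) \<Rightarrow> ('k poly \<Rightarrow> 'm::ab_group_add \<Rightarrow> 'm) \<Rightarrow>
     'm set \<Rightarrow> real \<Rightarrow> nat" where
  "spectral_mult v act N r =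
    (let Ns = (SOME Ns. composition_series act N Ns)
     in \<Sum>i<length Ns - 1. mult_irr v act (Ns ! Suc i) (Ns ! i) r)"

text \<open>\<open>F\<^sub>s\<^sub>p\<^sub>,\<^sub>[\<^sub>r\<^sub>,\<^sub>r\<^sub>] M\<close>.\<close>

definition F_sp ::
    "('k::field_char_0 \<Rightarrow> real) \<Rightarrow> ('k poly \<Rightarrow> 'm::ab_group_add \<Rightarrow> 'm) \<Rightarrow> real \<Rightarrow> 'm set" where
  "F_sp v act r = (GREATEST N. KT_submodule act N \<and> {r'. spectral_mult v act N r' \<noteq> 0} \<subseteq> {r})"


section \<open>Power series and the filtration by radii of convergence\<close>

definition g0 :: "('k::field_char_0 \<Rightarrow> 'k) \<Rightarrow> 'k \<Rightarrow> 'k fps" where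
  "g0 d c = Abs_fps (\<lambda>i. (d ^^ i) c / fact i)"

definition fps_act :: "('k::field_char_0 \<Rightarrow> 'k) \<Rightarrow> 'k poly \<Rightarrow> 'k fps \<Rightarrow> 'k fps" where
  "fps_act d p F = (\<Sum>i\<le>degree p. g0 d (coeff p i) * (fps_deriv ^^ i) F)"

text \<open>\<open>K[[X/r]]\<^sub>0\<close>, \<open>K{X/r}\<close> and \<open>K{X/r+}\<close>.\<close>

definition fps_bdd :: "('k::field_char_0 \<Rightarrow> real) \<Rightarrow> real \<Rightarrow> 'k fps set" where
  "fps_bdd v r = {F. bdd_above (range (\<lambda>i. v (fps_nth F i) * r ^ i))}"

definition fps_conv :: "('k::field_char_0 \<Rightarrow> real) \<Rightarrow> real \<Rightarrow> 'k fps set" where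
  "fps_conv v r = (\<Inter>s\<in>{0<..<r}. fps_bdd v s)"

definition fps_overconv :: "('k::field_char_0 \<Rightarrow> real) \<Rightarrow> real \<Rightarrow> 'k fps set" where
  "fps_overconv v r = (\<Union>s\<in>{r<..}. fps_bdd v s)"

text \<open>\<open>F\<^sub>[\<^sub>r\<^sub>,\<^sub>r\<^sub>(\<^sub>K\<^sub>,\<^sub>\<partial>\<^sub>)\<^sub>] M\<close>, \<open>F\<^sub>(\<^sub>0\<^sub>,\<^sub>r\<^sub>] M\<close> and \<open>F\<^sub>[\<^sub>r\<^sub>,\<^sub>r\<^sub>] M\<close>.\<close>

definition F_ge ::
    "('k::field_char_0 \<Rightarrow> real) \<Rightarrow> ('k \<Rightarrow> 'k) \<Rightarrow> ('k poly \<Rightarrow> 'm::ab_group_add \<Rightarrow> 'm) \<Rightarrow>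
     real \<Rightarrow> 'm set" where
  "F_ge v d act r = {x. \<forall>s. KT_hom act (fps_act d) s \<longrightarrow> s x \<in> fps_conv v r}"

definition F_le ::
    "('k::field_char_0 \<Rightarrow> real) \<Rightarrow> ('k \<Rightarrow> 'k) \<Rightarrow> ('k poly \<Rightarrow> 'm::ab_group_add \<Rightarrow> 'm) \<Rightarrow>
     real \<Rightarrow> 'm set" where
  "F_le v d act r =
    (if r < radius v d
     then {x. \<forall>s. KT_hom act (fps_act d) s \<and> range s \<subseteq> fps_overconv v r \<longrightarrow> s x = 0}
     else UNIV)"

definition F_eq ::
    "('k::field_char_0 \<Rightarrow> real) \<Rightarrow> ('k \<Rightarrow> 'k) \<Rightarrow> ('k poly \<Rightarrow> 'm::ab_group_add \<Rightarrow> 'm) \<Rightarrow>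
     real \<Rightarrow> 'm set" where
  "F_eq v d act r = F_le v d act r \<inter> F_ge v d act r"


section \<open>Direct sums of submodules\<close>

definition direct_sum :: "'i set \<Rightarrow> ('i \<Rightarrow> 'm::ab_group_add set) \<Rightarrow> ('i \<Rightarrow> 'm) set" where
  "direct_sum I A =
    {f. (\<forall>i\<in>I. f i \<in> A i) \<and> (\<forall>i. i \<notin> I \<longrightarrow> f i = 0) \<and> finite {i. f i \<noteq> 0}}"

definition direct_sum_map :: "('i \<Rightarrow> 'm::ab_group_add) \<Rightarrow> 'm" where
  "direct_sum_map f = (\<Sum>i | f i \<noteq> 0. f i)"

definition direct_sum_iso ::
    "('k::field_char_0 poly \<Rightarrow> 'm::ab_group_add \<Rightarrow> 'm) \<Rightarrow> 'i set \<Rightarrow> ('i \<Rightarrow> 'm set) \<Rightarrow> bool" where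
  "direct_sum_iso act I A \<longleftrightarrow>
    (\<forall>f\<in>direct_sum I A. \<forall>g\<in>direct_sum I A.
       direct_sum_map (\<lambda>i. f i + g i) = direct_sum_map f + direct_sum_map g) \<and>
    (\<forall>p. \<forall>f\<in>direct_sum I A. direct_sum_map (\<lambda>i. act p (f i)) = act p (direct_sum_map f)) \<and>
    bij_betw direct_sum_map (direct_sum I A) UNIV"

end

theory Submission
  imports Defs "HOL-Real_Asymp.Real_Asymp"
begin

text \<open>
  A functional \<open>f\<close> on \<open>M\<close> is the same as a morphism \<open>x \<mapsto> \<Sum> f(T\<^sup>i x)/i! X\<^sup>i\<close> to \<open>K[[X]]\<close>, and
  \<open>|i!|\<^sup>1\<^sup>/\<^sup>i \<rightarrow> \<omega>\<close>, so radii of convergence become growth rates of \<open>f(T\<^sup>i x)\<close>, with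
  \<open>\<rho> = \<omega>/r \<ge> |d|\<^sub>s\<^sub>p\<close>.
  The heart of the matter is that an extension of a module \<open>A\<close> of growth at most \<open>\<rho>\<close> by an
  irreducible \<open>B\<close> of faster growth splits. By irreducibility the infimum of
  \<open>max |e\<^sub>i| \<rho>\<^sup>i\<close> over all expressions \<open>y = \<Sum> e\<^sub>i T\<^sup>i b\<close> either is a norm on \<open>B\<close>, which would
  bound the growth of \<open>B\<close>, or vanishes identically; hence \<open>b = \<epsilon> b\<close> with \<open>\<epsilon>\<close> as small as we like.
  Modulo the image of \<open>\<phi> \<mapsto> T \<phi> - \<phi> T\<close> on \<open>Hom(A, B) = A\<^sup>* \<otimes> B\<close> we get
  \<open>\<alpha> \<otimes> b = \<alpha> \<otimes> \<epsilon> b \<equiv> \<epsilon>\<^sup>* \<alpha> \<otimes> b\<close>, and \<open>1 - \<epsilon>\<^sup>*\<close> is invertible on \<open>A\<^sup>*\<close>, so every cocycle is a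
  coboundary. Passing to the dual module gives the opposite extensions, and together they
  show that \<open>M\<close> is, for every \<open>\<rho>\<close>, the direct sum of the vectors of growth at most \<open>\<rho>\<close> and the
  common kernel of the functionals of growth at most \<open>\<rho>\<close>.
\<close>

section \<open>Absolute value and derivation\<close>

text \<open>Growth is tested by linear functionals rather than by a norm on \<open>M\<close>.
  Functionals vanishing on \<open>L\<close> see the image of a vector in M/L, so subquotients are
  pairs of submodules, and norms enter only in \<open>small_relation\<close> and in the comparison
  with spectral norms. Every growth bound is asked for each \<rho>' > \<rho>. This absorbs the
  polynomial loss in |i!|, matches convergence on all smaller discs, and provides constants K with
  |d^n x| \<le> K \<rho>'^n |x|, which are available strictly above the spectral norm of
  \<open>d\<close>. The factor to be split off need not be fast; when it is slow the extension is
  slow as a whole. Hence slow vectors can be lifted through a composition series factor by factor.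
  The dual is modelled on the space \<open>M\<close> itself, so that lifting can be applied to it
  verbatim; there it becomes the extension of slow functionals from a submodule. As r increases, the
  slow vectors for \<rho> = \<omega>/r form a decreasing, left continuous family with finitely many
  jumps, and the summand at r is a complement across the jump at r.\<close>

context nonarch_diff_field
begin

lemma v_0 [simp]: "v 0 = 0"
  by (simp add: v_eq_0_iff)

lemma v_1 [simp]: "v 1 = 1"
  using v_mult[of 1 1] v_eq_0_iff[of 1] by auto

lemma v_minus [simp]: "v (- x) = v x"
proof -
  have "v (-1) * v (-1) = 1"
    using v_mult[of "-1" "-1"] by simp
  then have "v (-1) = 1"
    using v_nonneg[of "-1"] by (simp add: square_eq_1_iff)
  then show ?thesis
    using v_mult[of "-1" x] by simp
qed

lemma v_diff_le: "v (x - y) \<le> max (v x) (v y)"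
  using v_ultra[of x "- y"] by simp

lemma v_diff_commute: "v (x - y) = v (y - x)"
  using v_minus[of "x - y"] by simp

lemma v_power: "v (x ^ n) = v x ^ n"
  by (induction n) (simp_all add: v_mult)

lemma v_inverse: "v (inverse x) = inverse (v x)"
proof (cases "x = 0")
  case False
  then have "v x * v (inverse x) = 1"
    using v_mult[of x "inverse x"] by simp
  then show ?thesis
    by (simp add: inverse_unique)
qed simp

lemma v_divide: "v (x / y) = v x / v y"
  by (simp add: divide_inverse v_mult v_inverse)

lemma v_of_nat_le_1: "v (of_nat n) \<le> 1"
proof (induction n)
  case (Suc n)
  then show ?case
    using v_ultra[of 1 "of_nat n"] by simp
qed simp

lemma v_sum_le:
  assumes "finite I" "0 \<le> B" "\<And>i. i \<in> I \<Longrightarrow> v (f i) \<le> B"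
  shows "v (\<Sum>i\<in>I. f i) \<le> B"
  using assms
proof (induction I rule: finite_induct)
  case (insert i I)
  then show ?case
    using v_ultra[of "f i" "\<Sum>i\<in>I. f i"] by (simp add: le_max_iff_disj) (smt (verit))
qed simp

lemma v_add_eq:
  assumes "v y < v x"
  shows "v (x + y) = v x"
  using v_ultra[of x y] v_diff_le[of "x + y" y] assms by simp

lemma d_0 [simp]: "d 0 = 0"
  using d_add[of 0 0] by simp

lemma d_minus: "d (- x) = - d x"
  using d_add[of x "- x"] by (simp add: add_eq_0_iff)

lemma d_diff: "d (x - y) = d x - d y"
  using d_add[of x "- y"] by (simp add: d_minus)

lemma d_1 [simp]: "d 1 = 0"
  using d_mult[of 1 1] by simp

lemma d_iter_add: "(d ^^ n) (x + y) = (d ^^ n) x + (d ^^ n) y"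
  by (induction n) (simp_all add: d_add)

lemma d_iter_0 [simp]: "(d ^^ n) 0 = 0"
  by (induction n) simp_all

lemma d_iter_diff: "(d ^^ n) (x - y) = (d ^^ n) x - (d ^^ n) y"
  by (induction n) (simp_all add: d_diff)

section \<open>Limits with respect to the absolute value\<close>

lemma v_tendsto_unique:
  assumes "(\<lambda>n. v (X n - a)) \<longlonglongrightarrow> 0" "(\<lambda>n. v (X n - b)) \<longlonglongrightarrow> 0"
  shows "a = b"
proof -
  have "v (a - b) \<le> v (X n - a) + v (X n - b)" for n
    using v_diff_le[of "X n - b" "X n - a"] v_nonneg[of "X n - a"] v_nonneg[of "X n - b"]
    by simp
  moreover have "(\<lambda>n. v (X n - a) + v (X n - b)) \<longlonglongrightarrow> 0 + 0"
    using assms by (intro tendsto_add)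
  ultimately have "v (a - b) \<le> 0"
    by (intro LIMSEQ_le_const[of _ 0]) auto
  then show ?thesis
    using v_eq_0_iff[of "a - b"] v_nonneg[of "a - b"] by simp
qed

lemma v_tendsto_add:
  assumes "(\<lambda>n. v (X n - a)) \<longlonglongrightarrow> 0" "(\<lambda>n. v (Y n - b)) \<longlonglongrightarrow> 0"
  shows "(\<lambda>n. v ((X n + Y n) - (a + b))) \<longlonglongrightarrow> 0"
proof (rule tendsto_sandwich[of "\<lambda>_. 0"])
  have "v ((X n + Y n) - (a + b)) \<le> v (X n - a) + v (Y n - b)" for n
    using v_ultra[of "X n - a" "Y n - b"] v_nonneg[of "X n - a"] v_nonneg[of "Y n - b"]
    by (simp add: algebra_simps)
  then show "\<forall>\<^sub>F n in sequentially. v ((X n + Y n) - (a + b)) \<le> v (X n - a) + v (Y n - b)"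
    by simp
  show "(\<lambda>n. v (X n - a) + v (Y n - b)) \<longlonglongrightarrow> 0"
    using tendsto_add[OF assms] by simp
qed (auto simp: v_nonneg)

lemma v_tendsto_mult:
  assumes "(\<lambda>n. v (X n - a)) \<longlonglongrightarrow> 0"
  shows "(\<lambda>n. v (c * X n - c * a)) \<longlonglongrightarrow> 0"
proof -
  have "v (c * X n - c * a) = v c * v (X n - a)" for n
    by (metis right_diff_distrib v_mult)
  then show ?thesis
    using tendsto_mult_left[OF assms, of "v c"] by simp
qed

lemma v_tendsto_minus:
  assumes "(\<lambda>n. v (X n - a)) \<longlonglongrightarrow> 0"
  shows "(\<lambda>n. v (- X n - - a)) \<longlonglongrightarrow> 0"
  using v_tendsto_mult[OF assms, of "-1"] by simp

lemma v_tendsto_d: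
  assumes "(\<lambda>n. v (X n - a)) \<longlonglongrightarrow> 0"
  shows "(\<lambda>n. v (d (X n) - d a)) \<longlonglongrightarrow> 0"
proof -
  obtain C where C: "\<And>x. v (d x) \<le> C * v x"
    using d_bounded by blast
  show ?thesis
  proof (rule tendsto_sandwich[of "\<lambda>_. 0" _ _ "\<lambda>n. C * v (X n - a)"])
    show "(\<lambda>n. C * v (X n - a)) \<longlonglongrightarrow> 0"
      using tendsto_mult_left[OF assms, of C] by simp
  qed (auto simp: v_nonneg C simp flip: d_diff)
qed

lemma v_tendsto_sum:
  assumes "\<And>i. i \<in> I \<Longrightarrow> (\<lambda>n. v (X i n - a i)) \<longlonglongrightarrow> 0"
  shows "(\<lambda>n. v ((\<Sum>i\<in>I. X i n) - (\<Sum>i\<in>I. a i))) \<longlonglongrightarrow> 0"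
  using assms
proof (induction I rule: infinite_finite_induct)
  case (insert i I)
  then show ?case
    using v_tendsto_add[of "X i" "a i" "\<lambda>n. \<Sum>i\<in>I. X i n" "\<Sum>i\<in>I. a i"] by simp
qed simp_all

lemma v_Cauchy_convergent:
  assumes "\<And>e. 0 < e \<Longrightarrow> \<exists>N. \<forall>m\<ge>N. \<forall>n\<ge>N. v (X m - X n) < e"
  shows "\<exists>l. (\<lambda>n. v (X n - l)) \<longlonglongrightarrow> 0"
proof -
  interpret M: Metric_space UNIV "\<lambda>x y. v (x - y)"
  proof
    fix x y z
    show "v (x - z) \<le> v (x - y) + v (y - z)"
      using v_ultra[of "x - y" "y - z"] v_nonneg[of "x - y"] v_nonneg[of "y - z"] by simp
  qed (auto simp: v_nonneg v_eq_0_iff v_diff_commute)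
  have "M.MCauchy X"
    using assms by (auto simp: M.MCauchy_def)
  then obtain l where "limitin M.mtopology X l sequentially"
    using v_complete by (auto simp: M.mcomplete_def)
  then show ?thesis
    unfolding M.limit_metric_sequentially
    by (auto intro!: exI[of _ l] simp: LIMSEQ_iff v_nonneg)
qed

text \<open>A difference of two terms telescopes, and by the ultrametric inequality it is bounded by
  the largest increment in between. Convergence of the Neumann series rests on this.\<close>

lemma v_increments_convergent:
  assumes "(\<lambda>n. v (X (Suc n) - X n)) \<longlonglongrightarrow> 0"
  shows "\<exists>l. (\<lambda>n. v (X n - l)) \<longlonglongrightarrow> 0"
proof (rule v_Cauchy_convergent)
  fix e :: real assume "0 < e"
  then obtain N where N: "\<And>n. n \<ge> N \<Longrightarrow> v (X (Suc n) - X n) < e"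
    using assms by (auto simp: LIMSEQ_iff v_nonneg)
  have *: "v (X (N + k) - X N) < e" for k
  proof (induction k)
    case (Suc k)
    then show ?case
      using v_ultra[of "X (Suc (N + k)) - X (N + k)" "X (N + k) - X N"] N[of "N + k"] by simp
  qed (simp add: \<open>0 < e\<close>)
  have "v (X m - X n) < e" if "m \<ge> N" "n \<ge> N" for m n
    using v_diff_le[of "X m - X N" "X n - X N"] *[of "m - N"] *[of "n - N"] that by simp
  then show "\<exists>N. \<forall>m\<ge>N. \<forall>n\<ge>N. v (X m - X n) < e"
    by blast
qed

end

section \<open>Spectral norms\<close>

text \<open>The constant disappears because K^(1/n) tends to 1. The vector \<open>x0\<close> keeps
  the supremum in \<open>op_norm\<close> away from the empty set, where \<open>Sup\<close> has no
  useful value.\<close>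

lemma spectral_norm_le:
  assumes "\<And>n x. x \<in> V \<Longrightarrow> \<nu> ((f ^^ n) x) \<le> K * \<rho> ^ n * \<nu> x"
    and nonneg: "\<And>x. x \<in> V \<Longrightarrow> 0 \<le> \<nu> x" and "0 < \<rho>"
    and x0: "x0 \<in> V" "\<nu> x0 \<noteq> 0" and f: "\<And>x. x \<in> V \<Longrightarrow> f x \<in> V"
  shows "spectral_norm V \<nu> f \<le> \<rho>"
proof -
  define K' where "K' = max K 1"
  have K': "K' \<ge> 1" "K \<le> K'" by (auto simp: K'_def)
  have fn: "(f ^^ n) x \<in> V" if "x \<in> V" for n x
    using that f by (induction n) auto
  have le: "op_norm V \<nu> (f ^^ n) \<le> K' * \<rho> ^ n" for n
    unfolding op_norm_def
  proof (rule cSup_least)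
    fix q assume "q \<in> {\<nu> ((f ^^ n) x) / \<nu> x |x. x \<in> V \<and> \<nu> x \<noteq> 0}"
    then obtain x where x: "q = \<nu> ((f ^^ n) x) / \<nu> x" "x \<in> V" "\<nu> x \<noteq> 0" by auto
    then have "\<nu> x > 0" using nonneg[of x] by simp
    moreover have "\<nu> ((f ^^ n) x) \<le> K' * \<rho> ^ n * \<nu> x"
      using assms(1)[OF x(2), of n] K' \<open>0 < \<rho>\<close> \<open>\<nu> x > 0\<close>
      by (smt (verit) mult_right_mono zero_le_power)
    ultimately show "q \<le> K' * \<rho> ^ n"
      by (simp add: x divide_le_eq)
  qed (use x0 in blast)
  have ge: "0 \<le> op_norm V \<nu> (f ^^ n)" for n
  proof -
    have "0 \<le> \<nu> ((f ^^ n) x0) / \<nu> x0"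
      using nonneg x0 fn by simp
    also have "\<dots> \<le> op_norm V \<nu> (f ^^ n)"
      unfolding op_norm_def
    proof (rule cSup_upper)
      show "bdd_above {\<nu> ((f ^^ n) x) / \<nu> x |x. x \<in> V \<and> \<nu> x \<noteq> 0}"
      proof (rule bdd_aboveI[of _ "K * \<rho> ^ n"])
        fix q assume "q \<in> {\<nu> ((f ^^ n) x) / \<nu> x |x. x \<in> V \<and> \<nu> x \<noteq> 0}"
        then show "q \<le> K * \<rho> ^ n"
          using assms(1)[of _ n] nonneg by (auto simp: divide_le_eq less_le)
      qed
    qed (use x0 in auto)
    finally show ?thesis .
  qed
  have "spectral_norm V \<nu> f \<le> K' powr (1 / real (Suc i)) * \<rho>" for i
  proof -
    have "spectral_norm V \<nu> f \<le> op_norm V \<nu> (f ^^ Suc i) powr (1 / real (Suc i))"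
      unfolding spectral_norm_def by (rule cINF_lower) (auto intro: bdd_belowI[of _ 0])
    also have "\<dots> \<le> (K' * \<rho> ^ Suc i) powr (1 / real (Suc i))"
      using le[of "Suc i"] ge[of "Suc i"] by (intro powr_mono2) auto
    also have "\<dots> = K' powr (1 / real (Suc i)) * \<rho>"
    proof -
      have "(\<rho> ^ Suc i) powr (1 / real (Suc i)) = \<rho>"
        using \<open>0 < \<rho>\<close> by (subst powr_realpow[symmetric]) (simp_all add: powr_powr del: power_Suc)
      then show ?thesis
        using K' \<open>0 < \<rho>\<close> by (simp add: powr_mult del: power_Suc)
    qed
    finally show ?thesis .
  qed
  moreover have "(\<lambda>i. K' powr (1 / real (Suc i)) * \<rho>) \<longlonglongrightarrow> K' powr 0 * \<rho>"
    using K' by (intro tendsto_intros LIMSEQ_Suc[OF lim_1_over_n]) auto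
  ultimately show ?thesis
    using K' by (intro LIMSEQ_le_const[of _ \<rho>]) auto
qed

text \<open>An infimum below \<rho> is witnessed by a single exponent i with |f^i| \<le> \<rho>^i.
  For n = k + q i with k < i, the powers of f^i give \<rho>^(q i), and the finitely many remainders
  k go into the constant.\<close>

lemma spectral_norm_less_imp_bound:
  assumes bd: "\<And>x. x \<in> V \<Longrightarrow> \<nu> (f x) \<le> B * \<nu> x"
    and nonneg: "\<And>x. x \<in> V \<Longrightarrow> 0 \<le> \<nu> x"
    and x0: "x0 \<in> V" "\<nu> x0 \<noteq> 0" and f: "\<And>x. x \<in> V \<Longrightarrow> f x \<in> V"
    and less: "spectral_norm V \<nu> f < \<rho>"
  shows "\<exists>K. K \<ge> 1 \<and> (\<forall>n. \<forall>x\<in>V. \<nu> ((f ^^ n) x) \<le> K * \<rho> ^ n * \<nu> x)"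
proof -
  define B' where "B' = max B 1"
  have B': "B' \<ge> 1" "B \<le> B'" by (auto simp: B'_def)
  have fn: "(f ^^ n) x \<in> V" if "x \<in> V" for n x
    using that f by (induction n) auto
  have bdn: "\<nu> ((f ^^ n) x) \<le> B' ^ n * \<nu> x" if "x \<in> V" for n x
  proof (induction n)
    case (Suc n)
    have "\<nu> ((f ^^ Suc n) x) \<le> B * \<nu> ((f ^^ n) x)"
      using bd[OF fn[OF that]] by simp
    also have "\<dots> \<le> B' * (B' ^ n * \<nu> x)"
      using B' Suc nonneg[OF fn[OF that]] by (intro mult_mono) auto
    finally show ?case by simp
  qed simp
  have opn: "\<nu> ((f ^^ n) x) \<le> op_norm V \<nu> (f ^^ n) * \<nu> x" if "x \<in> V" for n x
  proof (cases "\<nu> x = 0")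
    case True
    then show ?thesis using bdn[OF that, of n] by simp
  next
    case False
    then have "\<nu> x > 0" using nonneg[OF that] by simp
    have "\<nu> ((f ^^ n) x) / \<nu> x \<le> op_norm V \<nu> (f ^^ n)"
      unfolding op_norm_def
    proof (rule cSup_upper)
      show "bdd_above {\<nu> ((f ^^ n) x) / \<nu> x |x. x \<in> V \<and> \<nu> x \<noteq> 0}"
      proof (rule bdd_aboveI[of _ "B' ^ n"])
        fix q assume "q \<in> {\<nu> ((f ^^ n) x) / \<nu> x |x. x \<in> V \<and> \<nu> x \<noteq> 0}"
        then show "q \<le> B' ^ n"
          using bdn nonneg by (auto simp: divide_le_eq less_le)
      qed
    qed (use that False in auto)
    then show ?thesis
      using \<open>\<nu> x > 0\<close> by (simp add: divide_le_eq)
  qed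
  have op_ge0: "0 \<le> op_norm V \<nu> (f ^^ n)" for n
    using opn[OF x0(1), of n] nonneg[OF fn[OF x0(1)], of n] nonneg[OF x0(1)] x0(2)
    by (smt (verit) mult_neg_pos)
  obtain i where i: "i \<ge> 1" "op_norm V \<nu> (f ^^ i) powr (1 / real i) < \<rho>"
    using less unfolding spectral_norm_def
    by (subst (asm) cINF_less_iff) (auto intro!: bdd_belowI[of _ 0])
  then have "0 < \<rho>"
    by (smt (verit) powr_ge_zero)
  have "op_norm V \<nu> (f ^^ i) \<le> \<rho> ^ i"
  proof -
    have "op_norm V \<nu> (f ^^ i) = (op_norm V \<nu> (f ^^ i) powr (1 / real i)) ^ i"
      using i(1) op_ge0[of i] by (cases "op_norm V \<nu> (f ^^ i) = 0") (auto simp: powr_power)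
    also have "\<dots> \<le> \<rho> ^ i"
      using i by (intro power_mono) auto
    finally show ?thesis .
  qed
  then have step: "\<nu> ((f ^^ i) x) \<le> \<rho> ^ i * \<nu> x" if "x \<in> V" for x
    using opn[OF that, of i] nonneg[OF that] by (smt (verit) mult_right_mono)
  have steps: "\<nu> ((f ^^ (q * i)) x) \<le> (\<rho> ^ i) ^ q * \<nu> x" if "x \<in> V" for q x
  proof (induction q)
    case (Suc q)
    have "\<nu> ((f ^^ (Suc q * i)) x) \<le> \<rho> ^ i * \<nu> ((f ^^ (q * i)) x)"
      using step[OF fn[OF that, of "q * i"]] by (simp add: funpow_add)
    also have "\<dots> \<le> \<rho> ^ i * ((\<rho> ^ i) ^ q * \<nu> x)"
      using Suc \<open>0 < \<rho>\<close> by (intro mult_left_mono) auto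
    finally show ?case by simp
  qed simp
  define K where "K = (Max ((\<lambda>k. B' ^ k / \<rho> ^ k) ` {..<i}))"
  have K: "B' ^ k / \<rho> ^ k \<le> K" if "k < i" for k
    unfolding K_def using that by (intro Max_ge) auto
  have "K \<ge> 1"
    using K[of 0] i by simp
  have "\<nu> ((f ^^ n) x) \<le> K * \<rho> ^ n * \<nu> x" if "x \<in> V" for n x
  proof -
    define q k where "q = n div i" and "k = n mod i"
    have n: "n = k + q * i" "k < i"
      using i(1) by (auto simp: q_def k_def)
    have "\<nu> ((f ^^ n) x) \<le> B' ^ k * \<nu> ((f ^^ (q * i)) x)"
      using bdn[OF fn[OF that, of "q * i"], of k] by (simp add: n funpow_add)
    also have "\<dots> \<le> (K * \<rho> ^ k) * ((\<rho> ^ i) ^ q * \<nu> x)"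
      using steps[OF that] K[OF n(2)] B' \<open>0 < \<rho>\<close> \<open>K \<ge> 1\<close> nonneg[OF fn[OF that]]
      by (intro mult_mono) (auto simp: divide_le_eq)
    also have "\<dots> = K * \<rho> ^ n * \<nu> x"
      by (simp add: n(1) power_add power_mult[symmetric] mult.commute[of i])
    finally show ?thesis .
  qed
  then show ?thesis
    using \<open>K \<ge> 1\<close> by blast
qed

section \<open>Factorials and the spectral norm of the derivation\<close>

context nonarch_diff_field
begin

abbreviation "spd \<equiv> spectral_norm UNIV v d"

text \<open>Legendre's formula in recursive form: among the factors of n! only the multiples p q of
  the residue characteristic p have absolute value below 1, and such a factor contributes |p|
  |q|.\<close>

lemma v_fact_div:
  assumes "residue_char v > 0"
  shows "v (fact n) = v (of_nat (residue_char v)) ^ (n div residue_char v) * v (fact (n div residue_char v))"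
proof -
  define p where "p = residue_char v"
  have ex: "\<exists>n>0. v (of_nat n) < 1"
    using assms by (auto simp: residue_char_def split: if_splits)
  then have p_def': "p = (LEAST n. 0 < n \<and> v (of_nat n) < 1)"
    by (simp add: p_def residue_char_def)
  have p: "p > 0" "v (of_nat p) < 1"
    using LeastI_ex[OF ex] by (auto simp: p_def')
  have small: "v (of_nat k) = 1" if "0 < k" "k < p" for k
    using not_less_Least[of k "\<lambda>n. 0 < n \<and> v (of_nat n) < 1"] that v_of_nat_le_1[of k]
    by (simp add: p_def')
  \<comment> \<open>Write m = k + p q with 0 < k < p: minimality of p gives |k| = 1, and |p q| < 1
    cannot change this.\<close>
  have unit: "v (of_nat m) = 1" if "\<not> p dvd m" for m
  proof -
    define q k where "q = m div p" and "k = m mod p"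
    have k: "0 < k" "k < p"
      using that p(1) by (auto simp: k_def mod_greater_zero_iff_not_dvd)
    have "v (of_nat (p * q)) = v (of_nat p) * v (of_nat q)"
      by (simp add: v_mult)
    also have "\<dots> < 1"
      using p(2) v_of_nat_le_1[of q] v_nonneg[of "of_nat q"] v_nonneg[of "of_nat p"]
      by (smt (verit) mult_left_le)
    finally have "v (of_nat k + of_nat (p * q)) = v (of_nat k)"
      using small[OF k] by (intro v_add_eq) simp
    moreover have "(of_nat m :: 'k) = of_nat k + of_nat (p * q)"
      unfolding of_nat_add[symmetric] by (simp add: k_def q_def)
    ultimately show ?thesis
      using small[OF k] by simp
  qed
  have "v (fact n) = v (of_nat p) ^ (n div p) * v (fact (n div p))"
  proof (induction n)
    case (Suc n)
    show ?case
    proof (cases "p dvd Suc n")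
      case False
      then have "Suc n div p = n div p"
        using div_Suc[of n p] by (auto simp: dvd_eq_mod_eq_0)
      then show ?thesis
        using Suc unit[OF False] by (simp add: v_mult del: of_nat_Suc)
    next
      case True
      then have q: "Suc n div p = Suc (n div p)"
        using div_Suc[of n p] by (auto simp: dvd_eq_mod_eq_0)
      have "Suc n = p * Suc (n div p)"
        using True q by (metis dvd_mult_div_cancel)
      then have "v (of_nat (Suc n)) = v (of_nat p) * v (of_nat (Suc (n div p)))"
        by (metis of_nat_mult v_mult)
      then show ?thesis
        using Suc by (simp add: v_mult q del: of_nat_Suc)
    qed
  qed (simp add: p_def)
  then show ?thesis
    by (simp add: p_def)
qed

lemma residue_char_gt_1:
  assumes "residue_char v > 0"
  shows "residue_char v > 1" "0 < v (of_nat (residue_char v))" "v (of_nat (residue_char v)) < 1"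
proof -
  have ex: "\<exists>n>0. v (of_nat n) < 1"
    using assms by (auto simp: residue_char_def split: if_splits)
  then show *: "v (of_nat (residue_char v)) < 1"
    using LeastI_ex[OF ex] by (auto simp: residue_char_def)
  then have "residue_char v \<noteq> 1"
    by auto
  then show "residue_char v > 1"
    using assms by simp
  show "0 < v (of_nat (residue_char v))"
    using assms v_eq_0_iff[of "of_nat (residue_char v)"] v_nonneg[of "of_nat (residue_char v)"] by simp
qed

text \<open>The identity \<omega>^(p-1) = |p| lets the recursion for factorials close up: |p|^m
  \<omega>^m = \<omega>^(p m).\<close>

lemma omega_pos:
  assumes "residue_char v > 0"
  shows "0 < omega v" "omega v \<le> 1" "omega v ^ (residue_char v - 1) = v (of_nat (residue_char v))"
proof -
  note p = residue_char_gt_1[OF assms]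
  show "0 < omega v"
    using p by (simp add: omega_def)
  show "omega v \<le> 1"
    using p assms by (simp add: omega_def powr_le1)
  show "omega v ^ (residue_char v - 1) = v (of_nat (residue_char v))"
    using p assms by (simp add: omega_def powr_power of_nat_diff)
qed

text \<open>Strong induction along n -> n div p; passing from p (n div p) to n only helps because
  \<omega> \<le> 1.\<close>

lemma v_fact_ge:
  assumes "residue_char v > 0"
  shows "omega v ^ n \<le> v (fact n)"
proof (induction n rule: less_induct)
  case (less n)
  define p where "p = residue_char v"
  note p = residue_char_gt_1[OF assms, folded p_def]
  note om = omega_pos[OF assms, folded p_def]
  show ?case
  proof (cases "n = 0")
    case False
    define m where "m = n div p"
    have "m < n" using False p by (simp add: m_def)
    have "(p - 1) * m + m = p * m"
      using p(1) by (metis add.commute diff_add_inverse2 le_add_diff_inverse less_imp_le mult.left_neutral distrib_right)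
    also have "p * m \<le> n"
      by (simp add: m_def)
    finally have "omega v ^ n \<le> omega v ^ ((p - 1) * m + m)"
      using om by (intro power_decreasing) auto
    also have "\<dots> = v (of_nat p) ^ m * omega v ^ m"
      by (simp add: power_add power_mult om(3) del: One_nat_def)
    also have "\<dots> \<le> v (of_nat p) ^ m * v (fact m)"
      using less[OF \<open>m < n\<close>] p by (intro mult_left_mono) auto
    also have "\<dots> = v (fact n)"
      using v_fact_div[OF assms, of n] by (simp add: m_def p_def)
    finally show ?thesis .
  qed simp
qed

text \<open>The reverse estimate loses at most a factor A = 1/|p| at each of the roughly log_p n
  levels of the recursion, in total A^(log_p n) = n^a. This is why \<open>a\<close> is the logarithm
  of \<open>A\<close> to base p.\<close>

lemma v_fact_le:
  assumes "residue_char v > 0"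
  shows "\<exists>A a. 0 < a \<and> A \<ge> 1 \<and> (\<forall>n\<ge>1. v (fact n) \<le> A * real n powr a * omega v ^ n)"
proof -
  define p where "p = residue_char v"
  note p = residue_char_gt_1[OF assms, folded p_def]
  note om = omega_pos[OF assms, folded p_def]
  define A where "A = 1 / v (of_nat p)"
  define a where "a = log (real p) A"
  have A: "A > 1" using p by (simp add: A_def)
  have a: "a > 0" "real p powr a = A"
    using A p by (auto simp: a_def)
  have om_k: "1 \<le> A * omega v ^ k" if "k < p" for k
  proof -
    have "v (of_nat p) \<le> omega v ^ k"
      unfolding om(3)[symmetric] using that om by (intro power_decreasing) auto
    then show ?thesis using p by (simp add: A_def)
  qed
  have "v (fact n) \<le> A * real n powr a * omega v ^ n" if "n \<ge> 1" for n
    using that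
  proof (induction n rule: less_induct)
    case (less n)
    define m k where "m = n div p" and "k = n mod p"
    have k: "k < p" using p by (simp add: k_def)
    have n: "n = p * m + k" by (simp add: m_def k_def)
    have vf: "v (fact n) = v (of_nat p) ^ m * v (fact m)"
      using v_fact_div[OF assms, of n] by (simp add: m_def p_def)
    show ?case
    proof (cases "m = 0")
      case True
      have "1 \<le> A * omega v ^ n" using om_k[OF k] True n by simp
      also have "\<dots> \<le> A * omega v ^ n * real n powr a"
        using less.prems a A om by (intro mult_le_cancel_left1[THEN iffD2]) (auto simp: ge_one_powr_ge_zero mult_less_0_iff)
      finally show ?thesis using True vf by (simp add: mult_ac)
    next
      case False
      then have "m \<ge> 1" by simp
      have "m < n" using less.prems p by (simp add: m_def)
      have pm: "(p - 1) * m + m = p * m"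
        using p(1) by (metis add.commute diff_add_inverse2 le_add_diff_inverse less_imp_le mult.left_neutral distrib_right)
      have "v (fact n) \<le> v (of_nat p) ^ m * (A * real m powr a * omega v ^ m)"
        unfolding vf using less.IH[OF \<open>m < n\<close> \<open>m \<ge> 1\<close>] p by (intro mult_left_mono) auto
      also have "\<dots> = A * real m powr a * omega v ^ ((p - 1) * m + m)"
        by (simp add: power_add power_mult om(3) del: One_nat_def)
      also have "\<dots> = real m powr a * A * omega v ^ (p * m)"
        unfolding pm by simp
      also have "\<dots> \<le> real m powr a * A * omega v ^ (p * m) * (A * omega v ^ k)"
        using om_k[OF k] A om by (intro mult_le_cancel_left1[THEN iffD2]) (auto simp: mult_less_0_iff zero_le_mult_iff not_less)
      also have "\<dots> = A * (A * real m powr a) * omega v ^ n"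
        by (simp add: n power_add mult_ac)
      \<comment> \<open>Since A = p^a, the factor lost at this level turns m^a into (p m)^a.\<close>
      also have "A * real m powr a = (real p * real m) powr a"
        using p by (simp add: powr_mult a)
      also have "A * (real p * real m) powr a * omega v ^ n \<le> A * real n powr a * omega v ^ n"
      proof -
        have "real p * real m \<le> real n"
          unfolding n by simp
        then show ?thesis
          using A om a by (intro mult_right_mono mult_left_mono powr_mono2) auto
      qed
      finally show ?thesis .
    qed
  qed
  then show ?thesis
    using A a by (intro exI[of _ A] exI[of _ a]) auto
qed

text \<open>The polynomial loss is swallowed by \<delta>^n, at the price of a rate slightly above
  \<omega>.\<close>

lemma v_fact_le_power:
  assumes "residue_char v > 0" "1 < \<delta>"
  shows "\<exists>C>0. \<forall>n. v (fact n) \<le> C * (\<delta> * omega v) ^ n"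
proof -
  obtain A a where A: "A \<ge> 1" "a > 0" "\<And>n. n \<ge> 1 \<Longrightarrow> v (fact n) \<le> A * real n powr a * omega v ^ n"
    using v_fact_le[OF assms(1)] by blast
  have "(\<lambda>n. real n powr a / \<delta> ^ n) \<longlonglongrightarrow> 0"
    using A(2) assms(2) by real_asymp
  then have "Bseq (\<lambda>n. real n powr a / \<delta> ^ n)"
    by (intro convergent_imp_Bseq) (auto simp: convergent_def)
  then obtain B where B: "B > 0" "\<And>n. \<bar>real n powr a / \<delta> ^ n\<bar> \<le> B"
    by (auto simp: Bseq_def)
  have om: "0 < omega v" by (rule omega_pos[OF assms(1)])
  have "v (fact n) \<le> (A * B + 1) * (\<delta> * omega v) ^ n" for n
  proof (cases "n = 0")
    case False
    have "real n powr a \<le> B * \<delta> ^ n"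
      using B(2)[of n] assms(2) by (simp add: divide_le_eq)
    then have "A * real n powr a * omega v ^ n \<le> A * (B * \<delta> ^ n) * omega v ^ n"
      using A(1) om by (intro mult_right_mono mult_left_mono) auto
    also have "\<dots> \<le> (A * B + 1) * (\<delta> * omega v) ^ n"
      using om assms(2) by (simp add: power_mult_distrib algebra_simps)
    finally show ?thesis
      using A(3)[of n] False by simp
  qed (use A B in simp)
  moreover have "A * B + 1 > 0"
    using A(1) B(1) by (simp add: add_pos_pos)
  ultimately show ?thesis by blast
qed

section \<open>The Taylor homomorphism and positivity of the spectral norm of the derivation\<close>

lemma g0_0 [simp]: "g0 d 0 = 0"
  by (simp add: g0_def fps_eq_iff)

lemma g0_add: "g0 d (x + y) = g0 d x + g0 d y"
  by (simp add: g0_def fps_eq_iff d_iter_add add_divide_distrib)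

lemma fps_deriv_g0: "fps_deriv (g0 d x) = g0 d (d x)"
proof (rule fps_ext)
  fix n
  have "(of_nat (Suc n) :: 'k) \<noteq> 0" by (simp del: of_nat_Suc)
  then show "fps_nth (fps_deriv (g0 d x)) n = fps_nth (g0 d (d x)) n"
    by (simp add: g0_def funpow_swap1 del: of_nat_Suc)
qed

text \<open>Differentiation reduces the coefficient at n + 1 to the coefficients at n of the two
  products in the Leibniz rule; characteristic 0 allows division by n + 1.\<close>

lemma g0_mult: "g0 d (x * y) = g0 d x * g0 d y"
proof (rule fps_ext)
  fix n
  show "fps_nth (g0 d (x * y)) n = fps_nth (g0 d x * g0 d y) n"
  proof (induction n arbitrary: x y)
    case (Suc n)
    have "of_nat (n + 1) * fps_nth (g0 d (x * y)) (n + 1) = fps_nth (fps_deriv (g0 d (x * y))) n"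
      by (simp only: fps_deriv_nth)
    also have "\<dots> = fps_nth (g0 d (d x * y)) n + fps_nth (g0 d (x * d y)) n"
      by (simp only: fps_deriv_g0 d_mult g0_add fps_add_nth)
    also have "\<dots> = fps_nth (fps_deriv (g0 d x * g0 d y)) n"
      by (simp add: Suc fps_deriv_g0)
    also have "\<dots> = of_nat (n + 1) * fps_nth (g0 d x * g0 d y) (n + 1)"
      by (simp only: fps_deriv_nth)
    finally show ?case
      by (simp del: of_nat_Suc)
  qed (simp add: g0_def)
qed

lemma g0_1 [simp]: "g0 d 1 = 1"
proof (rule fps_ext)
  fix n
  show "fps_nth (g0 d 1) n = fps_nth 1 n"
    by (cases n) (simp_all add: g0_def funpow_swap1 del: funpow.simps(2) add: funpow_Suc_right)
qed

lemma g0_power: "g0 d (x ^ n) = g0 d x ^ n"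
  by (induction n) (simp_all add: g0_mult)

text \<open>Two ways to read the coefficient of X^n in (g0(c) - c)^n: the base starts with d(c) X,
  and the power has a binomial expansion. It bounds d(c) by the values of d^n on powers of
  c.\<close>

lemma fact_mult_d_power:
  "fact n * d c ^ n = (\<Sum>j\<le>n. of_nat (n choose j) * (- c) ^ (n - j) * (d ^^ n) (c ^ j))"
proof -
  define F where "F = g0 d c + fps_const (- c)"
  define G where "G = fps_shift 1 F"
  have "fps_nth F 0 = 0" by (simp add: F_def g0_def)
  then have "F = fps_X * G"
    by (intro fps_ext) (auto simp: G_def)
  then have "fps_nth (F ^ n) n = fps_nth (fps_X ^ n * G ^ n) n"
    by (simp add: power_mult_distrib)
  also have "\<dots> = fps_nth (G ^ n) 0"
    by (simp add: fps_X_power_mult_nth)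
  also have "\<dots> = d c ^ n"
    by (simp add: fps_nth_power_0 G_def F_def g0_def)
  finally have "fact n * d c ^ n = fact n * fps_nth (F ^ n) n" by simp
  also have "F ^ n = (\<Sum>j\<le>n. of_nat (n choose j) * g0 d (c ^ j) * fps_const ((- c) ^ (n - j)))"
    unfolding F_def by (subst binomial_ring) (simp only: g0_power fps_const_power)
  also have "fact n * fps_nth \<dots> n = (\<Sum>j\<le>n. of_nat (n choose j) * (- c) ^ (n - j) * (d ^^ n) (c ^ j))"
    by (simp add: fps_sum_nth sum_distrib_left fps_of_nat[symmetric] g0_def mult_ac)
  finally show ?thesis .
qed

lemma d_iter_bound:
  assumes "spd < \<rho>"
  shows "\<exists>K\<ge>1. \<forall>n x. v ((d ^^ n) x) \<le> K * \<rho> ^ n * v x"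
proof -
  obtain B where "\<And>x. v (d x) \<le> B * v x" using d_bounded by blast
  then show ?thesis
    using spectral_norm_less_imp_bound[of UNIV v d B 1 \<rho>] assms v_nonneg by auto
qed

text \<open>By \<open>fact_mult_d_power\<close> and |n!| \<ge> \<omega>^n, a bound |d^n x| \<le> K
  \<tau>^n |x| forces (\<omega> |d c|)^n \<le> K (\<tau> |c|)^n for all n, hence \<tau> \<ge>
  \<omega> |d c| / |c|. Positivity makes the quotient that defines \<open>radius\<close>
  meaningful.\<close>

lemma spd_pos:
  assumes "residue_char v > 0"
  shows "0 < spd"
proof (rule ccontr)
  assume "\<not> 0 < spd"
  obtain c where c: "d c \<noteq> 0" using d_nonzero by blast
  then have "c \<noteq> 0" by auto
  have pos: "0 < v c" "0 < v (d c)"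
    using c \<open>c \<noteq> 0\<close> v_nonneg v_eq_0_iff by (auto simp: less_le)
  \<comment> \<open>The critical rate; working with half of it leads to a bound on all powers of
    2.\<close>
  define q where "q = omega v * v (d c) / v c"
  have "q > 0"
    using pos omega_pos[OF assms] by (simp add: q_def)
  then have "spd < q / 2"
    using \<open>\<not> 0 < spd\<close> by simp
  then obtain K where K: "K \<ge> 1" "\<And>n x. v ((d ^^ n) x) \<le> K * (q / 2) ^ n * v x"
    using d_iter_bound by blast
  have "q ^ n \<le> K * (q / 2) ^ n" for n
  proof -
    have "v (fact n * d c ^ n) \<le> K * (q / 2) ^ n * v c ^ n"
      unfolding fact_mult_d_power
    proof (rule v_sum_le)
      fix j assume j: "j \<in> {..n}"
      have "v (of_nat (n choose j) * (- c) ^ (n - j) * (d ^^ n) (c ^ j))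
          \<le> 1 * v c ^ (n - j) * (K * (q / 2) ^ n * v c ^ j)"
        unfolding v_mult v_power v_minus
        using K(2)[of n "c ^ j"] v_of_nat_le_1 v_nonneg
        by (intro mult_mono) (auto simp: v_power)
      also have "\<dots> = K * (q / 2) ^ n * v c ^ n"
        using j by (simp add: power_add[symmetric])
      finally show "v (of_nat (n choose j) * (- c) ^ (n - j) * (d ^^ n) (c ^ j))
          \<le> K * (q / 2) ^ n * v c ^ n" .
    qed (use K \<open>q > 0\<close> pos in auto)
    moreover have "omega v ^ n * v (d c) ^ n \<le> v (fact n * d c ^ n)"
      using v_fact_ge[OF assms, of n] pos by (simp add: v_mult v_power mult_right_mono)
    ultimately have "(omega v * v (d c)) ^ n \<le> K * (q / 2) ^ n * v c ^ n"
      by (simp add: power_mult_distrib)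
    then show ?thesis
      using pos by (simp add: q_def power_divide divide_le_eq)
  qed
  then have "2 ^ n \<le> K" for n
    using \<open>q > 0\<close> by (simp add: power_divide le_divide_eq)
  moreover obtain n where "K < 2 ^ n"
    using real_arch_pow[of 2 K] by auto
  ultimately show False
    by (meson not_less)
qed

end

section \<open>Finite-dimensional differential modules\<close>

text \<open>A differential module freed from twisted polynomials. With the operator as a parameter,
  the locale can be interpreted again for the dual operator on the same vector space.\<close>

locale diff_space = nonarch_diff_field v d + vector_space sc
  for v :: "'k::field_char_0 \<Rightarrow> real" and d :: "'k \<Rightarrow> 'k"
    and sc :: "'k \<Rightarrow> 'm::ab_group_add \<Rightarrow> 'm" +
  fixes T :: "'m \<Rightarrow> 'm"
  assumes T_add: "T (x + y) = T x + T y"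
    and T_sc: "T (sc c x) = sc c (T x) + sc (d c) x"
    and fin_dim: "\<exists>B. finite B \<and> span B = UNIV"
begin

text \<open>Linearity on a subspace, since some functionals are meaningful only on a submodule;
  their values elsewhere are arbitrary until \<open>lin_on_extend\<close> replaces them.\<close>

definition lin_on :: "'m set \<Rightarrow> ('m \<Rightarrow> 'k) \<Rightarrow> bool" where
  "lin_on N f \<longleftrightarrow> (\<forall>x\<in>N. \<forall>y\<in>N. f (x + y) = f x + f y) \<and> (\<forall>c. \<forall>x\<in>N. f (sc c x) = c * f x)"

abbreviation lin :: "('m \<Rightarrow> 'k) \<Rightarrow> bool" where
  "lin \<equiv> lin_on UNIV"

lemma lin_onD:
  assumes "lin_on N f" "subspace N"
  shows "x \<in> N \<Longrightarrow> y \<in> N \<Longrightarrow> f (x + y) = f x + f y" "x \<in> N \<Longrightarrow> f (sc c x) = c * f x"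
    "f 0 = 0" "x \<in> N \<Longrightarrow> f (- x) = - f x" "x \<in> N \<Longrightarrow> y \<in> N \<Longrightarrow> f (x - y) = f x - f y"
proof -
  show add: "f (x + y) = f x + f y" if "x \<in> N" "y \<in> N" for x y
    using assms that by (simp add: lin_on_def)
  show hom: "f (sc c x) = c * f x" if "x \<in> N" for x c
    using assms that by (simp add: lin_on_def)
  show "f 0 = 0"
    using hom[of 0 0] assms(2) by (simp add: subspace_0)
  show minus: "f (- x) = - f x" if "x \<in> N" for x
    using hom[OF that, of "-1"] by simp
  show "f (x - y) = f x - f y" if "x \<in> N" "y \<in> N"
    using add[OF that(1), of "- y"] minus[OF that(2)] that assms(2) by (simp add: subspace_neg)
qed

lemmas linD = lin_onD[where N = UNIV, OF _ subspace_UNIV, simplified]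

lemma lin_sum:
  assumes "lin f"
  shows "f (\<Sum>i\<in>I. g i) = (\<Sum>i\<in>I. f (g i))"
  by (induction I rule: infinite_finite_induct) (simp_all add: linD[OF assms])

lemma lin_comp_proj:
  assumes "lin_on N f" "\<And>x y. \<pi> (x + y) = \<pi> x + \<pi> y" "\<And>c x. \<pi> (sc c x) = sc c (\<pi> x)" "\<And>x. \<pi> x \<in> N"
  shows "lin (\<lambda>x. f (\<pi> x))"
  using assms by (simp add: lin_on_def)

lemma lin_eq_iff_linear: "lin f \<longleftrightarrow> Vector_Spaces.linear sc (*) f"
proof -
  have K: "vector_space ((*) :: 'k \<Rightarrow> 'k \<Rightarrow> 'k)"
    by unfold_locales (auto simp: algebra_simps)
  interpret K: vector_space "(*) :: 'k \<Rightarrow> 'k \<Rightarrow> 'k" by (rule K)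
  interpret vp: vector_space_pair sc "(*) :: 'k \<Rightarrow> 'k \<Rightarrow> 'k" ..
  show ?thesis
    by (auto simp: Vector_Spaces.linear_iff lin_on_def vector_space_axioms K)
qed

lemma projection_exists:
  assumes "subspace P"
  obtains \<pi> where "\<And>x y. \<pi> (x + y) = \<pi> x + \<pi> y" "\<And>c x. \<pi> (sc c x) = sc c (\<pi> x)"
    "\<And>x. \<pi> x \<in> P" "\<And>x. x \<in> P \<Longrightarrow> \<pi> x = x"
proof -
  interpret vp: vector_space_pair sc sc ..
  have "Vector_Spaces.linear sc sc (\<lambda>x. x)"
    by (auto simp: Vector_Spaces.linear_iff vector_space_axioms)
  then obtain \<pi> where "\<pi> ` UNIV \<subseteq> P" "Vector_Spaces.linear sc sc \<pi>" "\<forall>x\<in>P. \<pi> x = x"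
    using vp.linear_exists_left_inverse_on[of "\<lambda>x. x" P] assms by auto
  then show ?thesis
    by (intro that[of \<pi>]) (auto simp: Vector_Spaces.linear_iff)
qed

lemma lin_on_extend:
  assumes "subspace N" "lin_on N f"
  obtains g where "lin g" "\<And>x. x \<in> N \<Longrightarrow> g x = f x"
proof -
  obtain \<pi> where "\<And>x y. \<pi> (x + y) = \<pi> x + \<pi> y" "\<And>c x. \<pi> (sc c x) = sc c (\<pi> x)"
    "\<And>x. \<pi> x \<in> N" "\<And>x. x \<in> N \<Longrightarrow> \<pi> x = x"
    using projection_exists[OF assms(1)] by blast
  then show ?thesis
    using lin_comp_proj[OF assms(2), of \<pi>] by (intro that[of "\<lambda>x. f (\<pi> x)"]) auto
qed

lemma coordinate_functional:
  assumes "independent B"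
  obtains f where "lin f" "\<And>x. x \<in> B \<Longrightarrow> f x = g x"
proof -
  have K: "vector_space ((*) :: 'k \<Rightarrow> 'k \<Rightarrow> 'k)"
    by unfold_locales (auto simp: algebra_simps)
  interpret K: vector_space "(*) :: 'k \<Rightarrow> 'k \<Rightarrow> 'k" by (rule K)
  interpret vp: vector_space_pair sc "(*) :: 'k \<Rightarrow> 'k \<Rightarrow> 'k" ..
  show ?thesis
    using vp.linear_independent_extend[OF assms, of g] that by (auto simp: lin_eq_iff_linear)
qed

lemma lin_eq_on_span:
  assumes "lin f" "lin g" "\<And>b. b \<in> B \<Longrightarrow> f b = g b" "x \<in> span B"
  shows "f x = g x"
  using assms(4)
  by (induction rule: span_induct_alt) (simp_all add: linD[OF assms(1)] linD[OF assms(2)] assms(3))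

lemma lin_zero: "lin (\<lambda>_. 0)"
  by (simp add: lin_on_def)

lemma independent_finite:
  assumes "independent B"
  shows "finite B"
  using fin_dim independent_span_bound[of _ B] assms by auto

text \<open>\<open>B\<close> is what a basis of \<open>Z\<close> lacks to be a basis of
  \<open>P\<close>. It represents a basis of P/Z, and the \<beta> are its dual coordinates, lifted
  to functionals on \<open>M\<close>; computations in P/Z thus stay inside \<open>M\<close>.\<close>

lemma coordinates_mod:
  assumes "subspace Z" "subspace P" "Z \<subseteq> P"
  obtains B \<beta> where "finite B" "B \<subseteq> P" "B \<inter> Z = {}" "\<And>b. lin (\<beta> b)"
    "\<And>b z. b \<in> B \<Longrightarrow> z \<in> Z \<Longrightarrow> \<beta> b z = 0"
    "\<And>x. x \<in> P \<Longrightarrow> x - (\<Sum>b\<in>B. sc (\<beta> b x) b) \<in> Z"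
    "\<And>b c. b \<in> B \<Longrightarrow> c \<in> B \<Longrightarrow> \<beta> b c = (if b = c then 1 else 0)"
proof -
  obtain B0 where B0: "B0 \<subseteq> Z" "independent B0" "Z \<subseteq> span B0"
    using maximal_independent_subset[of Z] by blast
  obtain B1 where B1: "B0 \<subseteq> B1" "B1 \<subseteq> P" "independent B1" "P \<subseteq> span B1"
    using maximal_independent_subset_extend[of B0 P] B0 assms by (metis subset_trans)
  have fin: "finite B1" using B1 by (intro independent_finite)
  have "\<exists>f. lin f \<and> (\<forall>x\<in>B1. f x = (if b = x then 1 else 0))" for b
    using coordinate_functional[OF B1(3), of "\<lambda>x. if b = x then 1 else 0"] by metis
  then obtain \<beta> where \<beta>: "\<And>b. lin (\<beta> b)" "\<And>b x. x \<in> B1 \<Longrightarrow> \<beta> b x = (if b = x then 1 else 0)"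
    by metis
  have spanZ: "span B0 \<subseteq> Z" using B0 assms(1) by (simp add: span_minimal)
  have rep: "x = (\<Sum>b\<in>B1. sc (\<beta> b x) b)" if "x \<in> span B1" for x
    using that
  proof (induction rule: span_induct_alt)
    case base
    then show ?case by (simp add: linD[OF \<beta>(1)])
  next
    case (step c x y)
    have "(\<Sum>b\<in>B1. sc (\<beta> b (sc c x + y)) b) = sc c (\<Sum>b\<in>B1. sc (\<beta> b x) b) + (\<Sum>b\<in>B1. sc (\<beta> b y) b)"
      by (simp add: linD[OF \<beta>(1)] scale_left_distrib sum.distrib scale_sum_right)
    moreover have "(\<Sum>b\<in>B1. sc (\<beta> b x) b) = (\<Sum>b\<in>B1. if b = x then x else 0)"
      using step by (intro sum.cong) (auto simp: \<beta>(2))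
    then have "(\<Sum>b\<in>B1. sc (\<beta> b x) b) = x"
      using step fin by simp
    ultimately show ?case
      using step by simp
  qed
  show thesis
  proof (rule that[of "B1 - B0" \<beta>])
    have "b \<notin> span B0" if "b \<in> B1" "b \<notin> B0" for b
    proof -
      have "span B0 \<subseteq> span (B1 - {b})"
        using B1(1) that(2) by (intro span_mono) auto
      then show ?thesis
        using B1(3) that(1) by (auto simp: dependent_def)
    qed
    then show "(B1 - B0) \<inter> Z = {}"
      using B0(3) by auto
    show "\<beta> b z = 0" if "b \<in> B1 - B0" "z \<in> Z" for b z
    proof (rule lin_eq_on_span[OF \<beta>(1) lin_zero])
      show "z \<in> span B0" using that B0 by auto
    qed (use that B1 \<beta>(2) in auto)
    show "x - (\<Sum>b\<in>B1 - B0. sc (\<beta> b x) b) \<in> Z" if "x \<in> P" for x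
    proof -
      have "x = (\<Sum>b\<in>B1. sc (\<beta> b x) b)" using rep that B1(4) by blast
      also have "\<dots> = (\<Sum>b\<in>B1 - B0. sc (\<beta> b x) b) + (\<Sum>b\<in>B0. sc (\<beta> b x) b)"
        using fin B1(1) by (simp add: sum.subset_diff)
      finally have "x - (\<Sum>b\<in>B1 - B0. sc (\<beta> b x) b) = (\<Sum>b\<in>B0. sc (\<beta> b x) b)"
        by (metis add_diff_cancel_left')
      then show ?thesis
        using B0 assms(1) by (auto intro!: subspace_sum subspace_scale)
    qed
  qed (use fin B1 \<beta> in auto)
qed

lemma separating_functional:
  assumes "subspace S" "x \<notin> S"
  obtains f where "lin f" "\<And>y. y \<in> S \<Longrightarrow> f y = 0" "f x = 1"
proof -
  obtain B \<beta> where B: "finite B" "B \<inter> S = {}" "\<And>b. lin (\<beta> b)"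
    "\<And>b z. b \<in> B \<Longrightarrow> z \<in> S \<Longrightarrow> \<beta> b z = 0"
    "\<And>x. x - (\<Sum>b\<in>B. sc (\<beta> b x) b) \<in> S"
    by (rule coordinates_mod[OF assms(1) subspace_UNIV]) auto
  have "\<exists>b\<in>B. \<beta> b x \<noteq> 0"
  proof (rule ccontr)
    assume "\<not> ?thesis"
    then have "x - 0 \<in> S" using B(5)[of x] by simp
    then show False using assms by simp
  qed
  then obtain b where b: "b \<in> B" "\<beta> b x \<noteq> 0" by blast
  show ?thesis
    using b B(4)[OF b(1)] B(3)[of b]
    by (intro that[of "\<lambda>y. inverse (\<beta> b x) * \<beta> b y"]) (auto simp: lin_on_def algebra_simps)
qed

lemma subspace_eq_span_union:
  assumes "subspace H" "L \<subseteq> H"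
  obtains B where "finite B" "B \<subseteq> H" "H = span (L \<union> B)"
proof -
  obtain B where B: "B \<subseteq> H" "independent B" "H \<subseteq> span B"
    using maximal_independent_subset[of H] by blast
  have "span (L \<union> B) \<subseteq> H"
    using assms B by (intro span_minimal) auto
  moreover have "H \<subseteq> span (L \<union> B)"
    using B span_mono[of B "L \<union> B"] by auto
  ultimately show ?thesis
    using B independent_finite that by blast
qed

lemma dim_strict_mono:
  assumes "subspace S" "subspace S'" "S \<subset> S'"
  shows "dim S < dim S'"
proof -
  obtain B where B: "independent B" "span B = UNIV"
    using basis_exists[of UNIV] by (metis top.extremum_uniqueI)
  interpret finite_dimensional_vector_space sc B
    using B independent_finite by unfold_locales auto
  show ?thesis
    using assms dim_psubset span_eq_iff by metis
qed

lemma dim_le: "S \<subseteq> S' \<Longrightarrow> dim S \<le> dim S'"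
proof -
  obtain B where B: "independent B" "span B = UNIV"
    using basis_exists[of UNIV] by (metis top.extremum_uniqueI)
  interpret finite_dimensional_vector_space sc B
    using B independent_finite by unfold_locales auto
  show "S \<subseteq> S' \<Longrightarrow> dim S \<le> dim S'"
    by (rule dim_subset)
qed

section \<open>Equivalence of norms\<close>

text \<open>A norm on N/L, pulled back to \<open>N\<close>.\<close>

definition norm_mod :: "'m set \<Rightarrow> 'm set \<Rightarrow> ('m \<Rightarrow> real) \<Rightarrow> bool" where
  "norm_mod N L \<nu> \<longleftrightarrow> (\<forall>x\<in>N. 0 \<le> \<nu> x) \<and> (\<forall>x\<in>N. \<nu> x = 0 \<longleftrightarrow> x \<in> L) \<and>
    (\<forall>c. \<forall>x\<in>N. \<nu> (sc c x) = v c * \<nu> x) \<and> (\<forall>x\<in>N. \<forall>y\<in>N. \<nu> (x + y) \<le> max (\<nu> x) (\<nu> y))"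

definition complete_for :: "('m \<Rightarrow> real) \<Rightarrow> 'm set \<Rightarrow> bool" where
  "complete_for \<nu> H \<longleftrightarrow> (\<forall>X. (\<forall>n. X n \<in> H) \<longrightarrow>
    (\<forall>e>0. \<exists>n0. \<forall>m\<ge>n0. \<forall>n\<ge>n0. \<nu> (X m - X n) < e) \<longrightarrow> (\<exists>l\<in>H. (\<lambda>n. \<nu> (X n - l)) \<longlonglongrightarrow> 0))"

context
  fixes N L :: "'m set" and \<nu> :: "'m \<Rightarrow> real"
  assumes N: "subspace N" and L: "subspace L" "L \<subseteq> N" and nm: "norm_mod N L \<nu>"
begin

lemma nu_nonneg: "x \<in> N \<Longrightarrow> 0 \<le> \<nu> x"
  using nm by (simp add: norm_mod_def)
lemma nu_0_iff: "x \<in> N \<Longrightarrow> \<nu> x = 0 \<longleftrightarrow> x \<in> L"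
  using nm by (simp add: norm_mod_def)
lemma nu_sc: "x \<in> N \<Longrightarrow> \<nu> (sc c x) = v c * \<nu> x"
  using nm by (simp add: norm_mod_def)
lemma nu_add: "x \<in> N \<Longrightarrow> y \<in> N \<Longrightarrow> \<nu> (x + y) \<le> max (\<nu> x) (\<nu> y)"
  using nm by (simp add: norm_mod_def)
lemma nu_minus: "x \<in> N \<Longrightarrow> \<nu> (- x) = \<nu> x"
  using nu_sc[of x "-1"] by simp
lemma nu_diff: "x \<in> N \<Longrightarrow> y \<in> N \<Longrightarrow> \<nu> (x - y) \<le> max (\<nu> x) (\<nu> y)"
  using nu_add[of x "- y"] nu_minus[of y] N by (simp add: subspace_neg)

lemma nu_sum_le:
  assumes "finite I" "\<And>i. i \<in> I \<Longrightarrow> g i \<in> N" "\<And>i. i \<in> I \<Longrightarrow> \<nu> (g i) \<le> B" "0 \<le> B"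
  shows "\<nu> (\<Sum>i\<in>I. g i) \<le> B"
  using assms
proof (induction I rule: finite_induct)
  case empty
  then show ?case using nu_0_iff[of 0] N L by (simp add: subspace_0)
next
  case (insert i I)
  then have "\<nu> (g i + (\<Sum>i\<in>I. g i)) \<le> max (\<nu> (g i)) (\<nu> (\<Sum>i\<in>I. g i))"
    using N by (intro nu_add subspace_sum) auto
  also have "\<dots> \<le> B"
    using insert by simp
  finally show ?case using insert by simp
qed

text \<open>A complete subspace is closed: approximations of \<open>e\<close> from \<open>H\<close>
  would form a Cauchy sequence, whose limit in \<open>H\<close> differs from \<open>e\<close> by an
  element of \<open>L\<close>, hence of \<open>H\<close>.\<close>

lemma complete_imp_distance_pos:
  assumes "complete_for \<nu> H" "subspace H" "L \<subseteq> H" "H \<subseteq> N" "e \<in> N" "e \<notin> H"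
  shows "\<exists>c>0. \<forall>h\<in>H. c \<le> \<nu> (e - h)"
proof (rule ccontr)
  assume "\<not> ?thesis"
  then have "\<forall>n. \<exists>h\<in>H. \<nu> (e - h) < 1 / real (Suc n)"
    by (auto simp: not_le)
  then obtain h where h: "\<And>n. h n \<in> H" "\<And>n. \<nu> (e - h n) < 1 / real (Suc n)"
    by metis
  have hN: "h n \<in> N" "e - h n \<in> N" for n
    using h assms N by (auto intro!: subspace_diff)
  have lim: "(\<lambda>n. \<nu> (e - h n)) \<longlonglongrightarrow> 0"
    using h(2) nu_nonneg[OF hN(2)]
    by (intro tendsto_sandwich[OF _ _ tendsto_const LIMSEQ_Suc[OF lim_1_over_n]])
       (auto intro!: always_eventually less_imp_le)
  have "\<exists>l\<in>H. (\<lambda>n. \<nu> (h n - l)) \<longlonglongrightarrow> 0"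
  proof (rule assms(1)[unfolded complete_for_def, rule_format, of h])
    fix r :: real assume "0 < r"
    then obtain n0 where n0: "\<And>n. n \<ge> n0 \<Longrightarrow> \<nu> (e - h n) < r"
      using lim nu_nonneg[OF hN(2)] by (simp add: LIMSEQ_iff) meson
    have "\<nu> (h m - h n) < r" if "m \<ge> n0" "n \<ge> n0" for m n
      using nu_diff[OF hN(2)[of n] hN(2)[of m]] n0[OF that(1)] n0[OF that(2)] by simp
    then show "\<exists>n0. \<forall>m\<ge>n0. \<forall>n\<ge>n0. \<nu> (h m - h n) < r" by blast
  qed (rule h)
  then obtain l where l: "l \<in> H" "(\<lambda>n. \<nu> (h n - l)) \<longlonglongrightarrow> 0" by blast
  have lN: "l \<in> N" "e - l \<in> N" "\<And>n. h n - l \<in> N"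
    using l hN assms N by (auto intro: subspace_diff)
  have "\<nu> (e - l) \<le> \<nu> (e - h n) + \<nu> (h n - l)" for n
    using nu_add[OF hN(2)[of n] lN(3)[of n]] nu_nonneg[OF hN(2)[of n]] nu_nonneg[OF lN(3)[of n]]
    by simp
  moreover have "(\<lambda>n. \<nu> (e - h n) + \<nu> (h n - l)) \<longlonglongrightarrow> 0 + 0"
    using lim l(2) by (intro tendsto_add)
  ultimately have "\<nu> (e - l) \<le> 0"
    by (intro LIMSEQ_le_const[of _ 0]) auto
  then have "e - l \<in> L"
    using nu_nonneg[OF lN(2)] nu_0_iff[OF lN(2)] by simp
  then have "e - l + l \<in> H"
    using assms l by (intro subspace_add) auto
  then show False using assms by simp
qed

text \<open>The lower bound c |a| \<le> \<nu>(g + a e) makes the coefficients of \<open>e\<close> a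
  Cauchy sequence in the complete field; then the components in \<open>H\<close> form a Cauchy
  sequence as well.\<close>

lemma complete_for_insert:
  assumes "complete_for \<nu> H" "subspace H" "L \<subseteq> H" "H \<subseteq> N" "e \<in> N" "e \<notin> H"
  shows "complete_for \<nu> (span (insert e H))"
  unfolding complete_for_def
proof (intro allI impI)
  fix X :: "nat \<Rightarrow> 'm" assume X: "\<forall>n. X n \<in> span (insert e H)"
    and Cauchy: "\<forall>r>0. \<exists>n0. \<forall>m\<ge>n0. \<forall>n\<ge>n0. \<nu> (X m - X n) < r"
  obtain c where c: "c > 0" "\<And>h. h \<in> H \<Longrightarrow> c \<le> \<nu> (e - h)"
    using complete_imp_distance_pos[OF assms] by blast
  have "\<exists>k. X n - sc k e \<in> H" for n
    using X span_breakdown_eq[of "X n" e H] assms(2) by (metis span_eq_iff)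
  then obtain k where k: "\<And>n. X n - sc (k n) e \<in> H" by metis
  define h where "h n = X n - sc (k n) e" for n
  have h: "h n \<in> H" "h n \<in> N" and Xn: "X n = h n + sc (k n) e" for n
    using k assms by (auto simp: h_def)
  have eN: "sc a e \<in> N" for a using assms N by (simp add: subspace_scale)
  have XN: "X n \<in> N" for n
    unfolding Xn using h eN N by (intro subspace_add)
  have key: "c * v a \<le> \<nu> (g + sc a e)" if "g \<in> H" for a g
  proof (cases "a = 0")
    case True
    then show ?thesis
      using nu_nonneg[of g] that assms by auto
  next
    case False
    have "g + sc a e = sc a (e - sc (- inverse a) g)"
      using False by (simp add: scale_right_distrib add.commute)
    then have "\<nu> (g + sc a e) = v a * \<nu> (e - sc (- inverse a) g)"
      using assms that N by (metis nu_sc subset_iff subspace_diff subspace_scale)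
    then show ?thesis
      using c(2)[of "sc (- inverse a) g"] that assms v_nonneg[of a]
      by (metis mult.commute mult_left_mono subspace_scale)
  qed
  have diffX: "X m - X n = (h m - h n) + sc (k m - k n) e" for m n
    by (simp add: Xn scale_left_diff_distrib)
  have "\<exists>l. (\<lambda>n. v (k n - l)) \<longlonglongrightarrow> 0"
  proof (rule v_Cauchy_convergent)
    fix r :: real assume "0 < r"
    then have "c * r > 0" using c by simp
    then obtain n0 where n0: "\<And>m n. m \<ge> n0 \<Longrightarrow> n \<ge> n0 \<Longrightarrow> \<nu> (X m - X n) < c * r"
      using Cauchy by meson
    have "v (k m - k n) < r" if "m \<ge> n0" "n \<ge> n0" for m n
    proof -
      have "c * v (k m - k n) \<le> \<nu> (X m - X n)"
        unfolding diffX using h assms by (intro key subspace_diff) auto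
      also have "\<dots> < c * r" using n0 that by blast
      finally show ?thesis using c by simp
    qed
    then show "\<exists>n0. \<forall>m\<ge>n0. \<forall>n\<ge>n0. v (k m - k n) < r" by blast
  qed
  then obtain a where a: "(\<lambda>n. v (k n - a)) \<longlonglongrightarrow> 0" by blast
  have lim_e: "(\<lambda>n. \<nu> (sc (k n - a) e)) \<longlonglongrightarrow> 0"
    using tendsto_mult_right[OF a, of "\<nu> e"] assms by (simp add: nu_sc)
  have "\<exists>l\<in>H. (\<lambda>n. \<nu> (h n - l)) \<longlonglongrightarrow> 0"
  proof (rule assms(1)[unfolded complete_for_def, rule_format, of h])
    fix r :: real assume "0 < r"
    then obtain n1 where n1: "\<And>m n. m \<ge> n1 \<Longrightarrow> n \<ge> n1 \<Longrightarrow> \<nu> (X m - X n) < r"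
      using Cauchy by meson
    obtain n2 where n2: "\<And>n. n \<ge> n2 \<Longrightarrow> \<nu> (sc (k n - a) e) < r"
      using lim_e \<open>0 < r\<close> nu_nonneg[OF eN] by (simp add: LIMSEQ_iff) meson
    have "\<nu> (h m - h n) < r" if "m \<ge> max n1 n2" "n \<ge> max n1 n2" for m n
    proof -
      have "h m - h n = (X m - X n) - (sc (k m - a) e - sc (k n - a) e)"
        by (simp add: h_def scale_left_diff_distrib)
      also have "\<nu> \<dots> \<le> max (\<nu> (X m - X n)) (\<nu> (sc (k m - a) e - sc (k n - a) e))"
        using XN eN N by (intro nu_diff subspace_diff)
      also have "\<dots> \<le> max (\<nu> (X m - X n)) (max (\<nu> (sc (k m - a) e)) (\<nu> (sc (k n - a) e)))"
        using nu_diff[OF eN[of "k m - a"] eN[of "k n - a"]] by simp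
      also have "\<dots> < r" using n1 n2 that by simp
      finally show ?thesis .
    qed
    then show "\<exists>n0. \<forall>m\<ge>n0. \<forall>n\<ge>n0. \<nu> (h m - h n) < r" by blast
  qed (rule h)
  then obtain l where l: "l \<in> H" "(\<lambda>n. \<nu> (h n - l)) \<longlonglongrightarrow> 0" by blast
  have hl: "h n - l \<in> N" for n using h l assms N by (intro subspace_diff) auto
  show "\<exists>l\<in>span (insert e H). (\<lambda>n. \<nu> (X n - l)) \<longlonglongrightarrow> 0"
  proof (rule bexI[of _ "l + sc a e"])
    show "l + sc a e \<in> span (insert e H)"
      using l by (intro span_add span_scale) (auto intro: span_base)
    have eq: "X n - (l + sc a e) = (h n - l) + sc (k n - a) e" for n
      by (simp add: Xn scale_left_diff_distrib)
    have le: "\<nu> (X n - (l + sc a e)) \<le> \<nu> (h n - l) + \<nu> (sc (k n - a) e)" for n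
      unfolding eq
      using nu_add[OF hl eN, of n "k n - a"] nu_nonneg[OF hl[of n]] nu_nonneg[OF eN[of "k n - a"]]
      by linarith
    have ge: "0 \<le> \<nu> (X n - (l + sc a e))" for n
      using XN l eN assms N by (intro nu_nonneg subspace_diff subspace_add) auto
    have "(\<lambda>n. \<nu> (h n - l) + \<nu> (sc (k n - a) e)) \<longlonglongrightarrow> 0"
      using tendsto_add[OF l(2) lim_e] by simp
    then show "(\<lambda>n. \<nu> (X n - (l + sc a e))) \<longlonglongrightarrow> 0"
      by (rule tendsto_sandwich[rotated 3]) (auto intro!: always_eventually le ge)
  qed
qed

lemma complete_for_subspace:
  assumes "subspace H" "L \<subseteq> H" "H \<subseteq> N"
  shows "complete_for \<nu> H"
proof -
  obtain B where B: "finite B" "B \<subseteq> H" "H = span (L \<union> B)"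
    using subspace_eq_span_union[OF assms(1,2)] by blast
  have "complete_for \<nu> (span (L \<union> B))"
    using B(1) subset_trans[OF B(2) assms(3)]
  proof (induction B rule: finite_induct)
    case empty
    have "complete_for \<nu> L"
      unfolding complete_for_def
    proof (intro allI impI)
      fix X :: "nat \<Rightarrow> 'm" assume "\<forall>n. X n \<in> L"
      then have "\<nu> (X n - 0) = 0" for n using nu_0_iff[of "X n"] L by auto
      then show "\<exists>l\<in>L. (\<lambda>n. \<nu> (X n - l)) \<longlonglongrightarrow> 0"
        using L by (intro bexI[of _ 0]) (auto simp: subspace_0)
    qed
    then show ?case using L span_eq_iff by (metis Un_empty_right)
  next
    case (insert e B)
    show ?case
    proof (cases "e \<in> span (L \<union> B)")
      case True
      then have "span (L \<union> insert e B) = span (L \<union> B)"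
        by (simp add: span_redundant)
      then show ?thesis using insert by simp
    next
      case False
      have "span (insert e (span (L \<union> B))) = span (L \<union> insert e B)"
        by (metis Un_insert_right span_insert span_span)
      moreover have "L \<subseteq> span (L \<union> B)"
        by (meson Un_upper1 span_superset subset_trans)
      moreover have "span (L \<union> B) \<subseteq> N"
        using L insert N by (intro span_minimal) auto
      ultimately show ?thesis
        using complete_for_insert[of "span (L \<union> B)" e] insert False by auto
    qed
  qed
  then show ?thesis using B(3) by simp
qed

text \<open>The classical continuity argument over a complete field: the kernel \<open>H\<close> is
  complete, hence at positive distance \<open>c\<close> from \<open>e\<close>, and e - (f e / f x) x
  lies in \<open>H\<close> whenever f x is nonzero.\<close>

lemma functional_bounded:
  assumes "lin f" "\<And>z. z \<in> L \<Longrightarrow> f z = 0"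
  shows "\<exists>C\<ge>0. \<forall>x\<in>N. v (f x) \<le> C * \<nu> x"
proof (cases "\<forall>x\<in>N. f x = 0")
  case True
  then show ?thesis by (intro exI[of _ 0]) auto
next
  case False
  then obtain e where e: "e \<in> N" "f e \<noteq> 0" by blast
  define H where "H = {x \<in> N. f x = 0}"
  have H: "subspace H" "L \<subseteq> H" "H \<subseteq> N" "e \<notin> H"
    using N L assms e by (auto simp: H_def subspace_def linD)
  obtain c where c: "c > 0" "\<And>h. h \<in> H \<Longrightarrow> c \<le> \<nu> (e - h)"
    using complete_imp_distance_pos[OF complete_for_subspace] H e by metis
  have "v (f x) \<le> v (f e) / c * \<nu> x" if "x \<in> N" for x
  proof (cases "f x = 0")
    case True
    then show ?thesis using nu_nonneg[OF that] c v_nonneg[of "f e"] by simp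
  next
    case False
    define a where "a = f e / f x"
    have "e - sc a x \<in> H"
      using e that N False by (auto simp: H_def a_def subspace_diff subspace_scale linD[OF assms(1)])
    then have "c \<le> \<nu> (e - (e - sc a x))" by (rule c(2))
    then have "c \<le> v (f e) / v (f x) * \<nu> x"
      using that by (simp add: nu_sc a_def v_divide)
    then show ?thesis
      using False c v_nonneg[of "f x"] v_eq_0_iff[of "f x"] by (simp add: field_simps)
  qed
  then show ?thesis
    using c v_nonneg[of "f e"] by (intro exI[of _ "v (f e) / c"]) auto
qed

end

end

section \<open>Growth of iterates\<close>

lemma (in nonarch_diff_field) spd_nonneg: "0 \<le> spd"
  unfolding spectral_norm_def by (intro cINF_greatest) auto

text \<open>No bound is asked at the rate \<rho> itself, as a radius of convergence only controls
  the smaller discs; the constant may depend on \<rho>'.\<close>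

definition (in nonarch_diff_field) growth :: "real \<Rightarrow> (nat \<Rightarrow> 'k) \<Rightarrow> bool" where
  "growth \<rho> a \<longleftrightarrow> (\<forall>\<rho>'>\<rho>. \<exists>C. \<forall>i. v (a i) \<le> C * \<rho>' ^ i)"

lemma (in nonarch_diff_field) growthE:
  assumes "growth \<rho> a" "\<rho> < \<rho>'"
  obtains C where "0 \<le> C" "\<And>i. v (a i) \<le> C * \<rho>' ^ i"
proof -
  obtain C where C: "\<And>i. v (a i) \<le> C * \<rho>' ^ i"
    using assms by (auto simp: growth_def)
  moreover have "0 \<le> C"
    using C[of 0] v_nonneg[of "a 0"] by simp
  ultimately show ?thesis using that by blast
qed

lemma (in nonarch_diff_field) growth_add:
  assumes "growth \<rho> a" "growth \<rho> b" "0 \<le> \<rho>"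
  shows "growth \<rho> (\<lambda>i. a i + b i)"
  unfolding growth_def
proof (intro allI impI)
  fix \<rho>' assume r: "\<rho> < \<rho>'"
  obtain C D where C: "0 \<le> C" "\<And>i. v (a i) \<le> C * \<rho>' ^ i" and D: "0 \<le> D" "\<And>i. v (b i) \<le> D * \<rho>' ^ i"
    using growthE[OF assms(1) r] growthE[OF assms(2) r] by metis
  have "v (a i + b i) \<le> (C + D) * \<rho>' ^ i" for i
  proof -
    have "0 \<le> C * \<rho>' ^ i" "0 \<le> D * \<rho>' ^ i" using C D assms r by simp_all
    then show ?thesis
      using v_ultra[of "a i" "b i"] C(2)[of i] D(2)[of i] by (simp add: distrib_right)
  qed
  then show "\<exists>C. \<forall>i. v (a i + b i) \<le> C * \<rho>' ^ i" by blast
qed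

lemma (in nonarch_diff_field) growth_Suc:
  assumes "growth \<rho> a" "0 \<le> \<rho>"
  shows "growth \<rho> (\<lambda>i. a (Suc i))"
  unfolding growth_def
proof (intro allI impI)
  fix \<rho>' assume r: "\<rho> < \<rho>'"
  obtain C where C: "\<And>i. v (a i) \<le> C * \<rho>' ^ i"
    using growthE[OF assms(1) r] by metis
  have "v (a (Suc i)) \<le> C * \<rho>' * \<rho>' ^ i" for i
    using C[of "Suc i"] by (simp add: mult_ac)
  then show "\<exists>C. \<forall>i. v (a (Suc i)) \<le> C * \<rho>' ^ i" by blast
qed

lemma (in nonarch_diff_field) growth_0: "growth \<rho> (\<lambda>i. 0)"
  unfolding growth_def by (auto intro: exI[of _ 0])

lemma (in nonarch_diff_field) growth_mono: "growth \<rho> a \<Longrightarrow> \<rho> \<le> \<rho>' \<Longrightarrow> growth \<rho>' a"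
  by (simp add: growth_def)

context diff_space
begin

lemma T_0 [simp]: "T 0 = 0"
  using T_add[of 0 0] by simp

lemma T_minus: "T (- x) = - T x"
  using T_add[of x "- x"] by (simp add: add_eq_0_iff)

lemma T_diff: "T (x - y) = T x - T y"
  using T_add[of x "- y"] by (simp add: T_minus)

lemma T_iter_add: "(T ^^ n) (x + y) = (T ^^ n) x + (T ^^ n) y"
  by (induction n) (simp_all add: T_add)

lemma T_iter_0 [simp]: "(T ^^ n) 0 = 0"
  by (induction n) simp_all

lemma T_iter_diff: "(T ^^ n) (x - y) = (T ^^ n) x - (T ^^ n) y"
  by (induction n) (simp_all add: T_diff)

lemma T_iter_sum: "(T ^^ n) (\<Sum>i\<in>I. g i) = (\<Sum>i\<in>I. (T ^^ n) (g i))"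
  by (induction I rule: infinite_finite_induct) (simp_all add: T_iter_add)

lemma T_sum: "T (\<Sum>i\<in>I. g i) = (\<Sum>i\<in>I. T (g i))"
  by (induction I rule: infinite_finite_induct) (simp_all add: T_add)

definition tsub :: "'m set \<Rightarrow> bool" where
  "tsub N \<longleftrightarrow> subspace N \<and> (\<forall>x\<in>N. T x \<in> N)"

lemma tsub_subspace: "tsub N \<Longrightarrow> subspace N"
  by (simp add: tsub_def)

lemma tsub_iter: "tsub N \<Longrightarrow> x \<in> N \<Longrightarrow> (T ^^ n) x \<in> N"
  by (induction n) (auto simp: tsub_def)

lemma tsub_0: "tsub {0}"
  by (simp add: tsub_def subspace_def)

lemma tsub_UNIV: "tsub UNIV"
  by (simp add: tsub_def)

definition irr :: "'m set \<Rightarrow> 'm set \<Rightarrow> bool" where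
  "irr P Z \<longleftrightarrow> tsub P \<and> tsub Z \<and> Z \<subset> P \<and> (\<forall>Q. tsub Q \<and> Z \<subseteq> Q \<and> Q \<subseteq> P \<longrightarrow> Q = Z \<or> Q = P)"

text \<open>Growth of the image of x in M/L: the functionals vanishing on \<open>L\<close> are those
  of the quotient.\<close>

definition growth_mod :: "real \<Rightarrow> 'm set \<Rightarrow> 'm \<Rightarrow> bool" where
  "growth_mod \<rho> L x \<longleftrightarrow> (\<forall>f. lin f \<longrightarrow> (\<forall>z\<in>L. f z = 0) \<longrightarrow> growth \<rho> (\<lambda>i. f ((T ^^ i) x)))"

text \<open>T^n(c x) is an integral combination of the terms d^k(c) T^j(x) with k + j = n, and
  integers have absolute value at most 1. Splitting T(c x) = c T(x) + d(c) x inside the induction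
  keeps binomial coefficients out of sight.\<close>

lemma leibniz_bound:
  assumes N: "tsub N" and "x \<in> N"
    and add: "\<And>x y. x \<in> N \<Longrightarrow> y \<in> N \<Longrightarrow> \<nu> (x + y) \<le> max (\<nu> x) (\<nu> y)"
    and sc: "\<And>c x. x \<in> N \<Longrightarrow> \<nu> (sc c x) \<le> v c * \<nu> x"
    and B: "\<And>k j. k + j = n \<Longrightarrow> v ((d ^^ k) c) * \<nu> ((T ^^ j) x) \<le> (B :: real)"
  shows "\<nu> ((T ^^ n) (sc c x)) \<le> B"
  using assms(2) B
proof (induction n arbitrary: c x)
  case 0
  then show ?case using sc[of x c] 0(2)[of 0 0] by simp
next
  case (Suc n)
  have Tx: "T x \<in> N" using N Suc.prems by (simp add: tsub_def)
  have eq: "(T ^^ Suc n) (sc c x) = (T ^^ n) (sc c (T x)) + (T ^^ n) (sc (d c) x)"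
    by (simp only: funpow_Suc_right o_def T_sc T_iter_add)
  have "\<nu> ((T ^^ n) (sc c (T x))) \<le> B"
  proof (rule Suc.IH[OF Tx])
    fix k j assume "k + j = n"
    then show "v ((d ^^ k) c) * \<nu> ((T ^^ j) (T x)) \<le> B"
      using Suc.prems(2)[of k "Suc j"] by (simp add: funpow_swap1)
  qed
  moreover have "\<nu> ((T ^^ n) (sc (d c) x)) \<le> B"
  proof (rule Suc.IH[OF Suc.prems(1)])
    fix k j assume "k + j = n"
    then show "v ((d ^^ k) (d c)) * \<nu> ((T ^^ j) x) \<le> B"
      using Suc.prems(2)[of "Suc k" j] by (simp add: funpow_swap1)
  qed
  moreover have "sc a y \<in> N" if "y \<in> N" for a y
    using that N by (simp add: tsub_def subspace_scale)
  ultimately show ?case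
    unfolding eq using add[of "(T ^^ n) (sc c (T x))" "(T ^^ n) (sc (d c) x)"] Tx Suc.prems(1)
    by (simp add: tsub_iter[OF N])
qed

lemma lin_leibniz_bound:
  assumes "lin f" "\<And>k j. k + j = n \<Longrightarrow> v ((d ^^ k) c) * v (f ((T ^^ j) x)) \<le> B"
  shows "v (f ((T ^^ n) (sc c x))) \<le> B"
  by (rule leibniz_bound[OF tsub_UNIV, where \<nu> = "\<lambda>x. v (f x)"])
     (simp_all add: linD[OF assms(1)] v_ultra v_mult assms(2))

text \<open>Stability under scalars rests on \<open>spd \<le> \<rho>\<close>: the iterates d^k(c)
  grow at most like \<rho>'^k for each \<rho>' > \<rho>, so the Leibniz rule preserves the
  rate.\<close>

lemma growth_tsub:
  assumes f: "lin f" and \<rho>: "spd \<le> \<rho>"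
  shows "tsub {x. growth \<rho> (\<lambda>i. f ((T ^^ i) x))}"
proof -
  have \<rho>0: "0 \<le> \<rho>" using \<rho> spd_nonneg by linarith
  have "growth \<rho> (\<lambda>i. f ((T ^^ i) (sc c x)))" if g: "growth \<rho> (\<lambda>i. f ((T ^^ i) x))" for c x
    unfolding growth_def
  proof (intro allI impI)
    fix \<rho>' assume r: "\<rho> < \<rho>'"
    obtain K where K: "K \<ge> 1" "\<And>n x. v ((d ^^ n) x) \<le> K * \<rho>' ^ n * v x"
      using d_iter_bound[of \<rho>'] r \<rho> by auto
    obtain C where C: "0 \<le> C" "\<And>i. v (f ((T ^^ i) x)) \<le> C * \<rho>' ^ i"
      using growthE[OF g r] by metis
    have "v (f ((T ^^ i) (sc c x))) \<le> (K * v c * C) * \<rho>' ^ i" for i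
    proof (rule lin_leibniz_bound[OF f])
      fix k j assume i: "k + j = i"
      have "v ((d ^^ k) c) * v (f ((T ^^ j) x)) \<le> (K * \<rho>' ^ k * v c) * (C * \<rho>' ^ j)"
        using K C r \<rho>0 v_nonneg by (intro mult_mono) auto
      also have "\<dots> = (K * v c * C) * \<rho>' ^ i"
        by (simp add: i[symmetric] power_add)
      finally show "v ((d ^^ k) c) * v (f ((T ^^ j) x)) \<le> (K * v c * C) * \<rho>' ^ i" .
    qed
    then show "\<exists>C. \<forall>i. v (f ((T ^^ i) (sc c x))) \<le> C * \<rho>' ^ i" by blast
  qed
  moreover have "growth \<rho> (\<lambda>i. f ((T ^^ i) (T x)))" if g: "growth \<rho> (\<lambda>i. f ((T ^^ i) x))" for x
    using growth_Suc[OF g \<rho>0] by (simp add: funpow_swap1)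
  ultimately show ?thesis
    using \<rho>0 by (auto simp: tsub_def subspace_def T_iter_add linD[OF f] growth_0 growth_add)
qed

lemma growth_mod_tsub:
  assumes "spd \<le> \<rho>"
  shows "tsub {x. growth_mod \<rho> L x}"
proof -
  have "{x. growth_mod \<rho> L x} = (\<Inter>f\<in>{f. lin f \<and> (\<forall>z\<in>L. f z = 0)}. {x. growth \<rho> (\<lambda>i. f ((T ^^ i) x))})"
    by (auto simp: growth_mod_def)
  then show ?thesis
    using growth_tsub[OF _ assms] by (fastforce simp: tsub_def subspace_def)
qed

lemma growth_mod_mem:
  assumes "tsub L" "x \<in> L"
  shows "growth_mod \<rho> L x"
  using assms by (auto simp: growth_mod_def tsub_iter growth_0)

lemma growth_mod_mono: "growth_mod \<rho> L x \<Longrightarrow> L \<subseteq> L' \<Longrightarrow> \<rho> \<le> \<rho>' \<Longrightarrow> growth_mod \<rho>' L' x"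
  unfolding growth_mod_def by (meson growth_mono subset_iff)

text \<open>The seminorm in question is the quotient of the Gauss norm max |e_i| \<rho>^i under the
  map from twisted polynomials to P/Z given by evaluation at \<open>b\<close>. The functional
  \<open>f\<close> and the vector \<open>x0\<close> witness the fast growth that rules out the case
  of a norm.\<close>

lemma small_relation:
  assumes irr: "irr P Z" and \<rho>: "spd < \<rho>"
    and x0: "x0 \<in> P" and f: "lin f" "\<And>z. z \<in> Z \<Longrightarrow> f z = 0"
    and unb: "\<not> (\<exists>C. \<forall>i. v (f ((T ^^ i) x0)) \<le> C * \<rho> ^ i)"
    and b: "b \<in> P" "b \<notin> Z" and \<delta>: "0 < \<delta>"
  shows "\<exists>m e. (\<forall>i. v (e i) * \<rho> ^ i \<le> \<delta>) \<and> (\<forall>i\<ge>m. e i = 0) \<and> b - (\<Sum>i<m. sc (e i) ((T ^^ i) b)) \<in> Z"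
proof -
  have \<rho>0: "0 < \<rho>" using \<rho> spd_nonneg by linarith
  have P: "tsub P" and Z: "tsub Z" "Z \<subset> P"
    and ir: "\<And>Q. tsub Q \<Longrightarrow> Z \<subseteq> Q \<Longrightarrow> Q \<subseteq> P \<Longrightarrow> Q = Z \<or> Q = P"
    using irr by (auto simp: irr_def)
  note sP = tsub_subspace[OF P] and sZ = tsub_subspace[OF Z(1)]
  have Tb: "(T ^^ i) b \<in> P" for i using tsub_iter[OF P b(1)] .
  define S where "S \<delta> y \<longleftrightarrow> (\<exists>m e. (\<forall>i. v (e i) * \<rho> ^ i \<le> \<delta>) \<and> (\<forall>i\<ge>m. e i = 0) \<and>
    y - (\<Sum>i<m. sc (e i) ((T ^^ i) b)) \<in> Z)" for \<delta> y
  have SI: "S \<delta> y" if "\<And>i. v (e i) * \<rho> ^ i \<le> \<delta>" "\<And>i. i \<ge> m \<Longrightarrow> e i = 0"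
    "y - (\<Sum>i<m. sc (e i) ((T ^^ i) b)) \<in> Z" for m e \<delta> y
    using that unfolding S_def by blast
  have ext: "(\<Sum>i<m'. sc (e i) ((T ^^ i) b)) = (\<Sum>i<m. sc (e i) ((T ^^ i) b))"
    if "m \<le> m'" "\<And>i. i \<ge> m \<Longrightarrow> e i = 0" for m m' e
    using that by (intro sum.mono_neutral_right) auto
  have S_Z: "S 0 z" if "z \<in> Z" for z
    using that by (intro SI[of "\<lambda>_. 0" _ 0]) auto
  have S_mono: "S \<delta>' y" if "S \<delta> y" "\<delta> \<le> \<delta>'" for \<delta> \<delta>' y
    using that unfolding S_def by (meson order_trans)
  have S_add: "S \<delta> (x + y)" if xy: "S \<delta> x" "S \<delta> y" for \<delta> x y
  proof -
    obtain m1 e1 where 1: "\<And>i. v (e1 i) * \<rho> ^ i \<le> \<delta>" "\<And>i. i \<ge> m1 \<Longrightarrow> e1 i = 0"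
      "x - (\<Sum>i<m1. sc (e1 i) ((T ^^ i) b)) \<in> Z" using xy(1) unfolding S_def by blast
    obtain m2 e2 where 2: "\<And>i. v (e2 i) * \<rho> ^ i \<le> \<delta>" "\<And>i. i \<ge> m2 \<Longrightarrow> e2 i = 0"
      "y - (\<Sum>i<m2. sc (e2 i) ((T ^^ i) b)) \<in> Z" using xy(2) unfolding S_def by blast
    define m where "m = max m1 m2"
    show ?thesis
    proof (rule SI)
      show "v (e1 i + e2 i) * \<rho> ^ i \<le> \<delta>" for i
      proof -
        have "v (e1 i + e2 i) * \<rho> ^ i \<le> max (v (e1 i)) (v (e2 i)) * \<rho> ^ i"
          using \<rho>0 by (intro mult_right_mono v_ultra) auto
        also have "\<dots> \<le> \<delta>" using 1(1)[of i] 2(1)[of i] by (simp add: max_def)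
        finally show ?thesis .
      qed
      have "(\<Sum>i<m. sc (e1 i + e2 i) ((T ^^ i) b)) =
          (\<Sum>i<m1. sc (e1 i) ((T ^^ i) b)) + (\<Sum>i<m2. sc (e2 i) ((T ^^ i) b))"
        using ext[of m1 m e1] ext[of m2 m e2] 1(2) 2(2)
        by (simp add: scale_left_distrib sum.distrib m_def)
      then have "x + y - (\<Sum>i<m. sc (e1 i + e2 i) ((T ^^ i) b)) =
          (x - (\<Sum>i<m1. sc (e1 i) ((T ^^ i) b))) + (y - (\<Sum>i<m2. sc (e2 i) ((T ^^ i) b)))"
        by simp
      then show "x + y - (\<Sum>i<m. sc (e1 i + e2 i) ((T ^^ i) b)) \<in> Z"
        using 1(3) 2(3) sZ by (simp only: subspace_add)
    qed (use 1 2 in \<open>auto simp: m_def\<close>)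
  qed
  have S_sc: "S (v c * \<delta>) (sc c y)" if y: "S \<delta> y" for c \<delta> y
  proof -
    obtain m e where e: "\<And>i. v (e i) * \<rho> ^ i \<le> \<delta>" "\<And>i. i \<ge> m \<Longrightarrow> e i = 0"
      "y - (\<Sum>i<m. sc (e i) ((T ^^ i) b)) \<in> Z" using y unfolding S_def by blast
    show ?thesis
    proof (rule SI)
      show "v (c * e i) * \<rho> ^ i \<le> v c * \<delta>" for i
        using mult_left_mono[OF e(1)[of i] v_nonneg[of c]] by (simp add: v_mult mult_ac)
      have "sc c y - (\<Sum>i<m. sc (c * e i) ((T ^^ i) b)) = sc c (y - (\<Sum>i<m. sc (e i) ((T ^^ i) b)))"
        by (simp add: scale_right_diff_distrib scale_sum_right)
      then show "sc c y - (\<Sum>i<m. sc (c * e i) ((T ^^ i) b)) \<in> Z"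
        using e(3) sZ by (simp add: subspace_scale)
    qed (use e in auto)
  qed
  have S_single: "S (v c * \<rho> ^ j) (sc c ((T ^^ j) b))" for c j
  proof (rule SI[of "\<lambda>i. if i = j then c else 0" _ "Suc j"])
    have "(\<Sum>i<Suc j. sc (if i = j then c else 0) ((T ^^ i) b)) = sc c ((T ^^ j) b)"
      by simp
    then show "sc c ((T ^^ j) b) - (\<Sum>i<Suc j. sc (if i = j then c else 0) ((T ^^ i) b)) \<in> Z"
      using sZ by (simp add: subspace_0)
  qed (use \<rho>0 v_nonneg in auto)
  obtain Cd where Cd: "\<And>x. v (d x) \<le> Cd * v x" using d_bounded by blast
  \<comment> \<open>T shifts the coefficients, at the price \<rho>, and differentiates them, at the
    price \<open>Cd\<close>.\<close>
  define D where "D = max Cd \<rho>"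
  have S_T: "S (D * \<delta>) (T y)" if y: "S \<delta> y" for \<delta> y
  proof -
    obtain m e where e: "\<And>i. v (e i) * \<rho> ^ i \<le> \<delta>" "\<And>i. i \<ge> m \<Longrightarrow> e i = 0"
      "y - (\<Sum>i<m. sc (e i) ((T ^^ i) b)) \<in> Z" using y unfolding S_def by blast
    have \<delta>0: "0 \<le> \<delta>" using e(1)[of 0] v_nonneg[of "e 0"] by simp
    define e' where "e' i = d (e i) + (case i of 0 \<Rightarrow> 0 | Suc j \<Rightarrow> e j)" for i
    show ?thesis
    proof (rule SI)
      show "v (e' i) * \<rho> ^ i \<le> D * \<delta>" for i
      proof -
        have 1: "v (d (e i)) * \<rho> ^ i \<le> D * \<delta>"
        proof -
          have "v (d (e i)) \<le> D * v (e i)"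
            using Cd[of "e i"] v_nonneg[of "e i"] unfolding D_def
            by (smt (verit) mult_right_mono)
          then have "v (d (e i)) * \<rho> ^ i \<le> D * v (e i) * \<rho> ^ i"
            using \<rho>0 by (intro mult_right_mono) auto
          also have "\<dots> \<le> D * \<delta>"
            using mult_left_mono[OF e(1)[of i], of D] \<rho>0 by (simp add: D_def mult_ac)
          finally show ?thesis .
        qed
        have 2: "v (case i of 0 \<Rightarrow> 0 | Suc j \<Rightarrow> e j) * \<rho> ^ i \<le> D * \<delta>"
        proof (cases i)
          case 0
          then show ?thesis using \<delta>0 \<rho>0 by (simp add: D_def)
        next
          case (Suc j)
          have "v (e j) * \<rho> ^ Suc j \<le> \<rho> * \<delta>"
            using mult_left_mono[OF e(1)[of j], of \<rho>] \<rho>0 by (simp add: mult_ac)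
          also have "\<dots> \<le> D * \<delta>" using \<delta>0 by (intro mult_right_mono) (auto simp: D_def)
          finally show ?thesis using Suc by simp
        qed
        have "v (e' i) * \<rho> ^ i \<le> max (v (d (e i))) (v (case i of 0 \<Rightarrow> 0 | Suc j \<Rightarrow> e j)) * \<rho> ^ i"
          unfolding e'_def using \<rho>0 by (intro mult_right_mono v_ultra) auto
        also have "\<dots> \<le> D * \<delta>" using 1 2 by (simp add: max_def)
        finally show ?thesis .
      qed
      show "e' i = 0" if "i \<ge> Suc m" for i
        using that e(2) by (cases i) (auto simp: e'_def)
      have "T (\<Sum>i<m. sc (e i) ((T ^^ i) b)) =
          (\<Sum>i<m. sc (e i) ((T ^^ Suc i) b)) + (\<Sum>i<m. sc (d (e i)) ((T ^^ i) b))"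
        by (simp add: T_sum T_sc sum.distrib)
      also have "(\<Sum>i<m. sc (d (e i)) ((T ^^ i) b)) = (\<Sum>i<Suc m. sc (d (e i)) ((T ^^ i) b))"
        using e(2) by simp
      also have "(\<Sum>i<m. sc (e i) ((T ^^ Suc i) b)) =
          (\<Sum>i<Suc m. sc (case i of 0 \<Rightarrow> 0 | Suc j \<Rightarrow> e j) ((T ^^ i) b))"
        by (simp add: sum.lessThan_Suc_shift del: sum.lessThan_Suc)
      also have "\<dots> + (\<Sum>i<Suc m. sc (d (e i)) ((T ^^ i) b)) = (\<Sum>i<Suc m. sc (e' i) ((T ^^ i) b))"
        unfolding e'_def scale_left_distrib sum.distrib by (rule add.commute)
      finally have "T y - (\<Sum>i<Suc m. sc (e' i) ((T ^^ i) b)) = T (y - (\<Sum>i<m. sc (e i) ((T ^^ i) b)))"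
        by (simp only: T_diff)
      then show "T y - (\<Sum>i<Suc m. sc (e' i) ((T ^^ i) b)) \<in> Z"
        using e(3) Z(1) by (simp add: tsub_def)
    qed
  qed
  have S_nonneg: "0 \<le> \<delta>" if "S \<delta> y" for \<delta> y
    using that v_nonneg unfolding S_def by (metis mult.right_neutral order_trans power_0)
  have D0: "D > 0" using \<rho>0 by (simp add: D_def)
  have S_P: "y \<in> P" if y: "S \<delta> y" for \<delta> y
  proof -
    obtain m e where e: "y - (\<Sum>i<m. sc (e i) ((T ^^ i) b)) \<in> Z" using y unfolding S_def by blast
    have "y - (\<Sum>i<m. sc (e i) ((T ^^ i) b)) + (\<Sum>i<m. sc (e i) ((T ^^ i) b)) \<in> P"
      using e Z(2) Tb sP by (intro subspace_add[OF sP] subspace_sum subspace_scale) auto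
    then show ?thesis by simp
  qed
  have S_all: "\<exists>\<delta>. S \<delta> y" if "y \<in> P" for y
  proof -
    \<comment> \<open>By irreducibility \<open>b\<close> generates P/Z, so the infimum taken below
      is never over the empty set.\<close>
    define Q where "Q = {y. \<exists>\<delta>. S \<delta> y}"
    have "x + y \<in> Q" if xy: "x \<in> Q" "y \<in> Q" for x y
    proof -
      obtain \<delta>1 \<delta>2 where "S \<delta>1 x" "S \<delta>2 y" using xy by (auto simp: Q_def)
      then have "S (max \<delta>1 \<delta>2) (x + y)" by (intro S_add) (auto elim: S_mono)
      then show ?thesis by (auto simp: Q_def)
    qed
    moreover have "0 \<in> Q" using S_Z[of 0] sZ by (auto simp: Q_def subspace_0)
    ultimately have "tsub Q"
      unfolding tsub_def subspace_def using S_sc S_T by (auto simp: Q_def) blast+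
    moreover have "Z \<subseteq> Q" "Q \<subseteq> P" using S_Z S_P by (auto simp: Q_def)
    moreover have "b \<in> Q" using S_single[of 1 0] by (auto simp: Q_def)
    ultimately have "Q = P" using ir[of Q] b by blast
    then show ?thesis using that by (auto simp: Q_def)
  qed
  \<comment> \<open>The null space of the seminorm is a submodule between \<open>Z\<close> and
    \<open>P\<close>, hence one of the two.\<close>
  define Q where "Q = {y. \<forall>\<delta>>0. S \<delta> y}"
  have "tsub Q"
  proof -
    have "sc c y \<in> Q" if y: "y \<in> Q" for c y
    proof (cases "c = 0")
      case True
      then show ?thesis using S_mono[OF S_Z[of 0]] sZ by (auto simp: Q_def subspace_0)
    next
      case False
      then have vc: "v c > 0" using v_nonneg[of c] v_eq_0_iff[of c] by simp
      have "S \<delta> (sc c y)" if "0 < \<delta>" for \<delta>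
        using S_sc[of "\<delta> / v c" y c] y that vc by (simp add: Q_def)
      then show ?thesis by (simp add: Q_def)
    qed
    moreover have "T y \<in> Q" if y: "y \<in> Q" for y
    proof -
      have "S \<delta> (T y)" if "0 < \<delta>" for \<delta>
        using S_T[of "\<delta> / D" y] y that D0 by (simp add: Q_def)
      then show ?thesis by (simp add: Q_def)
    qed
    moreover have "0 \<in> Q" using S_mono[OF S_Z[of 0]] sZ by (auto simp: Q_def subspace_0)
    ultimately show ?thesis
      unfolding tsub_def subspace_def using S_add by (auto simp: Q_def)
  qed
  moreover have "Z \<subseteq> Q" using S_mono[OF S_Z] by (auto simp: Q_def)
  moreover have "Q \<subseteq> P"
  proof
    fix y assume "y \<in> Q"
    then have "S 1 y" by (simp add: Q_def)
    then show "y \<in> P" by (rule S_P)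
  qed
  ultimately consider "Q = Z" | "Q = P" using ir by blast
  then show ?thesis
  proof cases
    case 2
    then have "S \<delta> b" using b(1) \<delta> by (auto simp: Q_def)
    then show ?thesis unfolding S_def .
  next
    case 1
    define \<nu> where "\<nu> y = Inf {\<delta>. S \<delta> y}" for y
    have \<nu>_le: "\<nu> y \<le> \<delta>" if "S \<delta> y" for y \<delta>
      unfolding \<nu>_def using that by (intro cInf_lower bdd_belowI[of _ 0]) (auto dest: S_nonneg)
    have \<nu>_ge: "\<delta> \<le> \<nu> y" if "y \<in> P" "\<And>\<delta>'. S \<delta>' y \<Longrightarrow> \<delta> \<le> \<delta>'" for y \<delta>
      unfolding \<nu>_def using that S_all[OF that(1)] by (intro cInf_greatest) auto
    have \<nu>_S: "S \<delta> y" if "y \<in> P" "\<nu> y < \<delta>" for y \<delta>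
    proof -
      have "\<not> (\<forall>\<delta>'. S \<delta>' y \<longrightarrow> \<delta> \<le> \<delta>')"
        using \<nu>_ge[OF that(1), of \<delta>] that(2) by auto
      then obtain \<delta>' where "S \<delta>' y" "\<delta>' < \<delta>" by (auto simp: not_le)
      then show ?thesis using S_mono by simp
    qed
    have \<nu>_nonneg: "0 \<le> \<nu> y" if "y \<in> P" for y
      using that by (intro \<nu>_ge) (auto dest: S_nonneg)
    have \<nu>_Z: "\<nu> z = 0" if "z \<in> Z" for z
      using \<nu>_le[OF S_Z[OF that]] \<nu>_nonneg[of z] that Z(2) by auto
    have \<nu>_add: "\<nu> (x + y) \<le> max (\<nu> x) (\<nu> y)" if "x \<in> P" "y \<in> P" for x y
    proof (rule field_le_epsilon)
      fix e :: real assume "0 < e"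
      then show "\<nu> (x + y) \<le> max (\<nu> x) (\<nu> y) + e"
        using that by (intro \<nu>_le S_add \<nu>_S) auto
    qed
    have \<nu>_sc_le: "\<nu> (sc c x) \<le> v c * \<nu> x" if "x \<in> P" for c x
    proof (cases "c = 0")
      case True
      then show ?thesis using \<nu>_Z[of 0] sZ by (simp add: subspace_0)
    next
      case False
      then have vc: "v c > 0" using v_nonneg[of c] v_eq_0_iff[of c] by simp
      have "\<nu> (sc c x) / v c \<le> \<nu> x"
      proof (rule \<nu>_ge[OF that])
        fix \<delta>' assume "S \<delta>' x"
        then have "\<nu> (sc c x) \<le> v c * \<delta>'" by (intro \<nu>_le S_sc)
        then show "\<nu> (sc c x) / v c \<le> \<delta>'" using vc by (simp add: field_simps)
      qed
      then show ?thesis using vc by (simp add: field_simps)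
    qed
    have \<nu>_sc: "\<nu> (sc c x) = v c * \<nu> x" if x: "x \<in> P" for c x
    proof (cases "c = 0")
      case True
      then show ?thesis using \<nu>_Z[of 0] sZ by (simp add: subspace_0)
    next
      case False
      then have vc: "v c > 0" using v_nonneg[of c] v_eq_0_iff[of c] by simp
      have "\<nu> x \<le> inverse (v c) * \<nu> (sc c x)"
        using \<nu>_sc_le[of "sc c x" "inverse c"] x sP False by (simp add: v_inverse subspace_scale)
      then show ?thesis using \<nu>_sc_le[OF x, of c] vc by (simp add: field_simps)
    qed
    have "\<nu> x = 0 \<longleftrightarrow> x \<in> Z" if "x \<in> P" for x
    proof
      assume "\<nu> x = 0"
      then have "x \<in> Q" using \<nu>_S[OF that] by (auto simp: Q_def)
      then show "x \<in> Z" using 1 by simp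
    qed (rule \<nu>_Z)
    then have nm: "norm_mod P Z \<nu>"
      using \<nu>_nonneg \<nu>_add \<nu>_sc by (auto simp: norm_mod_def)
    have ZP: "Z \<subseteq> P" using Z(2) by blast
    obtain K where K: "K \<ge> 1" "\<And>n x. v ((d ^^ n) x) \<le> K * \<rho> ^ n * v x"
      using d_iter_bound[OF \<rho>] by blast
    \<comment> \<open>On monomials c T^j, applying T^n multiplies the Gauss norm by at most K
      \<rho>^n; sums and infima preserve this, so it holds for \<nu>.\<close>
    have single: "\<nu> ((T ^^ n) (sc c ((T ^^ j) b))) \<le> K * \<rho> ^ n * (v c * \<rho> ^ j)" for n c j
    proof (rule leibniz_bound[OF P Tb \<nu>_add \<nu>_sc_le])
      fix k l assume n: "k + l = n"
      have "\<nu> ((T ^^ l) ((T ^^ j) b)) \<le> \<rho> ^ (l + j)"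
        using \<nu>_le[OF S_single[of 1 "l + j"]] by (simp add: funpow_add)
      then have "v ((d ^^ k) c) * \<nu> ((T ^^ l) ((T ^^ j) b)) \<le> (K * \<rho> ^ k * v c) * \<rho> ^ (l + j)"
        using K v_nonneg \<rho>0 \<nu>_nonneg[OF tsub_iter[OF P Tb]] by (intro mult_mono) auto
      also have "\<dots> = K * \<rho> ^ n * (v c * \<rho> ^ j)"
        by (simp add: n[symmetric] power_add)
      finally show "v ((d ^^ k) c) * \<nu> ((T ^^ l) ((T ^^ j) b)) \<le> K * \<rho> ^ n * (v c * \<rho> ^ j)" .
    qed auto
    have TS: "\<nu> ((T ^^ n) y) \<le> K * \<rho> ^ n * \<delta>'" if y: "S \<delta>' y" for n y \<delta>'
    proof -
      obtain m e where e: "\<And>i. v (e i) * \<rho> ^ i \<le> \<delta>'" "\<And>i. i \<ge> m \<Longrightarrow> e i = 0"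
        "y - (\<Sum>i<m. sc (e i) ((T ^^ i) b)) \<in> Z" using y unfolding S_def by blast
      define z where "z = y - (\<Sum>i<m. sc (e i) ((T ^^ i) b))"
      have z: "(T ^^ n) z \<in> Z" using e(3) tsub_iter[OF Z(1)] by (simp add: z_def)
      have K0: "0 \<le> K * \<rho> ^ n * \<delta>'" using K \<rho>0 S_nonneg[OF y] by simp
      have "\<nu> (\<Sum>i<m. (T ^^ n) (sc (e i) ((T ^^ i) b))) \<le> K * \<rho> ^ n * \<delta>'"
      proof (rule nu_sum_le[OF sP sZ ZP nm])
        show "\<nu> ((T ^^ n) (sc (e i) ((T ^^ i) b))) \<le> K * \<rho> ^ n * \<delta>'" for i
          using K \<rho>0 by (intro order_trans[OF single[of n "e i" i]] mult_left_mono e(1)) auto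
      qed (use K0 tsub_iter[OF P] Tb sP in \<open>auto intro!: subspace_scale\<close>)
      moreover have "(T ^^ n) y = (T ^^ n) z + (\<Sum>i<m. (T ^^ n) (sc (e i) ((T ^^ i) b)))"
        by (simp add: z_def T_iter_diff T_iter_sum)
      moreover have "(\<Sum>i<m. (T ^^ n) (sc (e i) ((T ^^ i) b))) \<in> P"
        using tsub_iter[OF P] Tb sP by (auto intro!: subspace_sum subspace_scale)
      ultimately show ?thesis
        using \<nu>_add[of "(T ^^ n) z" "\<Sum>i<m. (T ^^ n) (sc (e i) ((T ^^ i) b))"] z ZP \<nu>_Z[OF z] K0
        by auto
    qed
    have bound: "\<nu> ((T ^^ n) y) \<le> K * \<rho> ^ n * \<nu> y" if "y \<in> P" for n y
    proof -
      have "\<nu> ((T ^^ n) y) / (K * \<rho> ^ n) \<le> \<nu> y"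
        using TS K \<rho>0 by (intro \<nu>_ge[OF that]) (simp add: field_simps)
      then show ?thesis using K \<rho>0 by (simp add: field_simps)
    qed
    \<comment> \<open>Since functionals are bounded for the norm \<nu>, f(T^i x0) would grow at most
      like \<rho>^i, contrary to \<open>unb\<close>.\<close>
    obtain C where C: "C \<ge> 0" "\<And>x. x \<in> P \<Longrightarrow> v (f x) \<le> C * \<nu> x"
      using functional_bounded[OF sP sZ ZP nm f] by blast
    have "v (f ((T ^^ i) x0)) \<le> (C * K * \<nu> x0) * \<rho> ^ i" for i
    proof -
      have "v (f ((T ^^ i) x0)) \<le> C * \<nu> ((T ^^ i) x0)"
        using C(2)[OF tsub_iter[OF P x0]] .
      also have "\<dots> \<le> C * (K * \<rho> ^ i * \<nu> x0)"
        using bound[OF x0] C(1) by (intro mult_left_mono)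
      finally show ?thesis by (simp add: mult_ac)
    qed
    then show ?thesis using unb by blast
  qed
qed

end

section \<open>Coboundaries and the Neumann series\<close>

context diff_space
begin

context
  fixes N P Z :: "'m set"
  assumes N: "tsub N" and P: "tsub P" and Z: "tsub Z" and PN: "P \<subseteq> N" and ZP: "Z \<subseteq> P"
begin

definition functional_mod :: "('m \<Rightarrow> 'k) \<Rightarrow> bool" where
  "functional_mod \<gamma> \<longleftrightarrow> lin_on N \<gamma> \<and> (\<forall>x\<in>P. \<gamma> x = 0)"

text \<open>Represents a linear map N/P -> P/Z by a lift with values in \<open>P\<close>; this is
  why \<open>coboundary\<close> compares only modulo \<open>Z\<close>.\<close>

definition map_mod :: "('m \<Rightarrow> 'm) \<Rightarrow> bool" where
  "map_mod \<phi> \<longleftrightarrow> (\<forall>x\<in>N. \<forall>y\<in>N. \<phi> (x + y) = \<phi> x + \<phi> y) \<and> (\<forall>c. \<forall>x\<in>N. \<phi> (sc c x) = sc c (\<phi> x)) \<and>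
    (\<forall>x\<in>N. \<phi> x \<in> P) \<and> (\<forall>x\<in>P. \<phi> x = 0)"

definition coboundary :: "('m \<Rightarrow> 'm) \<Rightarrow> bool" where
  "coboundary \<psi> \<longleftrightarrow> (\<exists>\<phi>. map_mod \<phi> \<and> (\<forall>x\<in>N. \<psi> x - (T (\<phi> x) - \<phi> (T x)) \<in> Z))"

text \<open>Minus the usual connection on the dual. The two terms separately are not linear in x,
  but their contributions d(c) \<gamma>(x) cancel.\<close>

definition Td :: "('m \<Rightarrow> 'k) \<Rightarrow> 'm \<Rightarrow> 'k" where
  "Td \<gamma> = (\<lambda>x. \<gamma> (T x) - d (\<gamma> x))"

lemma Td_apply: "Td \<gamma> x = \<gamma> (T x) - d (\<gamma> x)"
  by (simp add: Td_def)

lemma T_in_N: "x \<in> N \<Longrightarrow> T x \<in> N"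
  using N by (simp add: tsub_def)

lemma subspace_Z: "subspace Z" and subspace_N: "subspace N" and subspace_P: "subspace P"
  using N P Z by (auto simp: tsub_def)

lemma coboundary_0: "coboundary (\<lambda>_. 0)"
  unfolding coboundary_def
  by (rule exI[of _ "\<lambda>_. 0"]) (simp add: map_mod_def subspace_0 subspace_P subspace_Z)

lemma coboundary_cong:
  assumes "coboundary \<psi>" "\<And>x. x \<in> N \<Longrightarrow> \<psi>' x - \<psi> x \<in> Z"
  shows "coboundary \<psi>'"
proof -
  obtain \<phi> where \<phi>: "map_mod \<phi>" "\<And>x. x \<in> N \<Longrightarrow> \<psi> x - (T (\<phi> x) - \<phi> (T x)) \<in> Z"
    using assms(1) by (auto simp: coboundary_def)
  have "\<psi>' x - (T (\<phi> x) - \<phi> (T x)) \<in> Z" if "x \<in> N" for x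
    using subspace_add[OF subspace_Z assms(2)[OF that] \<phi>(2)[OF that]] by (simp add: algebra_simps)
  then show ?thesis using \<phi>(1) by (auto simp: coboundary_def)
qed

lemma coboundary_add:
  assumes "coboundary \<psi>1" "coboundary \<psi>2"
  shows "coboundary (\<lambda>x. \<psi>1 x + \<psi>2 x)"
proof -
  obtain \<phi>1 where 1: "map_mod \<phi>1" "\<And>x. x \<in> N \<Longrightarrow> \<psi>1 x - (T (\<phi>1 x) - \<phi>1 (T x)) \<in> Z"
    using assms(1) by (auto simp: coboundary_def)
  obtain \<phi>2 where 2: "map_mod \<phi>2" "\<And>x. x \<in> N \<Longrightarrow> \<psi>2 x - (T (\<phi>2 x) - \<phi>2 (T x)) \<in> Z"
    using assms(2) by (auto simp: coboundary_def)
  have "map_mod (\<lambda>x. \<phi>1 x + \<phi>2 x)"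
    using 1(1) 2(1) subspace_P by (auto simp: map_mod_def subspace_add scale_right_distrib algebra_simps)
  moreover have "(\<psi>1 x + \<psi>2 x) - (T (\<phi>1 x + \<phi>2 x) - (\<phi>1 (T x) + \<phi>2 (T x))) \<in> Z" if "x \<in> N" for x
    using subspace_add[OF subspace_Z 1(2)[OF that] 2(2)[OF that]] by (simp add: T_add algebra_simps)
  ultimately show ?thesis
    unfolding coboundary_def by (intro exI[of _ "\<lambda>x. \<phi>1 x + \<phi>2 x"]) auto
qed

lemma coboundary_sum:
  assumes "\<And>i. i \<in> I \<Longrightarrow> coboundary (\<psi> i)"
  shows "coboundary (\<lambda>x. \<Sum>i\<in>I. \<psi> i x)"
  using assms by (induction I rule: infinite_finite_induct) (simp_all add: coboundary_0 coboundary_add)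

lemma functional_mod_Td:
  assumes "functional_mod \<gamma>"
  shows "functional_mod (Td \<gamma>)"
proof -
  have "sc c x \<in> N" "x + y \<in> N" if "x \<in> N" "y \<in> N" for c x y
    using that subspace_N by (auto simp: subspace_add subspace_scale)
  then show ?thesis
    using assms P PN by (auto simp: functional_mod_def lin_on_def Td_apply T_add T_sc d_add d_mult T_in_N tsub_def algebra_simps)
qed

lemma functional_mod_Td_iter:
  "functional_mod \<gamma> \<Longrightarrow> functional_mod ((Td ^^ i) \<gamma>)"
  by (induction i) (auto simp: functional_mod_Td)

lemma functional_mod_scale:
  "functional_mod \<gamma> \<Longrightarrow> functional_mod (\<lambda>x. c * \<gamma> x)"
  by (auto simp: functional_mod_def lin_on_def algebra_simps)

lemma functional_mod_add:
  "functional_mod \<gamma> \<Longrightarrow> functional_mod \<gamma>' \<Longrightarrow> functional_mod (\<lambda>x. \<gamma> x + \<gamma>' x)"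
  by (auto simp: functional_mod_def lin_on_def algebra_simps)

lemma functional_mod_0: "functional_mod (\<lambda>x. 0)"
  by (auto simp: functional_mod_def lin_on_def)

lemma functional_mod_sum:
  "(\<And>i. i \<in> I \<Longrightarrow> functional_mod (\<gamma> i)) \<Longrightarrow> functional_mod (\<lambda>x. \<Sum>i\<in>I. \<gamma> i x)"
  by (induction I rule: infinite_finite_induct) (simp_all add: functional_mod_0 functional_mod_add)

text \<open>For \<phi>(x) = \<gamma>(x) u the coboundary T \<phi> - \<phi> T is exactly \<gamma>(x)
  T(u) - (Td \<gamma>)(x) u. Each such step moves one \<open>T\<close> from the vector to the
  functional.\<close>

lemma coboundary_Td_iter:
  assumes "functional_mod \<gamma>" "y \<in> P"
  shows "coboundary (\<lambda>x. sc (\<gamma> x) ((T ^^ i) y) - sc ((Td ^^ i) \<gamma> x) y)"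
  using assms(1)
proof (induction i arbitrary: \<gamma>)
  case 0
  then show ?case by (simp add: coboundary_0)
next
  case (Suc i)
  define u where "u = (T ^^ i) y"
  have u: "u \<in> P" using assms(2) P by (simp add: u_def tsub_iter)
  have "coboundary (\<lambda>x. sc (\<gamma> x) (T u) - sc (Td \<gamma> x) u)"
    unfolding coboundary_def
  proof (intro exI conjI ballI)
    show "map_mod (\<lambda>x. sc (\<gamma> x) u)"
      using Suc.prems u subspace_P
      by (auto simp: map_mod_def functional_mod_def lin_on_def scale_left_distrib subspace_scale)
    show "sc (\<gamma> x) (T u) - sc (Td \<gamma> x) u - (T (sc (\<gamma> x) u) - sc (\<gamma> (T x)) u) \<in> Z" for x
      by (simp add: T_sc Td_apply scale_left_diff_distrib subspace_0[OF subspace_Z])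
  qed
  moreover have "coboundary (\<lambda>x. sc (Td \<gamma> x) u - sc ((Td ^^ i) (Td \<gamma>) x) y)"
    unfolding u_def by (rule Suc.IH[OF functional_mod_Td[OF Suc.prems]])
  ultimately have "coboundary (\<lambda>x. (sc (\<gamma> x) (T u) - sc (Td \<gamma> x) u) +
      (sc (Td \<gamma> x) u - sc ((Td ^^ i) (Td \<gamma>) x) y))"
    by (rule coboundary_add)
  then show ?case
    by (simp add: u_def funpow_swap1)
qed

text \<open>The adjoint of \<open>\<epsilon> = \<Sum> e\<^sub>i T\<^sup>i\<close>: modulo coboundaries \<open>\<gamma>(x) (\<epsilon> y)\<close> equals
  \<open>(adj m e \<gamma>)(x) y\<close>, by iterating \<open>\<gamma>(x) T y \<equiv> (Td \<gamma>)(x) y\<close>.\<close>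

definition adj :: "nat \<Rightarrow> (nat \<Rightarrow> 'k) \<Rightarrow> ('m \<Rightarrow> 'k) \<Rightarrow> 'm \<Rightarrow> 'k" where
  "adj m e \<gamma> = (\<lambda>x. \<Sum>i<m. (Td ^^ i) (\<lambda>x. e i * \<gamma> x) x)"

lemma functional_mod_adj: "functional_mod \<gamma> \<Longrightarrow> functional_mod (adj m e \<gamma>)"
  unfolding adj_def by (intro functional_mod_sum functional_mod_Td_iter functional_mod_scale)

lemma Td_iter_diff: "(Td ^^ i) (\<lambda>x. \<gamma> x - \<gamma>' x) = (\<lambda>x. (Td ^^ i) \<gamma> x - (Td ^^ i) \<gamma>' x)"
  by (induction i) (simp_all add: Td_apply d_diff fun_eq_iff)

lemma adj_diff: "adj m e (\<lambda>x. \<gamma> x - \<gamma>' x) = (\<lambda>x. adj m e \<gamma> x - adj m e \<gamma>' x)"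
  by (simp add: adj_def right_diff_distrib Td_iter_diff sum_subtractf)

lemma Td_iter_tendsto:
  assumes "\<And>x. x \<in> N \<Longrightarrow> (\<lambda>n. v (g n x - \<gamma> x)) \<longlonglongrightarrow> 0" "x \<in> N"
  shows "(\<lambda>n. v ((Td ^^ i) (g n) x - (Td ^^ i) \<gamma> x)) \<longlonglongrightarrow> 0"
  using assms(2)
proof (induction i arbitrary: x)
  case (Suc i)
  have "(\<lambda>n. v (((Td ^^ i) (g n) (T x) + - d ((Td ^^ i) (g n) x)) -
      ((Td ^^ i) \<gamma> (T x) + - d ((Td ^^ i) \<gamma> x)))) \<longlonglongrightarrow> 0"
    by (intro v_tendsto_add v_tendsto_minus v_tendsto_d Suc T_in_N)
  moreover have "(Td ^^ Suc i) \<beta> x = (Td ^^ i) \<beta> (T x) + - d ((Td ^^ i) \<beta> x)" for \<beta>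
    unfolding funpow.simps(2) comp_apply Td_apply[of "(Td ^^ i) \<beta>"] by simp
  ultimately show ?case by simp
qed (use assms in simp)

lemma adj_tendsto:
  assumes "\<And>x. x \<in> N \<Longrightarrow> (\<lambda>n. v (g n x - \<gamma> x)) \<longlonglongrightarrow> 0" "x \<in> N"
  shows "(\<lambda>n. v (adj m e (g n) x - adj m e \<gamma> x)) \<longlonglongrightarrow> 0"
  unfolding adj_def by (intro v_tendsto_sum Td_iter_tendsto v_tendsto_mult assms)

text \<open>A small adjoint operator contracts functionals of bounded growth, so \<open>1 - adj m e\<close> is
  inverted by a Neumann series.\<close>

lemma adj_neumann:
  assumes \<alpha>: "functional_mod \<alpha>" and \<rho>: "spd < \<rho>"
    and K: "K \<ge> 1" "\<And>n x. v ((d ^^ n) x) \<le> K * \<rho> ^ n * v x"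
    and e: "\<And>i. v (e i) * \<rho> ^ i \<le> 1 / (2 * K)"
    and bd: "\<And>x. x \<in> N \<Longrightarrow> \<exists>C. \<forall>j. v (\<alpha> ((T ^^ j) x)) \<le> C * \<rho> ^ j"
  shows "\<exists>\<alpha>'. functional_mod \<alpha>' \<and> (\<forall>x\<in>N. \<alpha>' x = \<alpha> x + adj m e \<alpha>' x)"
proof -
  have \<rho>0: "0 < \<rho>" using \<rho> spd_nonneg by linarith
  obtain X where X: "finite X" "X \<subseteq> N" "N = span X"
    using subspace_eq_span_union[OF subspace_N, of "{}"] by auto
  \<comment> \<open>\<open>bnd\<close> controls values along the \<open>T\<close>-orbits of finitely
    many generators. \<open>bnd2\<close> also controls their derivatives, because \<open>Td\<close>
    combines \<gamma> T and d \<gamma>; either costs one factor \<rho>.\<close>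
  define bnd where "bnd c \<gamma> \<longleftrightarrow> (\<forall>j. \<forall>x\<in>X. v (\<gamma> ((T ^^ j) x)) \<le> c * \<rho> ^ j)" for c \<gamma>
  define bnd2 where "bnd2 c \<gamma> \<longleftrightarrow> (\<forall>k j. \<forall>x\<in>X. v ((d ^^ k) (\<gamma> ((T ^^ j) x))) \<le> c * \<rho> ^ (k + j))" for c \<gamma>
  have b12: "bnd2 (K * v a * c) (\<lambda>x. a * \<gamma> x)" if "bnd c \<gamma>" for a c \<gamma>
    unfolding bnd2_def
  proof (intro allI ballI)
    fix k j x assume x: "x \<in> X"
    have "v ((d ^^ k) (a * \<gamma> ((T ^^ j) x))) \<le> K * \<rho> ^ k * (v a * v (\<gamma> ((T ^^ j) x)))"
      using K(2)[of k "a * \<gamma> ((T ^^ j) x)"] by (simp add: v_mult)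
    also have "\<dots> \<le> K * \<rho> ^ k * (v a * (c * \<rho> ^ j))"
      using that x K(1) \<rho>0 v_nonneg unfolding bnd_def by (intro mult_left_mono) auto
    finally show "v ((d ^^ k) (a * \<gamma> ((T ^^ j) x))) \<le> K * v a * c * \<rho> ^ (k + j)"
      by (simp add: power_add mult_ac)
  qed
  have bT: "bnd2 (c * \<rho>) (Td \<gamma>)" if b: "bnd2 c \<gamma>" for c \<gamma>
    unfolding bnd2_def
  proof (intro allI ballI)
    fix k j x assume x: "x \<in> X"
    have "(d ^^ k) (Td \<gamma> ((T ^^ j) x)) = (d ^^ k) (\<gamma> ((T ^^ Suc j) x)) - (d ^^ Suc k) (\<gamma> ((T ^^ j) x))"
      by (simp add: Td_apply d_iter_diff funpow_swap1)
    also have "v \<dots> \<le> max (v ((d ^^ k) (\<gamma> ((T ^^ Suc j) x)))) (v ((d ^^ Suc k) (\<gamma> ((T ^^ j) x))))"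
      by (rule v_diff_le)
    also have "\<dots> \<le> c * \<rho> ^ (Suc (k + j))"
      using b[unfolded bnd2_def, rule_format, OF x, of k "Suc j"]
        b[unfolded bnd2_def, rule_format, OF x, of "Suc k" j] by simp
    finally show "v ((d ^^ k) (Td \<gamma> ((T ^^ j) x))) \<le> c * \<rho> * \<rho> ^ (k + j)"
      by (simp add: mult_ac)
  qed
  have bTi: "bnd2 (c * \<rho> ^ i) ((Td ^^ i) \<gamma>)" if "bnd2 c \<gamma>" for c \<gamma> i
  proof (induction i)
    case (Suc i)
    then show ?case using bT[OF Suc] by (simp add: mult_ac)
  qed (use that in simp)
  \<comment> \<open>The scalar e_i costs K |e_i| and the i-th power of \<open>Td\<close> costs
    \<rho>^i; with |e_i| \<rho>^i \<le> 1/(2 K) a factor 1/2 remains.\<close>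
  have bE: "bnd (c / 2) (adj m e \<gamma>)" if b: "bnd c \<gamma>" "0 \<le> c" for c \<gamma>
    unfolding bnd_def
  proof (intro allI ballI)
    fix j x assume x: "x \<in> X"
    show "v (adj m e \<gamma> ((T ^^ j) x)) \<le> c / 2 * \<rho> ^ j"
      unfolding adj_def
    proof (rule v_sum_le)
      fix i assume "i \<in> {..<m}"
      have b2: "bnd2 (K * v (e i) * c * \<rho> ^ i) ((Td ^^ i) (\<lambda>x. e i * \<gamma> x))"
        by (rule bTi[OF b12[OF b(1)]])
      have "v ((Td ^^ i) (\<lambda>x. e i * \<gamma> x) ((T ^^ j) x)) \<le> K * v (e i) * c * \<rho> ^ i * \<rho> ^ j"
        using b2[unfolded bnd2_def, rule_format, OF x, of 0 j] by simp
      also have "\<dots> = K * c * \<rho> ^ j * (v (e i) * \<rho> ^ i)" by simp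
      also have "\<dots> \<le> K * c * \<rho> ^ j * (1 / (2 * K))"
        using e[of i] K b \<rho>0 by (intro mult_left_mono) auto
      also have "\<dots> = c / 2 * \<rho> ^ j" using K by simp
      finally show "v ((Td ^^ i) (\<lambda>x. e i * \<gamma> x) ((T ^^ j) x)) \<le> c / 2 * \<rho> ^ j" .
    qed (use b \<rho>0 in auto)
  qed
  have "\<forall>x\<in>X. \<exists>C. \<forall>j. v (\<alpha> ((T ^^ j) x)) \<le> C * \<rho> ^ j" using bd X by blast
  then obtain C where C: "\<And>x j. x \<in> X \<Longrightarrow> v (\<alpha> ((T ^^ j) x)) \<le> C x * \<rho> ^ j" by metis
  define c where "c = (\<Sum>x\<in>X. \<bar>C x\<bar>)"
  have c0: "0 \<le> c" unfolding c_def by (intro sum_nonneg) auto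
  have bc: "bnd c \<alpha>"
    unfolding bnd_def
  proof (intro allI ballI)
    fix j x assume x: "x \<in> X"
    have "C x \<le> \<bar>C x\<bar>" by simp
    also have "\<dots> \<le> c" unfolding c_def using x X by (intro member_le_sum) auto
    finally show "v (\<alpha> ((T ^^ j) x)) \<le> c * \<rho> ^ j"
      using C[OF x, of j] \<rho>0 by (smt (verit) mult_right_mono zero_le_power)
  qed
  define A where "A n = (adj m e ^^ n) \<alpha>" for n
  \<comment> \<open>Partial sums of the Neumann series, written as iterates of \<gamma> -> \<alpha>
    + adj \<gamma>; their limit solves the equation because \<open>adj\<close> commutes with
    pointwise limits.\<close>
  define S where "S = rec_nat (\<lambda>_. 0) (\<lambda>_ \<gamma> x. \<alpha> x + adj m e \<gamma> x)"
  have S0: "S 0 = (\<lambda>_. 0)" and SSuc: "S (Suc n) = (\<lambda>x. \<alpha> x + adj m e (S n) x)" for n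
    by (simp_all add: S_def)
  have fA: "functional_mod (A n)" for n
    by (induction n) (simp_all add: A_def \<alpha> functional_mod_adj)
  have fS: "functional_mod (S n)" for n
    by (induction n) (simp_all add: S0 SSuc \<alpha> functional_mod_adj functional_mod_add functional_mod_0)
  have adj0: "adj m e (\<lambda>x. 0) = (\<lambda>x. 0)"
    using adj_diff[of m e "\<lambda>x. 0" "\<lambda>x. 0"] by (simp add: fun_eq_iff)
  have diffS: "(\<lambda>x. S (Suc n) x - S n x) = A n" for n
  proof (induction n)
    case 0
    then show ?case by (simp add: S0 SSuc A_def adj0)
  next
    case (Suc n)
    have "(\<lambda>x. S (Suc (Suc n)) x - S (Suc n) x) = (\<lambda>x. adj m e (S (Suc n)) x - adj m e (S n) x)"
      by (subst SSuc, subst (2) SSuc) simp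
    also have "\<dots> = adj m e (A n)"
      unfolding Suc[symmetric] by (rule adj_diff[symmetric])
    finally show ?case by (simp add: A_def)
  qed
  have bA: "bnd (c / 2 ^ n) (A n)" for n
  proof (induction n)
    case (Suc n)
    then show ?case using bE[OF Suc] c0 by (simp add: A_def mult_ac)
  qed (simp add: A_def bc)
  \<comment> \<open>Decay is known on the generators \<open>X\<close> and spreads to their span by
    linearity.\<close>
  have "x \<in> N \<and> (\<lambda>n. v (A n x)) \<longlonglongrightarrow> 0" if "x \<in> span X" for x
    using that
  proof (induction rule: span_induct_alt)
    case base
    have "A n 0 = 0" for n
      using fA[of n] lin_onD(3)[OF _ subspace_N] by (simp add: functional_mod_def)
    then show ?case by (simp add: subspace_0 subspace_N)
  next
    case (step a x y)
    have xy: "x \<in> N" "y \<in> N" "sc a x \<in> N"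
      using step X(2) subspace_N by (auto simp: subspace_scale)
    have eq: "A n (sc a x + y) = a * A n x + A n y" for n
      using fA[of n] xy lin_onD[OF _ subspace_N] by (simp add: functional_mod_def)
    have "(\<lambda>n. v (A n x)) \<longlonglongrightarrow> 0"
    proof (rule tendsto_sandwich[of "\<lambda>_. 0" _ _ "\<lambda>n. c * (1 / 2) ^ n"])
      have "v (A n x) \<le> c * (1 / 2) ^ n" for n
        using bA[of n, unfolded bnd_def, rule_format, OF step(1), of 0] by (simp add: power_one_over)
      then show "\<forall>\<^sub>F n in sequentially. v (A n x) \<le> c * (1 / 2) ^ n" by simp
      show "(\<lambda>n. c * (1 / 2) ^ n) \<longlonglongrightarrow> 0"
        by (intro tendsto_mult_right_zero LIMSEQ_power_zero) simp
    qed (simp_all add: v_nonneg)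
    then have "(\<lambda>n. v (A n x - 0)) \<longlonglongrightarrow> 0" by simp
    moreover have "(\<lambda>n. v (A n y - 0)) \<longlonglongrightarrow> 0" using step by simp
    ultimately have "(\<lambda>n. v ((a * A n x + A n y) - (a * 0 + 0))) \<longlonglongrightarrow> 0"
      by (intro v_tendsto_add v_tendsto_mult)
    then show ?case using xy subspace_N by (simp add: eq subspace_add)
  qed
  then have limA: "(\<lambda>n. v (A n x)) \<longlonglongrightarrow> 0" if "x \<in> N" for x
    using that X(3) by blast
  have "\<exists>l. (\<lambda>n. v (S n x - l)) \<longlonglongrightarrow> 0" if "x \<in> N" for x
  proof (rule v_increments_convergent)
    have "S (Suc n) x - S n x = A n x" for n using diffS[of n] by (rule fun_cong)
    then show "(\<lambda>n. v (S (Suc n) x - S n x)) \<longlonglongrightarrow> 0" using limA[OF that] by simp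
  qed
  then have "\<forall>x. \<exists>l. x \<in> N \<longrightarrow> (\<lambda>n. v (S n x - l)) \<longlonglongrightarrow> 0" by blast
  then obtain \<alpha>' where \<alpha>': "\<And>x. x \<in> N \<Longrightarrow> (\<lambda>n. v (S n x - \<alpha>' x)) \<longlonglongrightarrow> 0" by metis
  have "\<alpha>' (x + y) = \<alpha>' x + \<alpha>' y" if xy: "x \<in> N" "y \<in> N" for x y
  proof (rule v_tendsto_unique)
    show "(\<lambda>n. v (S n (x + y) - \<alpha>' (x + y))) \<longlonglongrightarrow> 0" by (intro \<alpha>' subspace_add subspace_N xy)
    have "S n (x + y) = S n x + S n y" for n
      using fS[of n] xy lin_onD[OF _ subspace_N] by (simp add: functional_mod_def)
    then show "(\<lambda>n. v (S n (x + y) - (\<alpha>' x + \<alpha>' y))) \<longlonglongrightarrow> 0"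
      using v_tendsto_add[OF \<alpha>'[OF xy(1)] \<alpha>'[OF xy(2)]] by simp
  qed
  moreover have "\<alpha>' (sc a x) = a * \<alpha>' x" if x: "x \<in> N" for a x
  proof (rule v_tendsto_unique)
    show "(\<lambda>n. v (S n (sc a x) - \<alpha>' (sc a x))) \<longlonglongrightarrow> 0" by (intro \<alpha>' subspace_scale subspace_N x)
    have "S n (sc a x) = a * S n x" for n
      using fS[of n] x lin_onD[OF _ subspace_N] by (simp add: functional_mod_def)
    then show "(\<lambda>n. v (S n (sc a x) - a * \<alpha>' x)) \<longlonglongrightarrow> 0"
      using v_tendsto_mult[OF \<alpha>'[OF x]] by simp
  qed
  moreover have "\<alpha>' x = 0" if x: "x \<in> P" for x
  proof (rule v_tendsto_unique)
    show "(\<lambda>n. v (S n x - \<alpha>' x)) \<longlonglongrightarrow> 0" using \<alpha>' x PN by blast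
    show "(\<lambda>n. v (S n x - 0)) \<longlonglongrightarrow> 0" using fS x by (simp add: functional_mod_def)
  qed
  moreover have "\<alpha>' x = \<alpha> x + adj m e \<alpha>' x" if x: "x \<in> N" for x
  proof (rule v_tendsto_unique)
    show "(\<lambda>n. v (S (Suc n) x - \<alpha>' x)) \<longlonglongrightarrow> 0" using LIMSEQ_Suc[OF \<alpha>'[OF x]] .
    have "(\<lambda>n. v ((\<alpha> x + adj m e (S n) x) - (\<alpha> x + adj m e \<alpha>' x))) \<longlonglongrightarrow> 0"
      by (intro v_tendsto_add adj_tendsto \<alpha>' x) simp
    then show "(\<lambda>n. v (S (Suc n) x - (\<alpha> x + adj m e \<alpha>' x))) \<longlonglongrightarrow> 0" by (simp add: SSuc)
  qed
  ultimately show ?thesis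
    by (intro exI[of _ \<alpha>']) (simp add: functional_mod_def lin_on_def)
qed

lemma coboundary_if_small_relation:
  assumes \<alpha>: "functional_mod \<alpha>" and \<rho>: "spd < \<rho>"
    and bd: "\<And>x. x \<in> N \<Longrightarrow> \<exists>C. \<forall>j. v (\<alpha> ((T ^^ j) x)) \<le> C * \<rho> ^ j"
    and b: "b \<in> P"
    and small: "\<And>\<delta>. 0 < \<delta> \<Longrightarrow> \<exists>m e. (\<forall>i. v (e i) * \<rho> ^ i \<le> \<delta>) \<and> (\<forall>i\<ge>m. e i = 0) \<and>
      b - (\<Sum>i<m. sc (e i) ((T ^^ i) b)) \<in> Z"
  shows "coboundary (\<lambda>x. sc (\<alpha> x) b)"
proof -
  obtain K where K: "K \<ge> 1" "\<And>n x. v ((d ^^ n) x) \<le> K * \<rho> ^ n * v x"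
    using d_iter_bound[OF \<rho>] by blast
  \<comment> \<open>The bound 1/(2 K) is the one that makes the adjoint a contraction.\<close>
  obtain m e where e: "\<And>i. v (e i) * \<rho> ^ i \<le> 1 / (2 * K)" "b - (\<Sum>i<m. sc (e i) ((T ^^ i) b)) \<in> Z"
    using small[of "1 / (2 * K)"] K by auto
  obtain \<alpha>' where \<alpha>': "functional_mod \<alpha>'" "\<And>x. x \<in> N \<Longrightarrow> \<alpha>' x = \<alpha> x + adj m e \<alpha>' x"
    using adj_neumann[OF \<alpha> \<rho> K e(1) bd] by blast
  have "coboundary (\<lambda>x. \<Sum>i<m. sc (e i * \<alpha>' x) ((T ^^ i) b) - sc ((Td ^^ i) (\<lambda>x. e i * \<alpha>' x) x) b)"
    by (intro coboundary_sum coboundary_Td_iter functional_mod_scale \<alpha>'(1) b)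
  then show ?thesis
  proof (rule coboundary_cong)
    fix x assume x: "x \<in> N"
    have "(\<Sum>i<m. sc (e i * \<alpha>' x) ((T ^^ i) b) - sc ((Td ^^ i) (\<lambda>x. e i * \<alpha>' x) x) b) =
      sc (\<alpha>' x) (\<Sum>i<m. sc (e i) ((T ^^ i) b)) - sc (adj m e \<alpha>' x) b"
      by (simp add: sum_subtractf adj_def scale_sum_left scale_sum_right mult.commute)
    moreover have "sc (\<alpha> x) b = sc (\<alpha>' x) b - sc (adj m e \<alpha>' x) b"
      using \<alpha>'(2)[OF x] by (simp add: scale_left_distrib)
    \<comment> \<open>Since \<alpha> = \<alpha>' - adj \<alpha>', the difference collapses to
      \<alpha>'(x) (b - \<epsilon> b), an element of \<open>Z\<close> by the choice of
      \<epsilon>.\<close>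
    ultimately have "sc (\<alpha> x) b - (\<Sum>i<m. sc (e i * \<alpha>' x) ((T ^^ i) b) - sc ((Td ^^ i) (\<lambda>x. e i * \<alpha>' x) x) b)
      = sc (\<alpha>' x) (b - (\<Sum>i<m. sc (e i) ((T ^^ i) b)))"
      by (simp add: scale_right_diff_distrib)
    then show "sc (\<alpha> x) b - (\<Sum>i<m. sc (e i * \<alpha>' x) ((T ^^ i) b) - sc ((Td ^^ i) (\<lambda>x. e i * \<alpha>' x) x) b) \<in> Z"
      using e(2) subspace_Z by (simp add: subspace_scale)
  qed
qed

end

end

section \<open>Lifting slowly growing vectors\<close>

context diff_space
begin

context
  fixes P Z :: "'m set" and \<rho> :: real
  assumes irr: "irr P Z" and \<rho>: "spd \<le> \<rho>"
begin

text \<open>The case of a fast factor P/Z. On the submodule \<open>N\<close> of vectors slow modulo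
  \<open>P\<close>, a linear section of N -> N/P is corrected by \<phi> until it commutes with
  \<open>T\<close> modulo \<open>Z\<close>; such a section carries slow vectors to slow
  vectors.\<close>

lemma lift_step_nonconv:
  assumes x0: "x0 \<in> P" and f0: "lin f0" "\<And>z. z \<in> Z \<Longrightarrow> f0 z = 0" and \<rho>': "\<rho> < \<rho>'"
    and unb: "\<not> (\<exists>C. \<forall>i. v (f0 ((T ^^ i) x0)) \<le> C * \<rho>' ^ i)"
    and x: "growth_mod \<rho> P x"
  shows "\<exists>p\<in>P. growth_mod \<rho> Z (x - p)"
proof -
  define N where "N = {x. growth_mod \<rho> P x}"
  have P: "tsub P" and Z: "tsub Z" and ZP: "Z \<subseteq> P" using irr by (auto simp: irr_def)
  have N: "tsub N" unfolding N_def by (rule growth_mod_tsub[OF \<rho>])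
  have PN: "P \<subseteq> N" using growth_mod_mem[OF P] by (auto simp: N_def)
  note ctx = N P Z PN ZP
  note sP = tsub_subspace[OF P] and sN = tsub_subspace[OF N] and sZ = tsub_subspace[OF Z]
  have spd': "spd < \<rho>'" using \<rho> \<rho>' by simp
  obtain \<pi> where \<pi>: "\<And>x y. \<pi> (x + y) = \<pi> x + \<pi> y" "\<And>c x. \<pi> (sc c x) = sc c (\<pi> x)"
    "\<And>x. \<pi> x \<in> P" "\<And>x. x \<in> P \<Longrightarrow> \<pi> x = x"
    using projection_exists[OF sP] by blast
  \<comment> \<open>The cocycle: the failure of the projection onto \<open>P\<close> to commute with
    \<open>T\<close>. The terms with d(c) cancel, so it is linear over the field.\<close>
  define \<delta> where "\<delta> x = \<pi> (T x) - T (\<pi> x)" for x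
  have \<delta>P: "\<delta> x \<in> P" for x
    using \<pi>(3) P sP by (auto simp: \<delta>_def tsub_def intro: subspace_diff)
  have \<delta>0: "\<delta> x = 0" if "x \<in> P" for x
    using that \<pi>(4) P by (simp add: \<delta>_def tsub_def)
  have \<delta>_add: "\<delta> (x + y) = \<delta> x + \<delta> y" for x y
    by (simp add: \<delta>_def T_add \<pi>)
  have \<delta>_sc: "\<delta> (sc c x) = sc c (\<delta> x)" for c x
    by (simp add: \<delta>_def T_sc \<pi> scale_right_diff_distrib)
  obtain B \<beta> where B: "finite B" "B \<subseteq> P" "B \<inter> Z = {}" "\<And>b. lin (\<beta> b)"
    "\<And>b z. b \<in> B \<Longrightarrow> z \<in> Z \<Longrightarrow> \<beta> b z = 0" "\<And>x. x \<in> P \<Longrightarrow> x - (\<Sum>b\<in>B. sc (\<beta> b x) b) \<in> Z"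
    by (rule coordinates_mod[OF sZ sP ZP]) blast
  \<comment> \<open>In coordinates \<delta> is, modulo \<open>Z\<close>, a sum of rank one maps.
    Their functionals \<beta>_b \<delta> vanish on \<open>P\<close>, so they have slow growth along
    orbits in \<open>N\<close>.\<close>
  have "coboundary N P Z (\<lambda>x. sc (\<beta> b (\<delta> x)) b)" if b: "b \<in> B" for b
  proof (rule coboundary_if_small_relation[OF ctx])
    have lin: "lin (\<lambda>x. \<beta> b (\<delta> x))"
      using linD[OF B(4)[of b]] by (simp add: lin_on_def \<delta>_add \<delta>_sc)
    then show "functional_mod N P (\<lambda>x. \<beta> b (\<delta> x))"
      using linD(3)[OF B(4)[of b]] by (simp add: functional_mod_def[OF ctx] lin_on_def \<delta>0)
    show "\<exists>C. \<forall>j. v (\<beta> b (\<delta> ((T ^^ j) x))) \<le> C * \<rho>' ^ j" if "x \<in> N" for x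
      using that lin \<rho>' \<delta>0 linD(3)[OF B(4)[of b]] by (auto simp: N_def growth_mod_def growth_def)
    show "\<exists>m e. (\<forall>i. v (e i) * \<rho>' ^ i \<le> r) \<and> (\<forall>i\<ge>m. e i = 0) \<and>
        b - (\<Sum>i<m. sc (e i) ((T ^^ i) b)) \<in> Z" if "0 < r" for r
      using small_relation[OF irr spd' x0 f0 unb _ _ that] b B(2,3) by blast
  qed (use b B spd' in auto)
  then have "coboundary N P Z (\<lambda>x. \<Sum>b\<in>B. sc (\<beta> b (\<delta> x)) b)"
    by (rule coboundary_sum[OF ctx])
  then have "coboundary N P Z \<delta>"
    by (rule coboundary_cong[OF ctx]) (rule B(6)[OF \<delta>P])
  then obtain \<phi> where \<phi>: "map_mod N P \<phi>" "\<And>x. x \<in> N \<Longrightarrow> \<delta> x - (T (\<phi> x) - \<phi> (T x)) \<in> Z"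
    by (auto simp: coboundary_def[OF ctx])
  define \<sigma> where "\<sigma> x = x - \<pi> x - \<phi> x" for x
  have \<phi>': "\<And>x y. x \<in> N \<Longrightarrow> y \<in> N \<Longrightarrow> \<phi> (x + y) = \<phi> x + \<phi> y" "\<And>c x. x \<in> N \<Longrightarrow> \<phi> (sc c x) = sc c (\<phi> x)"
    "\<And>x. x \<in> N \<Longrightarrow> \<phi> x \<in> P" "\<And>x. x \<in> P \<Longrightarrow> \<phi> x = 0"
    using \<phi>(1) by (auto simp: map_mod_def[OF ctx])
  have \<sigma>T: "T (\<sigma> x) - \<sigma> (T x) \<in> Z" if "x \<in> N" for x
    using \<phi>(2)[OF that] by (simp add: \<sigma>_def \<delta>_def T_diff T_add algebra_simps)
  have xN: "x \<in> N" using x by (simp add: N_def)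
  have \<sigma>Ti: "(T ^^ i) (\<sigma> x) - \<sigma> ((T ^^ i) x) \<in> Z" for i
  proof (induction i)
    case 0
    then show ?case by (simp add: subspace_0[OF sZ])
  next
    case (Suc i)
    have "T ((T ^^ i) (\<sigma> x) - \<sigma> ((T ^^ i) x)) + (T (\<sigma> ((T ^^ i) x)) - \<sigma> (T ((T ^^ i) x))) \<in> Z"
      using Suc Z \<sigma>T[OF tsub_iter[OF N xN, of i]] by (intro subspace_add[OF sZ]) (auto simp: tsub_def)
    then show ?case by (simp add: T_diff)
  qed
  have "growth_mod \<rho> Z (\<sigma> x)"
    unfolding growth_mod_def
  proof (intro allI impI)
    fix f assume f: "lin f" "\<forall>z\<in>Z. f z = 0"
    have "lin_on N (\<lambda>x. f (\<sigma> x))"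
      unfolding lin_on_def
    proof (intro conjI ballI allI)
      fix x y assume "x \<in> N" "y \<in> N"
      then have "\<sigma> (x + y) = \<sigma> x + \<sigma> y" by (simp add: \<sigma>_def \<pi> \<phi>')
      then show "f (\<sigma> (x + y)) = f (\<sigma> x) + f (\<sigma> y)" by (simp add: linD[OF f(1)])
    next
      fix c x assume "x \<in> N"
      then have "\<sigma> (sc c x) = sc c (\<sigma> x)" by (simp add: \<sigma>_def \<pi> \<phi>' scale_right_diff_distrib)
      then show "f (\<sigma> (sc c x)) = c * f (\<sigma> x)" by (simp add: linD[OF f(1)])
    qed
    \<comment> \<open>f \<sigma> is linear on \<open>N\<close> only. Its extension \<open>g\<close>
      kills \<open>P\<close>, so the slowness of x modulo \<open>P\<close> applies to it.\<close>
    then obtain g where g: "lin g" "\<And>x. x \<in> N \<Longrightarrow> g x = f (\<sigma> x)"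
      using lin_on_extend[OF sN] by blast
    have "g z = 0" if "z \<in> P" for z
      using g(2)[of z] that PN by (auto simp: \<sigma>_def \<pi> \<phi>' linD[OF f(1)])
    then have "growth \<rho> (\<lambda>i. g ((T ^^ i) x))"
      using x g(1) by (auto simp: growth_mod_def)
    moreover have "g ((T ^^ i) x) = f ((T ^^ i) (\<sigma> x))" for i
      using g(2)[OF tsub_iter[OF N xN, of i]] \<sigma>Ti[of i] f(2) linD(5)[OF f(1), of "(T ^^ i) (\<sigma> x)" "\<sigma> ((T ^^ i) x)"]
      by simp
    ultimately show "growth \<rho> (\<lambda>i. f ((T ^^ i) (\<sigma> x)))" by simp
  qed
  moreover have "\<pi> x + \<phi> x \<in> P" using \<pi>(3) \<phi>'(3)[OF xN] sP by (intro subspace_add)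
  ultimately show ?thesis
    by (intro bexI[of _ "\<pi> x + \<phi> x"]) (simp_all add: \<sigma>_def diff_diff_eq)
qed

end

text \<open>The case of a slow factor. With a linear section \<sigma>, the deviation u(n) =
  T^n(\<sigma> x) - \<sigma>(T^n x) obeys u(n+1) = T u(n) + \<delta>(T^n x), and the ultrametric
  inequality bounds it by the largest contribution instead of by n of them.\<close>

lemma growth_mod_extension:
  assumes P: "tsub P" and Z: "tsub Z" and ZP: "Z \<subseteq> P" and \<rho>: "spd \<le> \<rho>"
    and Pcv: "\<And>y. y \<in> P \<Longrightarrow> growth_mod \<rho> Z y" and x: "growth_mod \<rho> P x"
  shows "growth_mod \<rho> Z x"
  unfolding growth_mod_def growth_def
proof (intro allI impI)
  fix f \<rho>' assume f: "lin f" "\<forall>z\<in>Z. f z = 0" and r: "\<rho> < \<rho>'"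
  note sP = tsub_subspace[OF P] and sZ = tsub_subspace[OF Z]
  have \<rho>0: "0 < \<rho>'" using r \<rho> spd_nonneg by linarith
  obtain K where K: "K \<ge> 1" "\<And>n x. v ((d ^^ n) x) \<le> K * \<rho>' ^ n * v x"
    using d_iter_bound[of \<rho>'] r \<rho> by auto
  obtain \<pi> where \<pi>: "\<And>x y. \<pi> (x + y) = \<pi> x + \<pi> y" "\<And>c x. \<pi> (sc c x) = sc c (\<pi> x)"
    "\<And>x. \<pi> x \<in> P" "\<And>x. x \<in> P \<Longrightarrow> \<pi> x = x"
    using projection_exists[OF sP] by blast
  define \<sigma> where "\<sigma> x = x - \<pi> x" for x
  define \<delta> where "\<delta> x = T (\<sigma> x) - \<sigma> (T x)" for x
  have \<delta>_eq: "\<delta> x = \<pi> (T x) - T (\<pi> x)" for x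
    by (simp add: \<delta>_def \<sigma>_def T_diff)
  have \<delta>P: "\<delta> x \<in> P" for x
    using \<pi>(3) P sP by (auto simp: \<delta>_eq tsub_def intro: subspace_diff)
  have \<delta>0: "\<delta> x = 0" if "x \<in> P" for x
    using that \<pi>(4) P by (simp add: \<delta>_eq tsub_def)
  have \<delta>_add: "\<delta> (x + y) = \<delta> x + \<delta> y" for x y
    by (simp add: \<delta>_eq T_add \<pi>)
  have \<delta>_sc: "\<delta> (sc c x) = sc c (\<delta> x)" for c x
    by (simp add: \<delta>_eq T_sc \<pi> scale_right_diff_distrib)
  obtain B \<beta> where B: "finite B" "B \<subseteq> P" "\<And>b. lin (\<beta> b)"
    "\<And>b z. b \<in> B \<Longrightarrow> z \<in> Z \<Longrightarrow> \<beta> b z = 0" "\<And>x. x \<in> P \<Longrightarrow> x - (\<Sum>b\<in>B. sc (\<beta> b x) b) \<in> Z"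
    by (rule coordinates_mod[OF sZ sP ZP]) blast
  have "\<exists>C\<ge>0. \<forall>m j. v (f ((T ^^ m) (sc (\<beta> b (\<delta> ((T ^^ j) x))) b))) \<le> C * \<rho>' ^ (m + j)" if b: "b \<in> B" for b
  proof -
    have "lin (\<lambda>x. \<beta> b (\<delta> x))" "\<And>z. z \<in> P \<Longrightarrow> \<beta> b (\<delta> z) = 0"
      using linD[OF B(3)[of b]] by (simp_all add: lin_on_def \<delta>_add \<delta>_sc \<delta>0)
    then have "growth \<rho> (\<lambda>j. \<beta> b (\<delta> ((T ^^ j) x)))"
      using x by (auto simp: growth_mod_def)
    then obtain C1 where C1: "0 \<le> C1" "\<And>j. v (\<beta> b (\<delta> ((T ^^ j) x))) \<le> C1 * \<rho>' ^ j"
      using growthE[OF _ r] by metis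
    have "growth \<rho> (\<lambda>j. f ((T ^^ j) b))"
      using Pcv[of b] B(2) b f by (auto simp: growth_mod_def)
    then obtain C2 where C2: "0 \<le> C2" "\<And>j. v (f ((T ^^ j) b)) \<le> C2 * \<rho>' ^ j"
      using growthE[OF _ r] by metis
    have "v (f ((T ^^ m) (sc (\<beta> b (\<delta> ((T ^^ j) x))) b))) \<le> (K * C1 * C2) * \<rho>' ^ (m + j)" for m j
    proof (rule lin_leibniz_bound[OF f(1)])
      fix k l assume m: "k + l = m"
      have "v ((d ^^ k) (\<beta> b (\<delta> ((T ^^ j) x)))) \<le> K * \<rho>' ^ k * (C1 * \<rho>' ^ j)"
        using K \<rho>0 by (intro order_trans[OF K(2)] mult_left_mono C1) auto
      then have "v ((d ^^ k) (\<beta> b (\<delta> ((T ^^ j) x)))) * v (f ((T ^^ l) b)) \<le>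
          (K * \<rho>' ^ k * (C1 * \<rho>' ^ j)) * (C2 * \<rho>' ^ l)"
        using C2 C1 K \<rho>0 v_nonneg by (intro mult_mono) auto
      also have "\<dots> = (K * C1 * C2) * \<rho>' ^ (m + j)"
        by (simp add: m[symmetric] power_add)
      finally show "v ((d ^^ k) (\<beta> b (\<delta> ((T ^^ j) x)))) * v (f ((T ^^ l) b)) \<le> (K * C1 * C2) * \<rho>' ^ (m + j)" .
    qed
    moreover have "0 \<le> K * C1 * C2" using K C1 C2 by simp
    ultimately show ?thesis by blast
  qed
  then obtain C where C: "\<And>b. b \<in> B \<Longrightarrow> 0 \<le> C b"
    "\<And>b m j. b \<in> B \<Longrightarrow> v (f ((T ^^ m) (sc (\<beta> b (\<delta> ((T ^^ j) x))) b))) \<le> C b * \<rho>' ^ (m + j)"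
    by metis
  define c where "c = (\<Sum>b\<in>B. C b)"
  have c0: "0 \<le> c" unfolding c_def by (intro sum_nonneg C(1))
  have bd\<delta>: "v (f ((T ^^ m) (\<delta> ((T ^^ j) x)))) \<le> c * \<rho>' ^ (m + j)" for m j
  proof -
    define w where "w = \<delta> ((T ^^ j) x)"
    have "(T ^^ m) w - (\<Sum>b\<in>B. (T ^^ m) (sc (\<beta> b w) b)) \<in> Z"
      using tsub_iter[OF Z B(5)[OF \<delta>P], of m] by (simp add: w_def T_iter_diff T_iter_sum)
    then have "f ((T ^^ m) w - (\<Sum>b\<in>B. (T ^^ m) (sc (\<beta> b w) b))) = 0"
      using f(2) by blast
    then have "f ((T ^^ m) w) = f (\<Sum>b\<in>B. (T ^^ m) (sc (\<beta> b w) b))"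
      by (simp add: linD(5)[OF f(1)])
    also have "\<dots> = (\<Sum>b\<in>B. f ((T ^^ m) (sc (\<beta> b w) b)))"
      by (rule lin_sum[OF f(1)])
    also have "v \<dots> \<le> c * \<rho>' ^ (m + j)"
    proof (rule v_sum_le[OF B(1)])
      fix b assume b: "b \<in> B"
      have "C b \<le> c" unfolding c_def using B(1) b C(1) by (intro member_le_sum) auto
      then show "v (f ((T ^^ m) (sc (\<beta> b w) b))) \<le> c * \<rho>' ^ (m + j)"
        unfolding w_def using \<rho>0 by (intro order_trans[OF C(2)[OF b]] mult_right_mono) auto
    qed (use c0 \<rho>0 in auto)
    finally show ?thesis unfolding w_def .
  qed
  define u where "u n = (T ^^ n) (\<sigma> x) - \<sigma> ((T ^^ n) x)" for n
  \<comment> \<open>Stated for all T^m, because the step trades u(n+1) at m for u(n) at m + 1. A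
    contribution \<delta>(T^j x) enters u(n) after n - 1 - j further applications of
    \<open>T\<close>, whence the factor 1/\<rho>'.\<close>
  have bdu: "v (f ((T ^^ m) (u n))) \<le> c / \<rho>' * \<rho>' ^ (m + n)" for m n
  proof (induction n arbitrary: m)
    case 0
    then show ?case using c0 \<rho>0 by (simp add: u_def linD[OF f(1)])
  next
    case (Suc n)
    have "u (Suc n) = T (u n) + \<delta> ((T ^^ n) x)"
      by (simp add: u_def \<delta>_def T_diff)
    then have "f ((T ^^ m) (u (Suc n))) = f ((T ^^ Suc m) (u n)) + f ((T ^^ m) (\<delta> ((T ^^ n) x)))"
      by (simp add: T_iter_add linD[OF f(1)] funpow_swap1)
    also have "v \<dots> \<le> max (v (f ((T ^^ Suc m) (u n)))) (v (f ((T ^^ m) (\<delta> ((T ^^ n) x)))))"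
      by (rule v_ultra)
    also have "\<dots> \<le> c / \<rho>' * \<rho>' ^ (m + Suc n)"
      using Suc[of "Suc m"] bd\<delta>[of m n] \<rho>0 by simp
    finally show ?case .
  qed
  have "growth \<rho> (\<lambda>i. f ((T ^^ i) (\<pi> x)))"
    using Pcv[OF \<pi>(3)[of x]] f by (auto simp: growth_mod_def)
  then obtain C1 where C1: "0 \<le> C1" "\<And>j. v (f ((T ^^ j) (\<pi> x))) \<le> C1 * \<rho>' ^ j"
    using growthE[OF _ r] by metis
  have "lin (\<lambda>x. f (\<sigma> x))" "\<And>z. z \<in> P \<Longrightarrow> f (\<sigma> z) = 0"
    by (simp_all add: lin_on_def \<sigma>_def \<pi> linD[OF f(1)] right_diff_distrib)
  then have "growth \<rho> (\<lambda>i. f (\<sigma> ((T ^^ i) x)))"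
    using x by (auto simp: growth_mod_def)
  then obtain C2 where C2: "0 \<le> C2" "\<And>j. v (f (\<sigma> ((T ^^ j) x))) \<le> C2 * \<rho>' ^ j"
    using growthE[OF _ r] by metis
  have "v (f ((T ^^ i) x)) \<le> (C1 + c / \<rho>' + C2) * \<rho>' ^ i" for i
  proof -
    have "(T ^^ i) x = (T ^^ i) (\<pi> x) + (u i + \<sigma> ((T ^^ i) x))"
      by (simp add: u_def \<sigma>_def T_iter_diff)
    then have "f ((T ^^ i) x) = f ((T ^^ i) (\<pi> x)) + (f (u i) + f (\<sigma> ((T ^^ i) x)))"
      by (metis linD(1)[OF f(1)])
    then have "v (f ((T ^^ i) x)) \<le> max (v (f ((T ^^ i) (\<pi> x)))) (v (f (u i) + f (\<sigma> ((T ^^ i) x))))"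
      by (simp only: v_ultra)
    also have "\<dots> \<le> max (v (f ((T ^^ i) (\<pi> x)))) (max (v (f (u i))) (v (f (\<sigma> ((T ^^ i) x)))))"
      by (intro max.mono v_ultra order_refl)
    also have "\<dots> \<le> C1 * \<rho>' ^ i + c / \<rho>' * \<rho>' ^ i + C2 * \<rho>' ^ i"
    proof -
      have "0 \<le> C1 * \<rho>' ^ i" "0 \<le> c / \<rho>' * \<rho>' ^ i" "0 \<le> C2 * \<rho>' ^ i"
        using C1 C2 c0 \<rho>0 by auto
      then show ?thesis
        using C1(2)[of i] C2(2)[of i] bdu[of 0 i] by simp
    qed
    finally show ?thesis by (simp add: distrib_right)
  qed
  then show "\<exists>C. \<forall>i. v (f ((T ^^ i) x)) \<le> C * \<rho>' ^ i" by blast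
qed

lemma lift_step:
  assumes irr: "irr P Z" and \<rho>: "spd \<le> \<rho>" and x: "growth_mod \<rho> P x"
  shows "\<exists>p\<in>P. growth_mod \<rho> Z (x - p)"
proof (cases "\<forall>y\<in>P. growth_mod \<rho> Z y")
  case True
  have "tsub P" "tsub Z" "Z \<subseteq> P" using irr by (auto simp: irr_def)
  moreover from this have "0 \<in> P" using subspace_0 tsub_subspace by blast
  ultimately show ?thesis
    using growth_mod_extension[of P Z \<rho> x] True \<rho> x by (intro bexI[of _ 0]) auto
next
  case False
  then obtain y f \<rho>' where "y \<in> P" "lin f" "\<And>z. z \<in> Z \<Longrightarrow> f z = 0" "\<rho> < \<rho>'"
    "\<not> (\<exists>C. \<forall>i. v (f ((T ^^ i) y)) \<le> C * \<rho>' ^ i)"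
    unfolding growth_mod_def growth_def by blast
  then show ?thesis
    using lift_step_nonconv[OF irr \<rho> _ _ _ _ _ x] by blast
qed

lemma maximal_tsub:
  assumes "tsub P" "P \<noteq> {0}"
  obtains Z where "irr P Z"
proof -
  define D where "D Z \<longleftrightarrow> tsub Z \<and> Z \<subset> P" for Z
  have "D {0}"
    using assms tsub_0 subspace_0[OF tsub_subspace[OF assms(1)]] by (auto simp: D_def)
  moreover have "\<forall>Z. D Z \<longrightarrow> dim Z < Suc (dim P)"
    by (auto simp: D_def intro!: le_imp_less_Suc dim_le)
  ultimately obtain Z where Z: "D Z" "\<And>Y. D Y \<Longrightarrow> dim Y \<le> dim Z"
    using ex_has_greatest_nat[of D "{0}" dim] by blast
  have "Q = Z \<or> Q = P" if Q: "tsub Q" "Z \<subseteq> Q" "Q \<subseteq> P" for Q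
  proof (rule ccontr)
    assume "\<not> ?thesis"
    then have "D Q" "Z \<subset> Q" using Q by (auto simp: D_def)
    then show False
      using Z(2)[of Q] Z(1) dim_strict_mono[of Z Q] Q(1) by (simp add: D_def tsub_def)
  qed
  then have "irr P Z" using assms Z(1) by (auto simp: irr_def D_def)
  then show ?thesis by (rule that)
qed

text \<open>Irreducible quotients of \<open>P\<close> are peeled off from the top, each by
  \<open>lift_step\<close>; thus slow vectors of M/P come from slow vectors of
  \<open>M\<close>.\<close>

lemma lift:
  assumes "tsub P" and \<rho>: "spd \<le> \<rho>" and "growth_mod \<rho> P x"
  shows "\<exists>p\<in>P. growth_mod \<rho> {0} (x - p)"
  using assms(1,3)
proof (induction "dim P" arbitrary: P x rule: less_induct)
  case less
  show ?case
  proof (cases "P = {0}")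
    case True
    then show ?thesis using less by auto
  next
    case False
    then obtain Z where irr: "irr P Z" using maximal_tsub less.prems by blast
    then have Z: "tsub Z" "Z \<subset> P" by (auto simp: irr_def)
    obtain p where p: "p \<in> P" "growth_mod \<rho> Z (x - p)"
      using lift_step[OF irr \<rho> less.prems(2)] by blast
    have "dim Z < dim P"
      using Z less.prems(1) by (intro dim_strict_mono) (auto simp: tsub_def)
    then obtain q where q: "q \<in> Z" "growth_mod \<rho> {0} (x - p - q)"
      using less.hyps[OF _ Z(1) p(2)] by blast
    have "p + q \<in> P" using p q Z less.prems(1) by (auto simp: tsub_def subspace_add)
    then show ?thesis using q(2) by (intro bexI[of _ "p + q"]) (simp_all add: diff_diff_eq)
  qed
qed

end

section \<open>Duality and extension of functionals\<close>

text \<open>Meant for a(i,j) = <T^i x, T'^j y>: the Leibniz rule trades an increase of j for an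
  increase of i or a derivative, each costing a factor \<rho>'. It transports growth between a
  module and its dual.\<close>

lemma (in nonarch_diff_field) growth_transfer:
  assumes a: "\<And>i j. d (a i j) = a (Suc i) j + a i (Suc j)" and \<rho>: "spd \<le> \<rho>"
    and g: "growth \<rho> (\<lambda>i. a i 0)"
  shows "growth \<rho> (\<lambda>j. a 0 j)"
  unfolding growth_def
proof (intro allI impI)
  fix \<rho>' assume r: "\<rho> < \<rho>'"
  have \<rho>0: "0 < \<rho>'" using r \<rho> spd_nonneg by linarith
  obtain K where K: "K \<ge> 1" "\<And>n x. v ((d ^^ n) x) \<le> K * \<rho>' ^ n * v x"
    using d_iter_bound[of \<rho>'] r \<rho> by auto
  obtain C where C: "0 \<le> C" "\<And>i. v (a i 0) \<le> C * \<rho>' ^ i"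
    using growthE[OF g r] by metis
  have bd: "v ((d ^^ k) (a i j)) \<le> K * C * \<rho>' ^ (k + i + j)" for k i j
  proof (induction j arbitrary: k i)
    case 0
    have "v ((d ^^ k) (a i 0)) \<le> K * \<rho>' ^ k * (C * \<rho>' ^ i)"
      using K \<rho>0 by (intro order_trans[OF K(2)] mult_left_mono C) auto
    then show ?case by (simp add: power_add mult_ac)
  next
    case (Suc j)
    have "a i (Suc j) = d (a i j) - a (Suc i) j" by (simp add: a)
    then have "(d ^^ k) (a i (Suc j)) = (d ^^ Suc k) (a i j) - (d ^^ k) (a (Suc i) j)"
      by (simp add: d_iter_diff funpow_swap1)
    also have "v \<dots> \<le> max (v ((d ^^ Suc k) (a i j))) (v ((d ^^ k) (a (Suc i) j)))"
      by (rule v_diff_le)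
    also have "\<dots> \<le> K * C * \<rho>' ^ (k + i + Suc j)"
      using Suc[of "Suc k" i] Suc[of k "Suc i"] by simp
    finally show ?case .
  qed
  have "v (a 0 j) \<le> K * C * \<rho>' ^ j" for j
    using bd[of 0 0 j] by simp
  then show "\<exists>C. \<forall>j. v (a 0 j) \<le> C * \<rho>' ^ j" by blast
qed

context diff_space
begin

text \<open>A basis identifies the dual space with \<open>M\<close>, so the dual module lives on the
  same type and \<open>diff_space\<close> can be interpreted for it.\<close>

lemma pairing_exists:
  obtains pr :: "'m \<Rightarrow> 'm \<Rightarrow> 'k" where "\<And>x. lin (pr x)" "\<And>x y. pr x y = pr y x"
    "\<And>f. lin f \<Longrightarrow> \<exists>y. \<forall>x. f x = pr x y" "\<And>y. (\<And>x. pr x y = 0) \<Longrightarrow> y = 0"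
proof -
  obtain B \<beta> where B: "finite B" "\<And>b. lin (\<beta> b)" "\<And>x. x - (\<Sum>b\<in>B. sc (\<beta> b x) b) \<in> {0}"
    "\<And>b c. b \<in> B \<Longrightarrow> c \<in> B \<Longrightarrow> \<beta> b c = (if b = c then 1 else 0)"
    by (rule coordinates_mod[OF tsub_subspace[OF tsub_0] subspace_UNIV subset_UNIV]) auto
  have rep: "(\<Sum>b\<in>B. sc (\<beta> b x) b) = x" for x
    using B(3)[of x] by simp
  define pr where "pr x y = (\<Sum>b\<in>B. \<beta> b x * \<beta> b y)" for x y
  show ?thesis
  proof (rule that[of pr])
    show "lin (pr x)" for x
      using linD[OF B(2)] by (simp add: lin_on_def pr_def distrib_left sum.distrib sum_distrib_left mult_ac)
    show "pr x y = pr y x" for x y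
      by (simp add: pr_def mult.commute)
    show "\<exists>y. \<forall>x. f x = pr x y" if f: "lin f" for f
    proof (intro exI allI)
      fix x
      have "\<beta> b (\<Sum>c\<in>B. sc (f c) c) = f b" if "b \<in> B" for b
      proof -
        have "\<beta> b (\<Sum>c\<in>B. sc (f c) c) = (\<Sum>c\<in>B. f c * \<beta> b c)"
          by (simp add: lin_sum[OF B(2)] linD[OF B(2)])
        also have "\<dots> = (\<Sum>c\<in>B. if b = c then f c else 0)"
          using that by (intro sum.cong) (auto simp: B(4))
        finally show ?thesis using that B(1) by simp
      qed
      then have "pr x (\<Sum>c\<in>B. sc (f c) c) = (\<Sum>b\<in>B. f (sc (\<beta> b x) b))"
        by (simp add: pr_def linD[OF f])
      also have "\<dots> = f x"
        by (simp only: lin_sum[OF f, symmetric] rep)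
      finally show "f x = pr x (\<Sum>c\<in>B. sc (f c) c)" ..
    qed
    show "y = 0" if y: "\<And>x. pr x y = 0" for y
    proof -
      have "\<beta> b y = 0" if b: "b \<in> B" for b
      proof -
        have "pr b y = (\<Sum>c\<in>B. if c = b then \<beta> c y else 0)"
          unfolding pr_def using b by (intro sum.cong) (auto simp: B(4))
        then show ?thesis using y[of b] b B(1) by simp
      qed
      then show ?thesis using rep[of y] by simp
    qed
  qed
qed

lemma dual_exists:
  obtains T' :: "'m \<Rightarrow> 'm" and pr :: "'m \<Rightarrow> 'm \<Rightarrow> 'k" where "diff_space v d sc T'"
    "\<And>x. lin (pr x)" "\<And>x y. pr x y = pr y x" "\<And>f. lin f \<Longrightarrow> \<exists>y. \<forall>x. f x = pr x y"
    "\<And>x y. d (pr x y) = pr (T x) y + pr x (T' y)"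
proof -
  obtain pr where pr: "\<And>x. lin (pr x)" "\<And>x y. pr x y = pr y x"
    "\<And>f. lin f \<Longrightarrow> \<exists>y. \<forall>x. f x = pr x y" "\<And>y. (\<And>x. pr x y = 0) \<Longrightarrow> y = 0"
    using pairing_exists by blast
  have pr': "lin (\<lambda>x. pr x y)" for y
    using pr(1)[of y] by (simp add: pr(2)[of _ y])
  have eqI: "y = z" if "\<And>x. pr x y = pr x z" for y z
  proof -
    have "y - z = 0"
      by (rule pr(4)) (simp add: linD[OF pr(1)] that)
    then show ?thesis by simp
  qed
  \<comment> \<open>The terms coming from d(c) cancel, so the left-hand side is linear in x and is
    represented by a vector, the future \<open>T' y\<close>.\<close>
  have "\<exists>z. \<forall>x. d (pr x y) - pr (T x) y = pr x z" for y
  proof (rule pr(3))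
    show "lin (\<lambda>x. d (pr x y) - pr (T x) y)"
      unfolding lin_on_def by (simp add: linD[OF pr'] T_add T_sc d_add d_mult algebra_simps)
  qed
  then obtain T' where T': "\<And>x y. d (pr x y) - pr (T x) y = pr x (T' y)"
    by metis
  have "diff_space v d sc T'"
  proof
    show "T' (x + y) = T' x + T' y" for x y
      by (rule eqI) (simp add: T'[symmetric] linD[OF pr(1)] d_add)
    show "T' (sc c x) = sc c (T' x) + sc (d c) x" for c x
      by (rule eqI) (simp add: T'[symmetric] linD[OF pr(1)] d_mult algebra_simps)
  qed (rule fin_dim)
  then show ?thesis
    using that[of T' pr] pr(1-3) by (simp add: T'[symmetric])
qed

text \<open>The dual form of \<open>lift\<close>. Modulo the annihilator \<open>P\<close> of
  \<open>N\<close> the dual of \<open>M\<close> becomes the dual of \<open>N\<close>; a functional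
  slow on \<open>N\<close> is a vector slow modulo \<open>P\<close>, and correcting it by an element
  of \<open>P\<close> does not change it on \<open>N\<close>.\<close>

lemma extend_functional:
  assumes N: "tsub N" and \<rho>: "spd \<le> \<rho>" and f: "lin f"
    and g: "\<And>x. x \<in> N \<Longrightarrow> growth \<rho> (\<lambda>i. f ((T ^^ i) x))"
  obtains h where "lin h" "\<And>x. x \<in> N \<Longrightarrow> h x = f x" "\<And>x. growth \<rho> (\<lambda>i. h ((T ^^ i) x))"
proof -
  obtain T' pr where D: "diff_space v d sc T'" and pr: "\<And>x. lin (pr x)" "\<And>x y. pr x y = pr y x"
    "\<And>f. lin f \<Longrightarrow> \<exists>y. \<forall>x. f x = pr x y" and dpr: "\<And>x y. d (pr x y) = pr (T x) y + pr x (T' y)"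
    using dual_exists by blast
  interpret D: diff_space v d sc T' by (rule D)
  have pr': "lin (\<lambda>x. pr x y)" for y
    using pr(1)[of y] by (simp add: pr(2)[of _ y])
  obtain y where y: "\<And>x. f x = pr x y" using pr(3)[OF f] by blast
  define P where "P = {y. \<forall>x\<in>N. pr x y = 0}"
  have P: "D.tsub P"
    unfolding D.tsub_def
  proof (intro conjI ballI)
    show "subspace P" by (auto simp: P_def subspace_def linD[OF pr(1)])
    show "T' z \<in> P" if "z \<in> P" for z
    proof -
      have "pr x (T' z) = 0" if x: "x \<in> N" for x
        using dpr[of x z] \<open>z \<in> P\<close> x N by (simp add: P_def tsub_def)
      then show ?thesis by (simp add: P_def)
    qed
  qed
  have tr: "growth \<rho> (\<lambda>i. pr x ((T' ^^ i) z))" if "growth \<rho> (\<lambda>i. pr ((T ^^ i) x) z)" for x z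
    using growth_transfer[of "\<lambda>i j. pr ((T ^^ i) x) ((T' ^^ j) z)" \<rho>] \<rho> that dpr by simp
  have tr': "growth \<rho> (\<lambda>i. pr ((T ^^ i) x) z)" if "growth \<rho> (\<lambda>i. pr x ((T' ^^ i) z))" for x z
    using growth_transfer[of "\<lambda>i j. pr ((T ^^ j) x) ((T' ^^ i) z)" \<rho>] \<rho> that dpr by (simp add: add.commute)
  have "D.growth_mod \<rho> P y"
    unfolding D.growth_mod_def
  proof (intro allI impI)
    fix k assume k: "lin k" "\<forall>z\<in>P. k z = 0"
    obtain x where x: "\<And>z. k z = pr x z" using pr(3)[OF k(1)] by (auto simp: pr(2))
    \<comment> \<open>\<open>k\<close> kills the annihilator of \<open>N\<close>, so by biduality it
      is evaluation at an element of \<open>N\<close>.\<close>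
    have "x \<in> N"
    proof (rule ccontr)
      assume "x \<notin> N"
      then obtain l where l: "lin l" "\<And>y. y \<in> N \<Longrightarrow> l y = 0" "l x = 1"
        using separating_functional[OF tsub_subspace[OF N]] by blast
      obtain z where z: "\<And>x. l x = pr x z" using pr(3)[OF l(1)] by blast
      have "z \<in> P" using l(2) z by (auto simp: P_def)
      then have "pr x z = 0" using k(2) x by auto
      then show False using z l(3) by simp
    qed
    then show "growth \<rho> (\<lambda>i. k ((T' ^^ i) y))"
      using g[of x] tr[of x y] by (simp add: y x)
  qed
  then obtain p where p: "p \<in> P" "D.growth_mod \<rho> {0} (y - p)"
    using D.lift[OF P \<rho>] by blast
  show ?thesis
  proof (rule that[of "\<lambda>x. pr x (y - p)"])
    show "lin (\<lambda>x. pr x (y - p))" by (rule pr')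
    show "pr x (y - p) = f x" if "x \<in> N" for x
      using p(1) that by (simp add: linD[OF pr(1)] y P_def)
    show "growth \<rho> (\<lambda>i. pr ((T ^^ i) x) (y - p))" for x
      by (rule tr') (use p(2) pr(1)[of x] linD(3)[OF pr(1)[of x]] in \<open>auto simp: D.growth_mod_def\<close>)
  qed
qed

section \<open>Slow functionals and the splitting into slow and fast part\<close>

definition good_functionals :: "real \<Rightarrow> ('m \<Rightarrow> 'k) set" where
  "good_functionals \<rho> = {f. lin f \<and> (\<forall>x. growth \<rho> (\<lambda>i. f ((T ^^ i) x)))}"

definition fast_part :: "real \<Rightarrow> 'm set" where
  "fast_part \<rho> = {x. \<forall>f\<in>good_functionals \<rho>. f x = 0}"

definition slow_part :: "real \<Rightarrow> 'm set" where
  "slow_part \<rho> = {x. growth_mod \<rho> {0} x}"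

lemma slow_part_tsub: "spd \<le> \<rho> \<Longrightarrow> tsub (slow_part \<rho>)"
  unfolding slow_part_def by (rule growth_mod_tsub)

lemma slow_part_mono: "\<rho> \<le> \<rho>' \<Longrightarrow> slow_part \<rho> \<subseteq> slow_part \<rho>'"
  unfolding slow_part_def using growth_mod_mono by blast

lemma fast_part_antimono: "\<rho> \<le> \<rho>' \<Longrightarrow> fast_part \<rho>' \<subseteq> fast_part \<rho>"
  unfolding fast_part_def good_functionals_def using growth_mono by blast

lemma growth_mult_const:
  assumes "growth \<rho> a" "0 \<le> \<rho>"
  shows "growth \<rho> (\<lambda>i. c * a i)"
  unfolding growth_def
proof (intro allI impI)
  fix \<rho>' assume r: "\<rho> < \<rho>'"
  obtain C where C: "\<And>i. v (a i) \<le> C * \<rho>' ^ i"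
    using growthE[OF assms(1) r] by metis
  have "v (c * a i) \<le> v c * C * \<rho>' ^ i" for i
    using mult_left_mono[OF C[of i] v_nonneg[of c]] by (simp add: v_mult mult_ac)
  then show "\<exists>C. \<forall>i. v (c * a i) \<le> C * \<rho>' ^ i" by blast
qed

lemma growth_d:
  assumes "growth \<rho> a" "0 \<le> \<rho>"
  shows "growth \<rho> (\<lambda>i. d (a i))"
  unfolding growth_def
proof (intro allI impI)
  fix \<rho>' assume r: "\<rho> < \<rho>'"
  obtain D where D: "\<And>x. v (d x) \<le> D * v x" using d_bounded by blast
  obtain C where C: "0 \<le> C" "\<And>i. v (a i) \<le> C * \<rho>' ^ i"
    using growthE[OF assms(1) r] by metis
  have "v (d (a i)) \<le> \<bar>D\<bar> * C * \<rho>' ^ i" for i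
  proof -
    have "v (d (a i)) \<le> \<bar>D\<bar> * v (a i)"
      using D[of "a i"] v_nonneg[of "a i"] by (smt (verit) mult_right_mono)
    also have "\<dots> \<le> \<bar>D\<bar> * (C * \<rho>' ^ i)" by (intro mult_left_mono C) auto
    finally show ?thesis by simp
  qed
  then show "\<exists>C. \<forall>i. v (d (a i)) \<le> C * \<rho>' ^ i" by blast
qed

lemma good_functionals_Td:
  assumes f: "f \<in> good_functionals \<rho>" and \<rho>: "spd \<le> \<rho>"
  shows "(\<lambda>x. f (T x) - d (f x)) \<in> good_functionals \<rho>"
proof -
  have \<rho>0: "0 \<le> \<rho>" using \<rho> spd_nonneg by linarith
  have lf: "lin f" and g: "\<And>x. growth \<rho> (\<lambda>i. f ((T ^^ i) x))"
    using f by (auto simp: good_functionals_def)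
  have "lin (\<lambda>x. f (T x) - d (f x))"
    unfolding lin_on_def by (simp add: linD[OF lf] T_add T_sc d_add d_mult algebra_simps)
  moreover have "growth \<rho> (\<lambda>i. f (T ((T ^^ i) x)) - d (f ((T ^^ i) x)))" for x
    using growth_add[OF growth_Suc[OF g[of x] \<rho>0] growth_mult_const[OF growth_d[OF g[of x] \<rho>0] \<rho>0, of "-1"] \<rho>0]
    by simp
  ultimately show ?thesis by (simp add: good_functionals_def)
qed

text \<open>Slow functionals are stable under f -> f T - d f; if f and its image vanish at x, then f
  vanishes at T x.\<close>

lemma fast_part_tsub:
  assumes "spd \<le> \<rho>"
  shows "tsub (fast_part \<rho>)"
  unfolding tsub_def
proof (intro conjI ballI)
  show "subspace (fast_part \<rho>)"
    by (auto simp: fast_part_def good_functionals_def subspace_def linD)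
  show "T x \<in> fast_part \<rho>" if x: "x \<in> fast_part \<rho>" for x
    unfolding fast_part_def
  proof (intro CollectI ballI)
    fix f assume f: "f \<in> good_functionals \<rho>"
    then have "f x = 0" "f (T x) - d (f x) = 0"
      using x good_functionals_Td[OF f assms] by (auto simp: fast_part_def)
    then show "f (T x) = 0" by simp
  qed
qed

text \<open>Biduality: the slow functionals form a subspace of the finite-dimensional dual, hence
  equal the annihilator of their common kernel. The pairing turns functionals into vectors so that
  \<open>separating_functional\<close> applies to them.\<close>

lemma kill_fast_part_good:
  assumes f: "lin f" "\<And>x. x \<in> fast_part \<rho> \<Longrightarrow> f x = 0" and \<rho>: "spd \<le> \<rho>"
  shows "f \<in> good_functionals \<rho>"
proof -
  have \<rho>0: "0 \<le> \<rho>" using \<rho> spd_nonneg by linarith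
  obtain pr where pr: "\<And>x. lin (pr x)" "\<And>x y. pr x y = pr y x"
    "\<And>f. lin f \<Longrightarrow> \<exists>y. \<forall>x. f x = pr x y" "\<And>y. (\<And>x. pr x y = 0) \<Longrightarrow> y = 0"
    using pairing_exists by blast
  have pr': "lin (\<lambda>x. pr x y)" for y
    using pr(1)[of y] by (simp add: pr(2)[of _ y])
  obtain y where y: "\<And>x. f x = pr x y" using pr(3)[OF f(1)] by blast
  define Y where "Y = {y. (\<lambda>x. pr x y) \<in> good_functionals \<rho>}"
  have "subspace Y"
    unfolding Y_def good_functionals_def subspace_def using \<rho>0 pr'
    by (auto simp: linD[OF pr(1)] growth_0 growth_add growth_mult_const)
  have "y \<in> Y"
  proof (rule ccontr)
    assume "y \<notin> Y"
    then obtain l where l: "lin l" "\<And>z. z \<in> Y \<Longrightarrow> l z = 0" "l y = 1"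
      using separating_functional[OF \<open>subspace Y\<close>] by blast
    obtain x where x: "\<And>z. l z = pr x z" using pr(3)[OF l(1)] by (auto simp: pr(2))
    have "x \<in> fast_part \<rho>"
      unfolding fast_part_def
    proof (intro CollectI ballI)
      fix h assume h: "h \<in> good_functionals \<rho>"
      then obtain z where z: "\<And>x. h x = pr x z" using pr(3)[of h] by (auto simp: good_functionals_def)
      then have "h = (\<lambda>x. pr x z)" by auto
      then have "z \<in> Y" using h by (simp add: Y_def)
      then show "h x = 0" using l(2)[of z] x z by simp
    qed
    then show False using f(2)[of x] y x l(3) by simp
  qed
  moreover have "f = (\<lambda>x. pr x y)" using y by auto
  ultimately show ?thesis by (simp add: Y_def)
qed

lemma growth_mod_fast_part:
  assumes "spd \<le> \<rho>"
  shows "growth_mod \<rho> (fast_part \<rho>) x"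
  unfolding growth_mod_def using kill_fast_part_good[OF _ _ assms] by (auto simp: good_functionals_def)

text \<open>The quotient by the fast part is slow throughout, so every x can be fed to
  \<open>lift\<close>.\<close>

lemma slow_fast_sum:
  assumes "spd \<le> \<rho>"
  obtains p where "p \<in> fast_part \<rho>" "x - p \<in> slow_part \<rho>"
  using lift[OF fast_part_tsub[OF assms] assms growth_mod_fast_part[OF assms, of x]] by (auto simp: slow_part_def)

text \<open>A functional with value 1 at x is slow on the slow part, hence agrees there with a slow
  functional on \<open>M\<close>; the latter vanishes on the fast part.\<close>

lemma slow_fast_int:
  assumes "spd \<le> \<rho>" "x \<in> slow_part \<rho>" "x \<in> fast_part \<rho>"
  shows "x = 0"
proof (rule ccontr)
  assume "x \<noteq> 0"
  then obtain f where f: "lin f" "f x = 1"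
    using separating_functional[OF tsub_subspace[OF tsub_0], of x] by (metis singletonD)
  have "growth \<rho> (\<lambda>i. f ((T ^^ i) y))" if "y \<in> slow_part \<rho>" for y
    using that f(1) linD(3)[OF f(1)] by (auto simp: slow_part_def growth_mod_def)
  then obtain h where h: "lin h" "\<And>x. x \<in> slow_part \<rho> \<Longrightarrow> h x = f x" "\<And>x. growth \<rho> (\<lambda>i. h ((T ^^ i) x))"
    using extend_functional[OF slow_part_tsub[OF assms(1)] assms(1) f(1)] by blast
  then have "h x = 0" using assms(3) by (auto simp: fast_part_def good_functionals_def)
  then show False using h(2)[OF assms(2)] f by simp
qed

end

section \<open>Modules over twisted polynomials and their solutions\<close>

locale fd_module = nonarch_diff_field v d
  for v :: "'k::field_char_0 \<Rightarrow> real" and d :: "'k \<Rightarrow> 'k" +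
  fixes act :: "'k poly \<Rightarrow> 'm::ab_group_add \<Rightarrow> 'm"
  assumes fd: "KT_module_fd d act" and p_pos: "residue_char v > 0"
begin

sublocale M: KT_module d act
  using fd by (simp add: KT_module_fd_def)

lemma act_0_right [simp]: "act p 0 = 0"
  using M.act_add_right[of p 0 0] by simp

lemma act_0_left [simp]: "act 0 x = 0"
  using M.act_add_left[of 0 0 x] by simp

lemma act_sum_left: "act (\<Sum>i\<in>I. p i) x = (\<Sum>i\<in>I. act (p i) x)"
  by (induction I rule: infinite_finite_induct) (simp_all add: M.act_add_left)

lemma tw_mult_const: "tw_mult d [:c:] q = smult c q"
  by (simp add: tw_mult_def)

lemma tw_mult_T: "tw_mult d [:0, 1:] q = T_mult d q"
  by (simp add: tw_mult_def)

lemma act_smult: "act (smult c q) x = scal act c (act q x)"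
  by (simp only: tw_mult_const[symmetric] M.act_mult scal_def)

lemma act_T_mult: "act (T_mult d q) x = T_op act (act q x)"
  by (simp only: tw_mult_T[symmetric] M.act_mult T_op_def)

lemma T_op_scal: "T_op act (scal act c x) = scal act c (T_op act x) + scal act (d c) x"
proof -
  have "T_mult d [:c:] = smult c [:0, 1:] + [:d c:]"
    by (simp add: T_mult_def map_poly_pCons)
  then show ?thesis
    unfolding scal_def[of act c] act_T_mult[symmetric]
    by (simp only: M.act_add_left act_smult) (simp add: scal_def T_op_def)
qed

sublocale vector_space "scal act"
proof
  fix a b x y
  show "scal act a (x + y) = scal act a x + scal act a y"
    by (simp add: scal_def M.act_add_right)
  show "scal act (a + b) x = scal act a x + scal act b x"
    unfolding scal_def M.act_add_left[symmetric] by simp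
  show "scal act a (scal act b x) = scal act (a * b) x"
    unfolding scal_def M.act_mult[symmetric] tw_mult_const by simp
  show "scal act 1 x = x"
    using M.act_one[of x] by (simp add: scal_def one_pCons)
qed

sublocale diff_space v d "scal act" "T_op act"
proof
  show "T_op act (x + y) = T_op act x + T_op act y" for x y
    by (simp add: T_op_def M.act_add_right)
  show "T_op act (scal act c x) = scal act c (T_op act x) + scal act (d c) x" for c x
    by (rule T_op_scal)
  show "\<exists>B. finite B \<and> span B = UNIV"
    using fd by (simp add: KT_module_fd_def)
qed

abbreviation "sc \<equiv> scal act"
abbreviation "T \<equiv> T_op act"

lemma act_monom: "act (monom c i) x = sc c ((T ^^ i) x)"
proof -
  have "act (monom 1 i) x = (T ^^ i) x"
  proof (induction i)
    case 0
    then show ?case by (simp add: M.act_one monom_0 one_pCons[symmetric])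
  next
    case (Suc i)
    have "T_mult d (monom 1 i) = monom 1 (Suc i)"
      by (simp add: T_mult_def monom_Suc map_poly_monom)
    then show ?case
      using act_T_mult[of "monom 1 i" x] Suc by simp
  qed
  then show ?thesis
    using act_smult[of c "monom 1 i" x] by (simp add: smult_monom)
qed

lemma act_eq: "act p x = (\<Sum>i\<le>degree p. sc (coeff p i) ((T ^^ i) x))"
  by (subst poly_as_sum_of_monoms[symmetric, of p]) (simp add: act_sum_left act_monom)

lemma KT_submodule_iff: "KT_submodule act N \<longleftrightarrow> tsub N"
proof
  assume "KT_submodule act N"
  then show "tsub N"
    unfolding tsub_def subspace_def KT_submodule_def by (auto simp: scal_def T_op_def)
next
  assume N: "tsub N"
  then have s: "subspace N" by (rule tsub_subspace)
  have "act p x \<in> N" if "x \<in> N" for p x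
  proof -
    have "(\<Sum>i\<le>degree p. sc (coeff p i) ((T ^^ i) x)) \<in> N"
      using tsub_iter[OF N that] by (auto intro!: subspace_sum[OF s] subspace_scale[OF s])
    then show ?thesis by (simp only: act_eq)
  qed
  then show "KT_submodule act N"
    using s by (auto simp: KT_submodule_def subspace_def)
qed

lemma irreducible_quot_iff: "irreducible_quot act N L \<longleftrightarrow> irr N L"
  by (simp add: irreducible_quot_def irr_def KT_submodule_iff)

definition sol :: "('m \<Rightarrow> 'k) \<Rightarrow> 'm \<Rightarrow> 'k fps" where
  "sol f x = Abs_fps (\<lambda>i. f ((T ^^ i) x) / fact i)"

lemma fps_act_const: "fps_act d [:c:] F = g0 d c * F"
  by (simp add: fps_act_def)

lemma fps_act_T: "fps_act d [:0, 1:] F = fps_deriv F"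
  by (simp add: fps_act_def)

lemma fps_deriv_sol: "fps_deriv (sol f x) = sol f (T x)"
proof (rule fps_ext)
  fix n
  have "(of_nat (Suc n) :: 'k) \<noteq> 0" by (simp del: of_nat_Suc)
  then show "fps_nth (fps_deriv (sol f x)) n = fps_nth (sol f (T x)) n"
    by (simp add: sol_def funpow_swap1 del: of_nat_Suc)
qed

lemma sol_add: "lin f \<Longrightarrow> sol f (x + y) = sol f x + sol f y"
  by (simp add: sol_def fps_eq_iff T_iter_add linD add_divide_distrib)

lemma sol_0: "lin f \<Longrightarrow> sol f 0 = 0"
  by (simp add: sol_def fps_eq_iff linD)

lemma sol_sum: "lin f \<Longrightarrow> sol f (\<Sum>i\<in>I. g i) = (\<Sum>i\<in>I. sol f (g i))"
  by (induction I rule: infinite_finite_induct) (simp_all add: sol_0 sol_add)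

lemma sol_sc:
  assumes "lin f"
  shows "sol f (sc c x) = g0 d c * sol f x"
proof (rule fps_ext)
  fix n
  show "fps_nth (sol f (sc c x)) n = fps_nth (g0 d c * sol f x) n"
  proof (induction n arbitrary: c x)
    case 0
    then show ?case by (simp add: sol_def g0_def linD[OF assms])
  next
    case (Suc n)
    have "of_nat (n + 1) * fps_nth (sol f (sc c x)) (n + 1) = fps_nth (fps_deriv (sol f (sc c x))) n"
      by (simp only: fps_deriv_nth)
    also have "\<dots> = fps_nth (sol f (sc c (T x))) n + fps_nth (sol f (sc (d c) x)) n"
      by (simp only: fps_deriv_sol T_sc sol_add[OF assms] fps_add_nth)
    also have "\<dots> = fps_nth (fps_deriv (g0 d c * sol f x)) n"
      by (simp add: Suc fps_deriv_g0 fps_deriv_sol)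
    also have "\<dots> = of_nat (n + 1) * fps_nth (g0 d c * sol f x) (n + 1)"
      by (simp only: fps_deriv_nth)
    finally show ?case
      by (simp del: of_nat_Suc)
  qed
qed

lemma fps_deriv_iter_sol: "(fps_deriv ^^ i) (sol f x) = sol f ((T ^^ i) x)"
  by (induction i) (simp_all add: fps_deriv_sol)

text \<open>The functional is the constant coefficient of s(x). Compatibility with \<open>T\<close>
  makes s(T x) the derivative of s(x), which recovers the other coefficients in characteristic
  0.\<close>

lemma KT_hom_iff: "KT_hom act (fps_act d) s \<longleftrightarrow> (\<exists>f. lin f \<and> s = sol f)"
proof
  assume s: "KT_hom act (fps_act d) s"
  define f where "f x = fps_nth (s x) 0" for x
  have add: "s (x + y) = s x + s y" for x y
    using s by (simp add: KT_hom_def)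
  have hom: "s (sc c x) = g0 d c * s x" for c x
    using s by (simp add: KT_hom_def scal_def fps_act_const)
  have sT: "s (T x) = fps_deriv (s x)" for x
    using s by (simp add: KT_hom_def T_op_def fps_act_T)
  have "lin f"
    by (simp add: lin_on_def f_def add hom g0_def)
  moreover have "fps_nth (s x) n = fps_nth (sol f x) n" for n x
  proof (induction n arbitrary: x)
    case 0
    then show ?case by (simp add: sol_def f_def)
  next
    case (Suc n)
    have "of_nat (n + 1) * fps_nth (s x) (n + 1) = fps_nth (fps_deriv (s x)) n"
      by (simp only: fps_deriv_nth)
    also have "\<dots> = fps_nth (fps_deriv (sol f x)) n"
      by (simp only: sT[symmetric] Suc fps_deriv_sol)
    also have "\<dots> = of_nat (n + 1) * fps_nth (sol f x) (n + 1)"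
      by (simp only: fps_deriv_nth)
    finally show ?case
      by (simp del: of_nat_Suc)
  qed
  then have "s = sol f" by (auto simp: fun_eq_iff fps_eq_iff)
  ultimately show "\<exists>f. lin f \<and> s = sol f" by blast
next
  assume "\<exists>f. lin f \<and> s = sol f"
  then obtain f where f: "lin f" "s = sol f" by blast
  then show "KT_hom act (fps_act d) s"
    by (simp add: KT_hom_def sol_add act_eq sol_sum sol_sc fps_act_def fps_deriv_iter_sol)
qed

section \<open>Radii of convergence as growth rates\<close>

lemma om_pos: "0 < omega v"
  by (rule omega_pos[OF p_pos])

lemma bdd_imp_growth:
  assumes "Abs_fps (\<lambda>i. a i / fact i) \<in> fps_bdd v s" "0 < s"
  shows "growth (omega v / s) a"
  unfolding growth_def
proof (intro allI impI)
  fix \<rho>' assume r: "omega v / s < \<rho>'"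
  \<comment> \<open>Chosen so that \<delta> \<omega> = \<rho>' s; the assumption on \<rho>' says
    exactly that \<delta> > 1.\<close>
  define \<delta> where "\<delta> = \<rho>' * s / omega v"
  have "1 < \<delta>" using r om_pos assms(2) by (simp add: \<delta>_def field_simps)
  then obtain C where C: "C > 0" "\<And>n. v (fact n) \<le> C * (\<delta> * omega v) ^ n"
    using v_fact_le_power[OF p_pos] by blast
  obtain B where B: "\<And>i. v (a i) / v (fact i) * s ^ i \<le> B"
    using assms(1) by (auto simp: fps_bdd_def bdd_above_def v_divide)
  have B0: "0 \<le> B" using B[of 0] v_nonneg[of "a 0"] by simp
  have "v (a i) \<le> B * C * \<rho>' ^ i" for i
  proof -
    have vf: "0 < v (fact i)" using v_nonneg[of "fact i"] v_eq_0_iff[of "fact i"] by simp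
    have "v (a i) * s ^ i \<le> B * v (fact i)" using B[of i] vf by (simp add: field_simps)
    also have "\<dots> \<le> B * (C * (\<delta> * omega v) ^ i)" using B0 C(2) by (intro mult_left_mono)
    also have "\<delta> * omega v = \<rho>' * s" using om_pos by (simp add: \<delta>_def)
    finally show ?thesis using assms(2) by (simp add: power_mult_distrib)
  qed
  then show "\<exists>C. \<forall>i. v (a i) \<le> C * \<rho>' ^ i" by blast
qed

lemma growth_imp_bdd:
  assumes "growth (omega v / r) a" "0 < s" "s < r"
  shows "Abs_fps (\<lambda>i. a i / fact i) \<in> fps_bdd v s"
proof -
  have "omega v / r < omega v / s" using assms om_pos by (simp add: field_simps)
  then obtain C where C: "0 \<le> C" "\<And>i. v (a i) \<le> C * (omega v / s) ^ i"
    using growthE[OF assms(1)] by metis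
  have "v (a i) / v (fact i) * s ^ i \<le> C" for i
  proof -
    have vf: "0 < v (fact i)" using v_nonneg[of "fact i"] v_eq_0_iff[of "fact i"] by simp
    have "v (a i) * s ^ i \<le> C * (omega v / s) ^ i * s ^ i"
      using C(2)[of i] assms(2) by (intro mult_right_mono) auto
    also have "\<dots> = C * omega v ^ i" using assms(2) by (simp add: power_divide)
    also have "\<dots> \<le> C * v (fact i)" using v_fact_ge[OF p_pos] C(1) by (intro mult_left_mono)
    finally show ?thesis using vf by (simp add: field_simps)
  qed
  then show ?thesis by (auto simp: fps_bdd_def v_divide intro!: bdd_aboveI[of _ C])
qed

lemma conv_iff_growth:
  assumes "0 < r"
  shows "Abs_fps (\<lambda>i. a i / fact i) \<in> fps_conv v r \<longleftrightarrow> growth (omega v / r) a"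
proof
  assume c: "Abs_fps (\<lambda>i. a i / fact i) \<in> fps_conv v r"
  show "growth (omega v / r) a"
    unfolding growth_def
  proof (intro allI impI)
    fix \<rho>' assume r: "omega v / r < \<rho>'"
    \<comment> \<open>Boundedness is known only on discs of radius below r; q leaves room for such a
      radius, namely \<omega>/q.\<close>
    obtain q where q: "omega v / r < q" "q < \<rho>'" using r dense by blast
    have "0 < omega v / r" using om_pos assms by simp
    then have q0: "0 < q" using q(1) by (rule less_trans)
    then have "0 < omega v / q" "omega v / q < r" using om_pos assms q by (auto simp: field_simps)
    then have "growth (omega v / (omega v / q)) a"
      using c by (intro bdd_imp_growth) (auto simp: fps_conv_def)
    then have "growth q a" using q0 om_pos by simp
    then show "\<exists>C. \<forall>i. v (a i) \<le> C * \<rho>' ^ i" using q by (auto simp: growth_def)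
  qed
next
  assume "growth (omega v / r) a"
  then show "Abs_fps (\<lambda>i. a i / fact i) \<in> fps_conv v r"
    using growth_imp_bdd by (auto simp: fps_conv_def)
qed

abbreviation "R \<equiv> radius v d"

lemma R_pos: "0 < R"
  using om_pos spd_pos[OF p_pos] by (simp add: radius_def)

lemma spd_le_iff: "0 < s \<Longrightarrow> spd \<le> omega v / s \<longleftrightarrow> s \<le> R"
  using spd_pos[OF p_pos] by (simp add: radius_def field_simps)

lemma F_ge_eq:
  assumes "0 < r"
  shows "F_ge v d act r = slow_part (omega v / r)"
proof -
  have "x \<in> F_ge v d act r \<longleftrightarrow> (\<forall>f. lin f \<longrightarrow> growth (omega v / r) (\<lambda>i. f ((T ^^ i) x)))" for x
    unfolding F_ge_def KT_hom_iff using conv_iff_growth[OF assms] by (auto simp: sol_def)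
  then show ?thesis
    by (auto simp: slow_part_def growth_mod_def linD(3))
qed

text \<open>A functional slow for some s > r gives solutions that converge beyond r. Conversely, the
  radius of an overconvergent solution depends on the vector at first, and finite dimension makes it
  uniform.\<close>

lemma F_le_eq:
  assumes "0 < r" "r < R"
  shows "F_le v d act r = (\<Inter>s\<in>{r<..R}. fast_part (omega v / s))"
proof (intro set_eqI iffI)
  fix x assume x: "x \<in> F_le v d act r"
  have "f x = 0" if s: "r < s" "s \<le> R" and f: "f \<in> good_functionals (omega v / s)" for s f
  proof -
    have "range (sol f) \<subseteq> fps_overconv v r"
    proof safe
      fix y
      have "growth (omega v / s) (\<lambda>i. f ((T ^^ i) y))" using f by (simp add: good_functionals_def)
      then have "sol f y \<in> fps_bdd v ((r + s) / 2)"
        unfolding sol_def using s assms by (intro growth_imp_bdd) auto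
      then show "sol f y \<in> fps_overconv v r"
        using s by (auto simp: fps_overconv_def intro!: bexI[of _ "(r + s) / 2"])
    qed
    then have "sol f x = 0"
      using x f assms KT_hom_iff by (auto simp: F_le_def good_functionals_def)
    then have "fps_nth (sol f x) 0 = 0" by simp
    then show ?thesis by (simp add: sol_def)
  qed
  then show "x \<in> (\<Inter>s\<in>{r<..R}. fast_part (omega v / s))" by (auto simp: fast_part_def)
next
  fix x assume x: "x \<in> (\<Inter>s\<in>{r<..R}. fast_part (omega v / s))"
  have "sol f x = 0" if f: "lin f" and oc: "range (sol f) \<subseteq> fps_overconv v r" for f
  proof -
    obtain B where B: "finite B" "span B = UNIV" using fin_dim by blast
    have "\<forall>b. \<exists>s>r. growth (omega v / s) (\<lambda>i. f ((T ^^ i) b))"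
    proof
      fix b
      have "sol f b \<in> fps_overconv v r" using oc by blast
      then obtain s where "s > r" "sol f b \<in> fps_bdd v s" by (auto simp: fps_overconv_def)
      then show "\<exists>s>r. growth (omega v / s) (\<lambda>i. f ((T ^^ i) b))"
        using bdd_imp_growth[of "\<lambda>i. f ((T ^^ i) b)" s] assms by (auto simp: sol_def)
    qed
    then obtain S where S: "\<And>b. S b > r" "\<And>b. growth (omega v / S b) (\<lambda>i. f ((T ^^ i) b))" by metis
    \<comment> \<open>A common radius for the generators; including \<open>R\<close> keeps it in the
      range where slow vectors form a submodule.\<close>
    define s where "s = Min (insert R (S ` B))"
    have s: "r < s" "s \<le> R" "\<And>b. b \<in> B \<Longrightarrow> s \<le> S b"
      using B(1) S(1) assms by (auto simp: s_def)
    define Y where "Y = {y. growth (omega v / s) (\<lambda>i. f ((T ^^ i) y))}"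
    have "omega v / S b \<le> omega v / s" if "b \<in> B" for b
      using s(3)[OF that] s(1) assms om_pos by (intro divide_left_mono) auto
    then have "B \<subseteq> Y" using growth_mono[OF S(2)] by (auto simp: Y_def)
    moreover have "tsub Y"
      unfolding Y_def using s assms by (intro growth_tsub f) (simp add: spd_le_iff)
    ultimately have "Y = UNIV" using B(2) span_minimal[of B Y] by (auto simp: tsub_def)
    then have fg: "f \<in> good_functionals (omega v / s)" using f by (auto simp: Y_def good_functionals_def)
    have "x \<in> fast_part (omega v / s)" using x s by auto
    then have "(T ^^ i) x \<in> fast_part (omega v / s)" for i
      using s assms by (intro tsub_iter fast_part_tsub) (simp_all add: spd_le_iff)
    then have "f ((T ^^ i) x) = 0" for i using fg by (auto simp: fast_part_def)
    then show ?thesis by (simp add: sol_def fps_eq_iff)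
  qed
  then show "x \<in> F_le v d act r" using assms by (auto simp: F_le_def KT_hom_iff)
qed

end

section \<open>Spectral norms of subquotients\<close>

context fd_module
begin

lemma coset_eq_iff:
  assumes "subspace L"
  shows "x +o L = y +o L \<longleftrightarrow> x - y \<in> L"
proof
  assume "x +o L = y +o L"
  moreover have "x \<in> x +o L"
    using subspace_0[OF assms] by (auto simp: elt_set_plus_def intro!: bexI[of _ 0])
  ultimately obtain l where "l \<in> L" "x = y + l" by (auto simp: elt_set_plus_def)
  then show "x - y \<in> L" by simp
next
  assume xy: "x - y \<in> L"
  have "z \<in> x +o L \<longleftrightarrow> z - x \<in> L" for x z
    by (auto simp: elt_set_plus_def intro!: bexI[of _ "z - x"])
  moreover have "z - x \<in> L \<longleftrightarrow> z - y \<in> L" for z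
    using subspace_add[OF assms xy, of "z - x"] subspace_diff[OF assms _ xy, of "z - y"]
    by (auto simp: algebra_simps)
  ultimately show "x +o L = y +o L" by blast
qed

lemma mem_coset: "subspace L \<Longrightarrow> x \<in> x +o L"
  using subspace_0 by (auto simp: elt_set_plus_def intro!: bexI[of _ 0])

lemma mem_cosetD: "(z::'m) \<in> x +o L \<Longrightarrow> z - x \<in> L"
  by (auto simp: elt_set_plus_def)

lemma quot_map_coset:
  assumes "tsub L"
  shows "quot_map L T (x +o L) = T x +o L"
proof -
  note s = tsub_subspace[OF assms]
  have "T y +o L = T x +o L" if "y \<in> x +o L" for y
    using mem_cosetD[OF that] assms by (simp add: coset_eq_iff[OF s] T_diff[symmetric] tsub_def)
  then show ?thesis
    unfolding quot_map_def using mem_coset[OF s, of x] by blast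
qed

lemma quot_map_iter_coset:
  assumes "tsub L"
  shows "(quot_map L T ^^ n) (x +o L) = (T ^^ n) x +o L"
  by (induction n) (simp_all add: quot_map_coset[OF assms])

text \<open>The maximum of the absolute values of coordinates modulo \<open>L\<close>. Existence
  ensures that the choice inside \<open>T_spectral_norm\<close> selects an actual norm.\<close>

lemma quot_norm_exists:
  assumes "subspace N" "subspace L" "L \<subseteq> N"
  shows "\<exists>\<nu>. quot_norm v act N L \<nu>"
proof -
  obtain B \<beta> where B: "finite B" "\<And>b. lin (\<beta> b)"
    "\<And>b z. b \<in> B \<Longrightarrow> z \<in> L \<Longrightarrow> \<beta> b z = 0" "\<And>x. x \<in> N \<Longrightarrow> x - (\<Sum>b\<in>B. sc (\<beta> b x) b) \<in> L"
    by (rule coordinates_mod[OF assms(2,1,3)]) blast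
  \<comment> \<open>The inserted 0 gives \<open>Max\<close> a value also when \<open>B\<close> is
    empty, that is, when N = L.\<close>
  define \<mu> where "\<mu> x = Max (insert 0 ((\<lambda>b. v (\<beta> b x)) ` B))" for x
  define \<nu> where "\<nu> X = \<mu> (SOME x. x \<in> X)" for X
  have \<mu>_le: "\<mu> x \<le> a \<longleftrightarrow> 0 \<le> a \<and> (\<forall>b\<in>B. v (\<beta> b x) \<le> a)" for x a
    using B(1) by (simp add: \<mu>_def)
  have \<mu>_ge: "0 \<le> \<mu> x" "b \<in> B \<Longrightarrow> v (\<beta> b x) \<le> \<mu> x" for x b
    using \<mu>_le[of x "\<mu> x"] by auto
  have \<nu>: "\<nu> (x +o L) = \<mu> x" for x
  proof -
    define y where "y = (SOME y. y \<in> x +o L)"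
    have "y \<in> x +o L" unfolding y_def using mem_coset[OF assms(2), of x] by (rule someI)
    then have "\<beta> b y = \<beta> b x" if "b \<in> B" for b
      using B(3)[OF that mem_cosetD] by (simp add: linD[OF B(2)])
    then have "\<mu> y = \<mu> x" by (simp add: \<mu>_def cong: image_cong)
    then show ?thesis by (simp add: \<nu>_def y_def)
  qed
  have "\<mu> x = 0 \<longleftrightarrow> x \<in> L" if "x \<in> N" for x
  proof
    assume "\<mu> x = 0"
    then have "\<beta> b x = 0" if "b \<in> B" for b
      using \<mu>_ge(2)[OF that, of x] v_nonneg[of "\<beta> b x"] v_eq_0_iff[of "\<beta> b x"] by simp
    then show "x \<in> L" using B(4)[OF that] by simp
  next
    assume "x \<in> L"
    then have "\<mu> x \<le> 0" using B(3) by (simp add: \<mu>_le)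
    then show "\<mu> x = 0" using \<mu>_ge(1)[of x] by simp
  qed
  moreover have "\<mu> (sc c x) = v c * \<mu> x" for c x
  proof (rule antisym)
    show "\<mu> (sc c x) \<le> v c * \<mu> x"
      using \<mu>_ge v_nonneg by (auto simp: \<mu>_le linD[OF B(2)] v_mult intro: mult_left_mono)
    show "v c * \<mu> x \<le> \<mu> (sc c x)"
    proof (cases "c = 0")
      case True
      then show ?thesis using \<mu>_ge(1)[of "sc c x"] by simp
    next
      case False
      then have vc: "0 < v c" using v_nonneg[of c] v_eq_0_iff[of c] by simp
      have "\<mu> x \<le> \<mu> (sc c x) / v c"
        using vc \<mu>_ge(1)[of "sc c x"] \<mu>_ge(2)[of _ "sc c x"]
        by (auto simp: \<mu>_le linD[OF B(2)] v_mult field_simps)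
      then show ?thesis using vc by (simp add: field_simps)
    qed
  qed
  moreover have "\<mu> (x + y) \<le> max (\<mu> x) (\<mu> y)" for x y
    unfolding \<mu>_le[of "x + y"]
  proof (intro conjI ballI)
    show "0 \<le> max (\<mu> x) (\<mu> y)" using \<mu>_ge(1)[of x] by simp
    fix b assume b: "b \<in> B"
    show "v (\<beta> b (x + y)) \<le> max (\<mu> x) (\<mu> y)"
      using v_ultra[of "\<beta> b x" "\<beta> b y"] \<mu>_ge(2)[OF b, of x] \<mu>_ge(2)[OF b, of y]
      by (simp add: linD[OF B(2)])
  qed
  ultimately have "quot_norm v act N L \<nu>"
    using \<mu>_ge(1) by (simp add: quot_norm_def \<nu>)
  then show ?thesis by blast
qed

text \<open>A converse of \<open>leibniz_bound\<close>: repeated use of d(c) y = T(c y) - c T(y)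
  expresses d^n(c) x through the terms T^i(c T^j x) with i + j = n.\<close>

lemma derivation_bound:
  assumes N: "tsub N" and x: "x \<in> N"
    and add: "\<And>x y. x \<in> N \<Longrightarrow> y \<in> N \<Longrightarrow> \<nu> (x - y) \<le> max (\<nu> x) (\<nu> y)"
    and sc: "\<And>c x. x \<in> N \<Longrightarrow> \<nu> (sc c x) = v c * \<nu> x"
    and B: "\<And>i j. i + j = n \<Longrightarrow> \<nu> ((T ^^ i) (sc c ((T ^^ j) x))) \<le> (B :: real)"
  shows "v ((d ^^ n) c) * \<nu> x \<le> B"
  using B
proof (induction n arbitrary: c)
  case 0
  then show ?case using 0[of 0 0] sc[OF x, of c] by simp
next
  case (Suc n)
  have "v ((d ^^ n) (d c)) * \<nu> x \<le> B"
  proof (rule Suc.IH)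
    fix i j assume ij: "i + j = n"
    have mem: "(T ^^ k) (sc c ((T ^^ l) x)) \<in> N" for k l
      using N x by (intro tsub_iter subspace_scale tsub_subspace)
    have eq: "(T ^^ i) (sc (d c) ((T ^^ j) x)) = (T ^^ Suc i) (sc c ((T ^^ j) x)) - (T ^^ i) (sc c ((T ^^ Suc j) x))"
      by (simp only: funpow_Suc_right o_def T_sc T_iter_add funpow.simps) (simp add: funpow_swap1)
    have "\<nu> ((T ^^ i) (sc (d c) ((T ^^ j) x))) \<le>
        max (\<nu> ((T ^^ Suc i) (sc c ((T ^^ j) x)))) (\<nu> ((T ^^ i) (sc c ((T ^^ Suc j) x))))"
      unfolding eq by (intro add mem)
    also have "\<dots> \<le> B" by (intro max.boundedI Suc.prems) (simp_all add: ij)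
    finally show "\<nu> ((T ^^ i) (sc (d c) ((T ^^ j) x))) \<le> B" .
  qed
  then show ?case by (simp add: funpow_swap1)
qed

context
  fixes N L :: "'m set"
  assumes N: "tsub N" and L: "tsub L" and LN: "L \<subset> N"
begin

text \<open>The norm that \<open>T_spectral_norm\<close> selects, read on representatives.\<close>

definition qn :: "'m \<Rightarrow> real" where
  "qn x = (SOME \<nu>. quot_norm v act N L \<nu>) (x +o L)"

lemma subspace_upper: "subspace N" and subspace_lower: "subspace L" and lower_subset_upper: "L \<subseteq> N"
  using N L LN by (auto simp: tsub_def)

lemma qn_norm_mod: "norm_mod N L qn"
proof -
  have "quot_norm v act N L (SOME \<nu>. quot_norm v act N L \<nu>)"
    using quot_norm_exists[OF subspace_upper subspace_lower lower_subset_upper] by (rule someI_ex)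
  then show ?thesis
    unfolding quot_norm_def norm_mod_def qn_def .
qed

lemmas qn_nonneg = nu_nonneg[OF subspace_upper subspace_lower lower_subset_upper qn_norm_mod]
  and qn_0_iff = nu_0_iff[OF subspace_upper subspace_lower lower_subset_upper qn_norm_mod]
  and qn_sc = nu_sc[OF subspace_upper subspace_lower lower_subset_upper qn_norm_mod]
  and qn_add = nu_add[OF subspace_upper subspace_lower lower_subset_upper qn_norm_mod]
  and qn_diff = nu_diff[OF subspace_upper subspace_lower lower_subset_upper qn_norm_mod]
  and qn_sum_le = nu_sum_le[OF subspace_upper subspace_lower lower_subset_upper qn_norm_mod]

lemma qn_functional:
  "lin f \<Longrightarrow> (\<And>z. z \<in> L \<Longrightarrow> f z = 0) \<Longrightarrow> \<exists>C\<ge>0. \<forall>x\<in>N. v (f x) \<le> C * qn x"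
  using functional_bounded[OF subspace_upper subspace_lower lower_subset_upper qn_norm_mod] by blast

lemma qn_cong_mod:
  assumes "x \<in> N" "x - y \<in> L"
  shows "qn x = qn y"
  using coset_eq_iff[OF subspace_lower, of x y] assms by (simp add: qn_def)

lemma basis_bounds:
  obtains B \<beta> D where "finite B" "B \<subseteq> N" "\<And>b. lin (\<beta> b)" "\<And>b z. b \<in> B \<Longrightarrow> z \<in> L \<Longrightarrow> \<beta> b z = 0"
    "\<And>x. x \<in> N \<Longrightarrow> x - (\<Sum>b\<in>B. sc (\<beta> b x) b) \<in> L"
    "0 \<le> D" "\<And>b x. b \<in> B \<Longrightarrow> x \<in> N \<Longrightarrow> v (\<beta> b x) \<le> D * qn x"
proof -
  obtain B \<beta> where B: "finite B" "B \<subseteq> N" "\<And>b. lin (\<beta> b)"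
    "\<And>b z. b \<in> B \<Longrightarrow> z \<in> L \<Longrightarrow> \<beta> b z = 0" "\<And>x. x \<in> N \<Longrightarrow> x - (\<Sum>b\<in>B. sc (\<beta> b x) b) \<in> L"
    by (rule coordinates_mod[OF subspace_lower subspace_upper lower_subset_upper]) blast
  have "\<forall>b\<in>B. \<exists>C\<ge>0. \<forall>x\<in>N. v (\<beta> b x) \<le> C * qn x"
    using qn_functional[OF B(3)] B(4) by blast
  then obtain E where E: "\<And>b. b \<in> B \<Longrightarrow> 0 \<le> E b" "\<And>b x. b \<in> B \<Longrightarrow> x \<in> N \<Longrightarrow> v (\<beta> b x) \<le> E b * qn x"
    by metis
  have "v (\<beta> b x) \<le> (\<Sum>b\<in>B. E b) * qn x" if "b \<in> B" "x \<in> N" for b x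
    using E that B(1) qn_nonneg by (intro order_trans[OF E(2)] mult_right_mono member_le_sum) auto
  moreover have "0 \<le> (\<Sum>b\<in>B. E b)" using E by (intro sum_nonneg)
  ultimately show ?thesis using that[of B \<beta>] B by blast
qed

text \<open>Bounds on the \<open>T\<close>-orbits of finitely many generators control T^n as an
  operator on N/L. Only the orbits up to n enter, so the case n = 1 yields the continuity of
  \<open>T\<close>.\<close>

lemma iterate_bound:
  assumes \<rho>: "spd < \<rho>"
    and K: "K \<ge> 1" "\<And>n x. v ((d ^^ n) x) \<le> K * \<rho> ^ n * v x"
    and B: "finite B" "B \<subseteq> N" "\<And>x. x \<in> N \<Longrightarrow> x - (\<Sum>b\<in>B. sc (\<beta> b x) b) \<in> L"
    and D: "0 \<le> D" "\<And>b x. b \<in> B \<Longrightarrow> x \<in> N \<Longrightarrow> v (\<beta> b x) \<le> D * qn x"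
    and E: "0 \<le> E" "\<And>b l. b \<in> B \<Longrightarrow> l \<le> n \<Longrightarrow> qn ((T ^^ l) b) \<le> E * \<rho> ^ l"
    and x: "x \<in> N"
  shows "qn ((T ^^ n) x) \<le> K * D * E * \<rho> ^ n * qn x"
proof -
  have \<rho>0: "0 < \<rho>" using \<rho> spd_nonneg by linarith
  define y where "y = (\<Sum>b\<in>B. (T ^^ n) (sc (\<beta> b x) b))"
  have mem: "(T ^^ k) (sc c b) \<in> N" if "b \<in> B" for k c b
    using that B(2) N by (intro tsub_iter subspace_scale subspace_upper) auto
  have "(T ^^ n) x - y \<in> L"
    using tsub_iter[OF L B(3)[OF x], of n] by (simp add: y_def T_iter_diff T_iter_sum)
  then have "qn ((T ^^ n) x) = qn y" by (intro qn_cong_mod tsub_iter N x)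
  also have "\<dots> \<le> K * D * E * \<rho> ^ n * qn x"
    unfolding y_def
  proof (rule qn_sum_le[OF B(1)])
    fix b assume b: "b \<in> B"
    then have bN: "b \<in> N" using B(2) by blast
    show "qn ((T ^^ n) (sc (\<beta> b x) b)) \<le> K * D * E * \<rho> ^ n * qn x"
    proof (rule leibniz_bound[OF N bN qn_add])
      fix k l assume n: "k + l = n"
      have "v ((d ^^ k) (\<beta> b x)) \<le> K * \<rho> ^ k * (D * qn x)"
        using K \<rho>0 by (intro order_trans[OF K(2)] mult_left_mono D b x) auto
      then have "v ((d ^^ k) (\<beta> b x)) * qn ((T ^^ l) b) \<le> (K * \<rho> ^ k * (D * qn x)) * (E * \<rho> ^ l)"
        using E(2)[OF b, of l] n K D \<rho>0 qn_nonneg[OF x] qn_nonneg[OF tsub_iter[OF N bN]]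
        by (intro mult_mono) auto
      also have "\<dots> = K * D * E * \<rho> ^ n * qn x" by (simp add: n[symmetric] power_add)
      finally show "v ((d ^^ k) (\<beta> b x)) * qn ((T ^^ l) b) \<le> K * D * E * \<rho> ^ n * qn x" .
    qed (auto simp: qn_sc)
  qed (use mem K D E \<rho>0 qn_nonneg[OF x] in auto)
  finally show ?thesis .
qed

lemma T_bounded: "\<exists>M. \<forall>x\<in>N. qn (T x) \<le> M * qn x"
proof -
  define \<rho> where "\<rho> = spd + 1"
  have \<rho>: "spd < \<rho>" "0 < \<rho>" using spd_nonneg by (auto simp: \<rho>_def)
  obtain K where K: "K \<ge> 1" "\<And>n x. v ((d ^^ n) x) \<le> K * \<rho> ^ n * v x"
    using d_iter_bound[OF \<rho>(1)] by blast
  obtain B \<beta> D where B: "finite B" "B \<subseteq> N" "\<And>x. x \<in> N \<Longrightarrow> x - (\<Sum>b\<in>B. sc (\<beta> b x) b) \<in> L"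
    and D: "0 \<le> D" "\<And>b x. b \<in> B \<Longrightarrow> x \<in> N \<Longrightarrow> v (\<beta> b x) \<le> D * qn x"
    by (rule basis_bounds) blast
  define E where "E = (\<Sum>b\<in>B. qn b + qn (T b) / \<rho>)"
  have nn: "0 \<le> qn b" "0 \<le> qn (T b) / \<rho>" if "b \<in> B" for b
    using that B(2) N \<rho>(2) qn_nonneg by (auto simp: tsub_def)
  have E0: "0 \<le> E" unfolding E_def using nn by (intro sum_nonneg add_nonneg_nonneg)
  have E: "qn b + qn (T b) / \<rho> \<le> E" if "b \<in> B" for b
    unfolding E_def using nn that B(1)
    by (intro member_le_sum[where f = "\<lambda>b. qn b + qn (T b) / \<rho>"] add_nonneg_nonneg) auto
  have "qn ((T ^^ 1) x) \<le> K * D * E * \<rho> ^ 1 * qn x" if "x \<in> N" for x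
  proof (rule iterate_bound[OF \<rho>(1) K B D E0 _ that])
    fix b l assume b: "b \<in> B" and "l \<le> (1::nat)"
    then consider "l = 0" | "l = 1" by linarith
    then show "qn ((T ^^ l) b) \<le> E * \<rho> ^ l"
    proof cases
      case 1
      then show ?thesis using E[OF b] nn[OF b] by simp
    next
      case 2
      have "qn (T b) / \<rho> \<le> E" using E[OF b] nn[OF b] by linarith
      then show ?thesis using 2 \<rho>(2) by (simp add: field_simps)
    qed
  qed
  then show ?thesis by auto
qed

lemma T_spectral_norm_nonneg: "0 \<le> T_spectral_norm v act N L"
  unfolding T_spectral_norm_def spectral_norm_def by (intro cINF_greatest) auto

lemma T_spectral_less:
  assumes "T_spectral_norm v act N L < \<rho>"
  shows "\<exists>K\<ge>1. \<forall>n. \<forall>x\<in>N. qn ((T ^^ n) x) \<le> K * \<rho> ^ n * qn x"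
proof -
  define \<nu> where "\<nu> = (SOME \<nu>. quot_norm v act N L \<nu>)"
  have \<nu>: "\<nu> (x +o L) = qn x" for x by (simp add: \<nu>_def qn_def)
  obtain M where M: "\<And>x. x \<in> N \<Longrightarrow> qn (T x) \<le> M * qn x" using T_bounded by blast
  obtain x0 where x0: "x0 \<in> N" "x0 \<notin> L" using LN by blast
  have "\<exists>K\<ge>1. \<forall>n. \<forall>X\<in>quot_space N L. \<nu> ((quot_map L T ^^ n) X) \<le> K * \<rho> ^ n * \<nu> X"
  proof (rule spectral_norm_less_imp_bound)
    show "x0 +o L \<in> quot_space N L" using x0 by (auto simp: quot_space_def)
    show "\<nu> (x0 +o L) \<noteq> 0" using x0 qn_0_iff[of x0] by (simp add: \<nu>)
    show "spectral_norm (quot_space N L) \<nu> (quot_map L T) < \<rho>"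
      using assms by (simp add: T_spectral_norm_def \<nu>_def)
    fix X assume "X \<in> quot_space N L"
    then obtain x where x: "x \<in> N" "X = x +o L" by (auto simp: quot_space_def)
    show "\<nu> (quot_map L T X) \<le> M * \<nu> X" using M x by (simp add: quot_map_coset[OF L] \<nu>)
    show "0 \<le> \<nu> X" using qn_nonneg x by (simp add: \<nu>)
    show "quot_map L T X \<in> quot_space N L"
      using x N by (auto simp: quot_map_coset[OF L] quot_space_def tsub_def)
  qed
  then show ?thesis
    by (auto simp: quot_space_def quot_map_iter_coset[OF L] \<nu>)
qed

lemma T_spectral_le:
  assumes "0 < \<rho>" "\<And>n x. x \<in> N \<Longrightarrow> qn ((T ^^ n) x) \<le> K * \<rho> ^ n * qn x"
  shows "T_spectral_norm v act N L \<le> \<rho>"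
proof -
  define \<nu> where "\<nu> = (SOME \<nu>. quot_norm v act N L \<nu>)"
  have \<nu>: "\<nu> (x +o L) = qn x" for x by (simp add: \<nu>_def qn_def)
  obtain x0 where x0: "x0 \<in> N" "x0 \<notin> L" using LN by blast
  show ?thesis
    unfolding T_spectral_norm_def \<nu>_def[symmetric]
  proof (rule spectral_norm_le)
    show "x0 +o L \<in> quot_space N L" using x0 by (auto simp: quot_space_def)
    show "\<nu> (x0 +o L) \<noteq> 0" using x0 qn_0_iff[of x0] by (simp add: \<nu>)
    fix X assume "X \<in> quot_space N L"
    then obtain x where x: "x \<in> N" "X = x +o L" by (auto simp: quot_space_def)
    show "\<nu> ((quot_map L T ^^ n) X) \<le> K * \<rho> ^ n * \<nu> X" for n
      using assms(2) x by (simp add: quot_map_iter_coset[OF L] \<nu>)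
    show "0 \<le> \<nu> X" using qn_nonneg x by (simp add: \<nu>)
    show "quot_map L T X \<in> quot_space N L"
      using x N by (auto simp: quot_map_coset[OF L] quot_space_def tsub_def)
  qed (rule assms)
qed

text \<open>If T^n is bounded by K \<rho>^n on N/L, then d^n is bounded by K^2 \<rho>^n, with one K
  for each of the two powers of \<open>T\<close> in T^i(c T^j x). This places all radii in (0,
  R].\<close>

lemma spd_le_T_spectral: "spd \<le> T_spectral_norm v act N L"
proof (rule dense_ge)
  fix \<rho> assume r: "T_spectral_norm v act N L < \<rho>"
  then have \<rho>0: "0 < \<rho>" using T_spectral_norm_nonneg by linarith
  obtain K where K: "K \<ge> 1" "\<And>n x. x \<in> N \<Longrightarrow> qn ((T ^^ n) x) \<le> K * \<rho> ^ n * qn x"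
    using T_spectral_less[OF r] by blast
  obtain x0 where x0: "x0 \<in> N" "x0 \<notin> L" using LN by blast
  have q0: "0 < qn x0" using qn_0_iff[OF x0(1)] qn_nonneg[OF x0(1)] x0(2) by simp
  have "v ((d ^^ n) c) \<le> (K * K) * \<rho> ^ n * v c" for n c
  proof -
    have "v ((d ^^ n) c) * qn x0 \<le> ((K * K) * \<rho> ^ n * v c) * qn x0"
    proof (rule derivation_bound[OF N x0(1) qn_diff qn_sc])
      fix i j assume n: "i + j = n"
      have jN: "(T ^^ j) x0 \<in> N" by (intro tsub_iter N x0)
      have "qn ((T ^^ i) (sc c ((T ^^ j) x0))) \<le> K * \<rho> ^ i * (v c * qn ((T ^^ j) x0))"
        using K(2)[OF subspace_scale[OF subspace_upper jN], of i c] by (simp add: qn_sc[OF jN])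
      also have "\<dots> \<le> K * \<rho> ^ i * (v c * (K * \<rho> ^ j * qn x0))"
        using K \<rho>0 v_nonneg x0 by (intro mult_left_mono) auto
      also have "\<dots> = ((K * K) * \<rho> ^ n * v c) * qn x0"
        by (simp add: n[symmetric] power_add)
      finally show "qn ((T ^^ i) (sc c ((T ^^ j) x0))) \<le> ((K * K) * \<rho> ^ n * v c) * qn x0" .
    qed auto
    then show ?thesis using q0 by simp
  qed
  then show "spd \<le> \<rho>"
    using \<rho>0 v_nonneg by (intro spectral_norm_le[of UNIV v d "K * K" \<rho> 1]) auto
qed

text \<open>The bridge from operator norms to functionals: one direction is the continuity of
  functionals, the other applies coordinate functionals to the orbits of finitely many
  generators.\<close>

lemma T_spectral_le_iff:
  assumes \<rho>: "spd \<le> \<rho>"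
  shows "T_spectral_norm v act N L \<le> \<rho> \<longleftrightarrow> (\<forall>x\<in>N. growth_mod \<rho> L x)"
proof
  assume le: "T_spectral_norm v act N L \<le> \<rho>"
  show "\<forall>x\<in>N. growth_mod \<rho> L x"
    unfolding growth_mod_def growth_def
  proof (intro ballI allI impI)
    fix x f \<rho>' assume x: "x \<in> N" and f: "lin f" "\<forall>z\<in>L. f z = 0" and r: "\<rho> < \<rho>'"
    obtain K where K: "K \<ge> 1" "\<And>n x. x \<in> N \<Longrightarrow> qn ((T ^^ n) x) \<le> K * \<rho>' ^ n * qn x"
      using T_spectral_less[of \<rho>'] le r by auto
    obtain D where D: "0 \<le> D" "\<And>x. x \<in> N \<Longrightarrow> v (f x) \<le> D * qn x"
      using qn_functional[OF f(1)] f(2) by blast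
    have "v (f ((T ^^ i) x)) \<le> (D * K * qn x) * \<rho>' ^ i" for i
    proof -
      have "v (f ((T ^^ i) x)) \<le> D * qn ((T ^^ i) x)" by (intro D tsub_iter N x)
      also have "\<dots> \<le> D * (K * \<rho>' ^ i * qn x)" by (intro mult_left_mono K D x)
      finally show ?thesis by (simp add: mult_ac)
    qed
    then show "\<exists>C. \<forall>i. v (f ((T ^^ i) x)) \<le> C * \<rho>' ^ i" by blast
  qed
next
  assume growth_mod: "\<forall>x\<in>N. growth_mod \<rho> L x"
  show "T_spectral_norm v act N L \<le> \<rho>"
  proof (rule dense_ge)
    fix \<rho>' assume r: "\<rho> < \<rho>'"
    then have \<rho>': "spd < \<rho>'" "0 < \<rho>'" using \<rho> spd_nonneg by auto
    obtain K where K: "K \<ge> 1" "\<And>n x. v ((d ^^ n) x) \<le> K * \<rho>' ^ n * v x"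
      using d_iter_bound[OF \<rho>'(1)] by blast
    obtain B \<beta> D where B: "finite B" "B \<subseteq> N" "\<And>b. lin (\<beta> b)" "\<And>b z. b \<in> B \<Longrightarrow> z \<in> L \<Longrightarrow> \<beta> b z = 0"
      "\<And>x. x \<in> N \<Longrightarrow> x - (\<Sum>b\<in>B. sc (\<beta> b x) b) \<in> L"
      and D: "0 \<le> D" "\<And>b x. b \<in> B \<Longrightarrow> x \<in> N \<Longrightarrow> v (\<beta> b x) \<le> D * qn x"
      by (rule basis_bounds) blast
    have "\<exists>A\<ge>0. \<forall>l. v (\<beta> c ((T ^^ l) b)) \<le> A * \<rho>' ^ l" if "b \<in> B" "c \<in> B" for b c
    proof -
      have "growth \<rho> (\<lambda>l. \<beta> c ((T ^^ l) b))"
        using growth_mod that B unfolding growth_mod_def by blast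
      then show ?thesis using growthE[OF _ r] by metis
    qed
    then obtain A where A: "\<And>b c. b \<in> B \<Longrightarrow> c \<in> B \<Longrightarrow> 0 \<le> A b c"
      "\<And>b c l. b \<in> B \<Longrightarrow> c \<in> B \<Longrightarrow> v (\<beta> c ((T ^^ l) b)) \<le> A b c * \<rho>' ^ l" by metis
    define E where "E = (\<Sum>b\<in>B. \<Sum>c\<in>B. A b c * qn c)"
    have qB: "0 \<le> qn c" if "c \<in> B" for c using that B(2) qn_nonneg by blast
    have E0: "0 \<le> E" unfolding E_def using A(1) qB by (intro sum_nonneg mult_nonneg_nonneg)
    have E: "A b c * qn c \<le> E" if "b \<in> B" "c \<in> B" for b c
    proof -
      have "A b c * qn c \<le> (\<Sum>c\<in>B. A b c * qn c)"
        using that A(1) qB B(1) by (intro member_le_sum[where f = "\<lambda>c. A b c * qn c"]) auto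
      also have "\<dots> \<le> E"
        unfolding E_def using that A(1) qB B(1)
        by (intro member_le_sum[where f = "\<lambda>b. \<Sum>c\<in>B. A b c * qn c"] sum_nonneg) auto
      finally show ?thesis .
    qed
    have "qn ((T ^^ l) b) \<le> E * \<rho>' ^ l" if b: "b \<in> B" for b l
    proof -
      have TbN: "(T ^^ l) b \<in> N" using b B(2) by (intro tsub_iter N) auto
      have "qn ((T ^^ l) b) = qn (\<Sum>c\<in>B. sc (\<beta> c ((T ^^ l) b)) c)"
        by (intro qn_cong_mod TbN B(5))
      also have "\<dots> \<le> E * \<rho>' ^ l"
      proof (rule qn_sum_le[OF B(1)])
        fix c assume c: "c \<in> B"
        show "sc (\<beta> c ((T ^^ l) b)) c \<in> N" using c B(2) by (intro subspace_scale subspace_upper) auto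
        have "qn (sc (\<beta> c ((T ^^ l) b)) c) = v (\<beta> c ((T ^^ l) b)) * qn c"
          using c B(2) by (intro qn_sc) auto
        also have "\<dots> \<le> A b c * \<rho>' ^ l * qn c"
          using A(2)[OF b c] qB[OF c] by (intro mult_right_mono)
        also have "\<dots> \<le> E * \<rho>' ^ l"
          using mult_right_mono[OF E[OF b c], of "\<rho>' ^ l"] \<rho>'(2) by (simp add: mult_ac)
        finally show "qn (sc (\<beta> c ((T ^^ l) b)) c) \<le> E * \<rho>' ^ l" .
      qed (use E0 \<rho>'(2) in auto)
      finally show ?thesis .
    qed
    then have "qn ((T ^^ n) x) \<le> K * D * E * \<rho>' ^ n * qn x" if "x \<in> N" for n x
      using iterate_bound[OF \<rho>'(1) K B(1,2,5) D E0 _ that, of n] by blast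
    then show "T_spectral_norm v act N L \<le> \<rho>'"
      by (rule T_spectral_le[OF \<rho>'(2)])
  qed
qed

end

end

section \<open>The decomposition\<close>

context fd_module
begin

definition rad :: "'m set \<Rightarrow> 'm set \<Rightarrow> real" where
  "rad N L = omega v / T_spectral_norm v act N L"

lemma irrD:
  assumes "irr N L"
  shows "tsub N" "tsub L" "L \<subset> N"
  using assms by (auto simp: irr_def)

lemma rad_le_R:
  assumes "irr N L"
  shows "0 < rad N L" "rad N L \<le> R"
proof -
  note spd_le = spd_le_T_spectral[OF irrD[OF assms]]
  have "0 < T_spectral_norm v act N L"
    using spd_le spd_pos[OF p_pos] by linarith
  then show "0 < rad N L" "rad N L \<le> R"
    using om_pos spd_le spd_pos[OF p_pos] by (auto simp: rad_def radius_def intro: divide_left_mono)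
qed

lemma rad_ge_iff:
  assumes "irr N L" "0 < s" "s \<le> R"
  shows "s \<le> rad N L \<longleftrightarrow> (\<forall>x\<in>N. growth_mod (omega v / s) L x)"
proof -
  have "0 < T_spectral_norm v act N L"
    using spd_le_T_spectral[OF irrD[OF assms(1)]] spd_pos[OF p_pos] by linarith
  then have "s \<le> rad N L \<longleftrightarrow> T_spectral_norm v act N L \<le> omega v / s"
    using assms(2) by (simp add: rad_def field_simps)
  also have "\<dots> \<longleftrightarrow> (\<forall>x\<in>N. growth_mod (omega v / s) L x)"
    using assms by (intro T_spectral_le_iff irrD[OF assms(1)]) (simp add: spd_le_iff)
  finally show ?thesis .
qed

lemma composition_series_exists:
  assumes "tsub N"
  shows "\<exists>Ns. composition_series act N Ns"
  using assms
proof (induction "dim N" arbitrary: N rule: less_induct)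
  case less
  show ?case
  proof (cases "N = {0}")
    case True
    then show ?thesis by (intro exI[of _ "[{0}]"]) (simp add: composition_series_def)
  next
    case False
    then obtain Z where irr: "irr N Z" using maximal_tsub less.prems by blast
    have "dim Z < dim N"
      using irrD[OF irr] by (intro dim_strict_mono) (auto simp: tsub_def)
    then obtain Zs where Zs: "composition_series act Z Zs"
      using less.hyps irrD[OF irr] by blast
    have "irreducible_quot act ((Zs @ [N]) ! Suc i) ((Zs @ [N]) ! i)" if "Suc i < length (Zs @ [N])" for i
    proof (cases "Suc i < length Zs")
      case True
      then show ?thesis using Zs by (simp add: composition_series_def nth_append)
    next
      case False
      then have "i = length Zs - 1" "Suc i = length Zs" using that by auto
      moreover have "Zs ! (length Zs - 1) = Z"
        using Zs last_conv_nth[of Zs] by (simp add: composition_series_def)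
      ultimately show ?thesis
        using irr Zs by (simp add: composition_series_def nth_append irreducible_quot_iff)
    qed
    then have "composition_series act N (Zs @ [N])"
      using Zs by (auto simp: composition_series_def)
    then show ?thesis by blast
  qed
qed

lemma composition_seriesD:
  assumes "composition_series act N Ns"
  shows "Suc i < length Ns \<Longrightarrow> irr (Ns ! Suc i) (Ns ! i)" "Ns ! 0 = {0}" "Ns ! (length Ns - 1) = N" "Ns \<noteq> []"
  using assms by (auto simp: composition_series_def irreducible_quot_iff hd_conv_nth last_conv_nth)

lemma composition_series_subset:
  assumes Ns: "composition_series act N Ns" and "i < length Ns"
  shows "Ns ! i \<subseteq> N"
proof -
  have "Ns ! i \<subseteq> Ns ! j" if "i \<le> j" "j < length Ns" for j
    using that
  proof (induction j rule: dec_induct)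
    case (step j)
    then have "Ns ! i \<subseteq> Ns ! j" by simp
    also have "\<dots> \<subseteq> Ns ! Suc j" using composition_seriesD(1)[OF Ns, of j] step irrD(3) by blast
    finally show ?case .
  qed simp
  from this[of "length Ns - 1"] show ?thesis
    using assms composition_seriesD(3)[OF Ns] by auto
qed

text \<open>The series obtained is the one that \<open>spectral_mult\<close> selects. Its factors
  have positive dimension, so the support consists exactly of their radii.\<close>

lemma spectral_mult_subset_iff:
  assumes "tsub N"
  obtains Ns where "composition_series act N Ns"
    "{r'. spectral_mult v act N r' \<noteq> 0} \<subseteq> {r} \<longleftrightarrow> (\<forall>i. Suc i < length Ns \<longrightarrow> rad (Ns ! Suc i) (Ns ! i) = r)"
proof -
  define Ns where "Ns = (SOME Ns. composition_series act N Ns)"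
  have Ns: "composition_series act N Ns"
    unfolding Ns_def using composition_series_exists[OF assms] by (rule someI_ex)
  have "mult_irr v act (Ns ! Suc i) (Ns ! i) r' \<noteq> 0 \<longleftrightarrow> r' = rad (Ns ! Suc i) (Ns ! i)"
    if "Suc i < length Ns" for i r'
  proof -
    note irr = irrD[OF composition_seriesD(1)[OF Ns that]]
    have "dim (Ns ! i) < dim (Ns ! Suc i)"
      using irr by (intro dim_strict_mono) (auto simp: tsub_def)
    then show ?thesis by (simp add: mult_irr_def quot_dim_def rad_def)
  qed
  then have "spectral_mult v act N r' \<noteq> 0 \<longleftrightarrow> (\<exists>i. Suc i < length Ns \<and> r' = rad (Ns ! Suc i) (Ns ! i))" for r'
    unfolding spectral_mult_def Let_def Ns_def[symmetric] by (auto simp: less_diff_conv)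
  then have "{r'. spectral_mult v act N r' \<noteq> 0} \<subseteq> {r} \<longleftrightarrow> (\<forall>i. Suc i < length Ns \<longrightarrow> rad (Ns ! Suc i) (Ns ! i) = r)"
    by blast
  then show ?thesis using that Ns by blast
qed

section \<open>The filtrations indexed by the radius and their comparison with the spectral
  one\<close>

abbreviation "Cr r \<equiv> slow_part (omega v / r)"
abbreviation "Wr r \<equiv> fast_part (omega v / r)"
abbreviation "Fr r \<equiv> F_eq v d act r"

lemma Cr_tsub: "0 < r \<Longrightarrow> r \<le> R \<Longrightarrow> tsub (Cr r)"
  by (intro slow_part_tsub) (simp add: spd_le_iff)

lemma Wr_tsub: "0 < r \<Longrightarrow> r \<le> R \<Longrightarrow> tsub (Wr r)"
  by (intro fast_part_tsub) (simp add: spd_le_iff)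

lemma Cr_antimono: "0 < r \<Longrightarrow> r \<le> s \<Longrightarrow> Cr s \<subseteq> Cr r"
  using om_pos by (intro slow_part_mono divide_left_mono) auto

lemma Wr_mono: "0 < r \<Longrightarrow> r \<le> s \<Longrightarrow> Wr r \<subseteq> Wr s"
  using om_pos by (intro fast_part_antimono divide_left_mono) auto

lemma F_le_subset_Wr:
  assumes "0 < r" "r < s" "s \<le> R"
  shows "F_le v d act r \<subseteq> Wr s"
  using assms F_le_eq[of r] by auto

lemma Fr_tsub:
  assumes "0 < r" "r \<le> R"
  shows "tsub (Fr r)"
proof -
  have "tsub (F_le v d act r)"
  proof (cases "r < R")
    case True
    have "tsub (Wr s)" if "s \<in> {r<..R}" for s using assms that by (intro Wr_tsub) auto
    then show ?thesis
      unfolding F_le_eq[OF assms(1) True] by (auto simp: tsub_def subspace_def)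
  next
    case False
    then show ?thesis by (simp add: F_le_def tsub_UNIV)
  qed
  then show ?thesis
    using Cr_tsub[OF assms] unfolding F_eq_def F_ge_eq[OF assms(1)]
    by (auto simp: tsub_def subspace_inter)
qed

text \<open>f on \<open>A\<close> and 0 on \<open>W'\<close> agree on the intersection, so they glue
  on the sum of the two spaces; \<open>rep\<close> chooses a component in \<open>A\<close>.\<close>

lemma extend_functional_killing:
  assumes A: "subspace A" and W: "subspace W'" and f: "lin f" "\<And>x. x \<in> A \<Longrightarrow> x \<in> W' \<Longrightarrow> f x = 0"
  obtains g where "lin g" "\<And>x. x \<in> A \<Longrightarrow> g x = f x" "\<And>x. x \<in> W' \<Longrightarrow> g x = 0"
proof -
  define S where "S = {y. \<exists>a\<in>A. y - a \<in> W'}"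
  define rep where "rep y = (SOME a. a \<in> A \<and> y - a \<in> W')" for y
  have rep: "rep y \<in> A" "y - rep y \<in> W'" if "y \<in> S" for y
    using that someI_ex[of "\<lambda>a. a \<in> A \<and> y - a \<in> W'"] by (auto simp: S_def rep_def)
  have f_rep: "f (rep y) = f a" if "a \<in> A" "y - a \<in> W'" for y a
  proof -
    have y: "y \<in> S" using that by (auto simp: S_def)
    have "rep y - a = (y - a) - (y - rep y)" by simp
    also have "\<dots> \<in> W'" by (rule subspace_diff[OF W that(2) rep(2)[OF y]])
    finally have "f (rep y - a) = 0"
      using f(2) subspace_diff[OF A rep(1)[OF y] that(1)] by blast
    then show ?thesis by (simp add: linD[OF f(1)])
  qed
  have S: "subspace S"
    unfolding subspace_def
  proof (intro conjI allI ballI)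
    show "0 \<in> S" using A W by (auto simp: S_def subspace_0 intro!: bexI[of _ 0])
  next
    fix x y assume "x \<in> S" "y \<in> S"
    then obtain a b where "a \<in> A" "x - a \<in> W'" "b \<in> A" "y - b \<in> W'" by (auto simp: S_def)
    then have "a + b \<in> A" "(x - a) + (y - b) \<in> W'"
      using subspace_add[OF A] subspace_add[OF W] by auto
    moreover have "(x - a) + (y - b) = x + y - (a + b)" by (simp add: algebra_simps)
    ultimately show "x + y \<in> S" unfolding S_def by auto
  next
    fix c x assume "x \<in> S"
    then obtain a where "a \<in> A" "x - a \<in> W'" by (auto simp: S_def)
    then have "sc c a \<in> A" "sc c x - sc c a \<in> W'"
      using A W by (auto simp: scale_right_diff_distrib[symmetric] intro: subspace_scale)
    then show "sc c x \<in> S" by (auto simp: S_def)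
  qed
  have "lin_on S (\<lambda>y. f (rep y))"
    unfolding lin_on_def
  proof (intro conjI allI ballI)
    fix x y assume xy: "x \<in> S" "y \<in> S"
    have "f (rep (x + y)) = f (rep x + rep y)"
    proof (rule f_rep)
      show "rep x + rep y \<in> A" using rep xy A by (intro subspace_add) auto
      have "(x - rep x) + (y - rep y) \<in> W'" using rep xy W by (intro subspace_add) auto
      then show "x + y - (rep x + rep y) \<in> W'" by (simp add: algebra_simps)
    qed
    then show "f (rep (x + y)) = f (rep x) + f (rep y)" by (simp add: linD[OF f(1)])
  next
    fix c x assume x: "x \<in> S"
    have "f (rep (sc c x)) = f (sc c (rep x))"
    proof (rule f_rep)
      show "sc c (rep x) \<in> A" using rep[OF x] A by (intro subspace_scale)
      show "sc c x - sc c (rep x) \<in> W'"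
        using rep[OF x] W by (simp add: scale_right_diff_distrib[symmetric] subspace_scale)
    qed
    then show "f (rep (sc c x)) = c * f (rep x)" by (simp add: linD[OF f(1)])
  qed
  then obtain g where g: "lin g" "\<And>x. x \<in> S \<Longrightarrow> g x = f (rep x)"
    using lin_on_extend[OF S] by blast
  show ?thesis
  proof (rule that[OF g(1)])
    fix x
    show "g x = f x" if "x \<in> A"
    proof -
      have "x - x \<in> W'" using W by (simp add: subspace_0)
      moreover from this that have "x \<in> S" unfolding S_def by blast
      ultimately show ?thesis using that g(2)[of x] f_rep[of x x] by simp
    qed
    show "g x = 0" if "x \<in> W'"
    proof -
      have "0 \<in> A" "x - 0 \<in> W'" using A that by (auto simp: subspace_0)
      moreover from this have "x \<in> S" unfolding S_def by blast
      ultimately show ?thesis using g(2)[of x] f_rep[of 0 x] linD(3)[OF f(1)] by simp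
    qed
  qed
qed

text \<open>Slowness climbs the series by \<open>growth_mod_extension\<close>. If for some s > r the
  series left \<open>Wr s\<close> at a factor A/L, this factor would embed into the quotient of
  \<open>M\<close> by \<open>Wr s\<close>, where all growth is at most \<omega>/s, and its radius
  would be at least s.\<close>

lemma subset_Fr_if_rad_eq:
  assumes r: "0 < r" "r \<le> R" and Ns: "composition_series act N Ns"
    and rad: "\<And>i. Suc i < length Ns \<Longrightarrow> rad (Ns ! Suc i) (Ns ! i) = r"
  shows "N \<subseteq> Fr r"
proof -
  note irr = composition_seriesD(1)[OF Ns]
  have last: "Ns ! (length Ns - 1) = N" "length Ns - 1 < length Ns"
    using composition_seriesD(3,4)[OF Ns] by auto
  have "Ns ! i \<subseteq> Cr r" if "i < length Ns" for i
    using that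
  proof (induction i)
    case 0
    then show ?case
      using composition_seriesD(2)[OF Ns] Cr_tsub[OF r] by (auto simp: tsub_def subspace_0)
  next
    case (Suc i)
    show ?case
    proof
      fix x assume x: "x \<in> Ns ! Suc i"
      note ir = irrD[OF irr[OF Suc.prems]]
      have "growth_mod (omega v / r) (Ns ! i) x"
        using rad_ge_iff[OF irr[OF Suc.prems] r] rad[OF Suc.prems] x by simp
      moreover have "growth_mod (omega v / r) {0} y" if "y \<in> Ns ! i" for y
        using Suc that by (auto simp: slow_part_def)
      moreover have "{0} \<subseteq> Ns ! i" using ir(2) by (auto simp: tsub_def subspace_0)
      ultimately have "growth_mod (omega v / r) {0} x"
        using growth_mod_extension[OF ir(2) tsub_0] r by (simp add: spd_le_iff)
      then show "x \<in> Cr r" by (simp add: slow_part_def)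
    qed
  qed
  from this[OF last(2)] have "N \<subseteq> F_ge v d act r" using last by (simp add: F_ge_eq[OF r(1)])
  moreover have "N \<subseteq> F_le v d act r"
  proof (cases "r < R")
    case True
    have "N \<subseteq> Wr s" if s: "r < s" "s \<le> R" for s
    proof -
      have s0: "0 < s" using s r by simp
      have spds: "spd \<le> omega v / s" using s s0 by (simp add: spd_le_iff)
      note Ws = Wr_tsub[OF s0 s(2)]
      have "Ns ! i \<subseteq> Wr s" if "i < length Ns" for i
        using that
      proof (induction i)
        case 0
        then show ?case
          using composition_seriesD(2)[OF Ns] Ws by (auto simp: tsub_def subspace_0)
      next
        case (Suc i)
        define A L where "A = Ns ! Suc i" and "L = Ns ! i"
        have irrA: "irr A L" using irr[OF Suc.prems] by (simp add: A_def L_def)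
        note ir = irrD[OF irrA]
        have LW: "L \<subseteq> Wr s" using Suc by (simp add: L_def)
        show ?case
        proof (rule ccontr)
          assume "\<not> Ns ! Suc i \<subseteq> Wr s"
          then have nA: "A \<inter> Wr s \<noteq> A" by (auto simp: A_def)
          have "tsub (A \<inter> Wr s)" using ir Ws by (auto simp: tsub_def subspace_inter)
          then have AW: "A \<inter> Wr s = L"
            using irrA nA LW ir(3) unfolding irr_def by blast
          have "growth_mod (omega v / s) L x" if x: "x \<in> A" for x
            unfolding growth_mod_def
          proof (intro allI impI)
            fix f assume f: "lin f" "\<forall>z\<in>L. f z = 0"
            obtain g where g: "lin g" "\<And>x. x \<in> A \<Longrightarrow> g x = f x" "\<And>x. x \<in> Wr s \<Longrightarrow> g x = 0"
              using extend_functional_killing[OF tsub_subspace[OF ir(1)] tsub_subspace[OF Ws] f(1)] f(2) AW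
              by blast
            have "growth (omega v / s) (\<lambda>i. g ((T ^^ i) x))"
              using growth_mod_fast_part[OF spds, of x] g by (auto simp: growth_mod_def)
            moreover have "g ((T ^^ i) x) = f ((T ^^ i) x)" for i
              by (intro g(2) tsub_iter ir(1) x)
            ultimately show "growth (omega v / s) (\<lambda>i. f ((T ^^ i) x))" by simp
          qed
          then have "s \<le> rad A L" using rad_ge_iff[OF irrA s0 s(2)] by blast
          then show False using rad[OF Suc.prems] s by (simp add: A_def L_def)
        qed
      qed
      from this[OF last(2)] show ?thesis using last by simp
    qed
    then show ?thesis unfolding F_le_eq[OF r(1) True] by (auto simp: subset_iff)
  next
    case False
    then show ?thesis by (simp add: F_le_def)
  qed
  ultimately show ?thesis by (simp add: F_eq_def)
qed

text \<open>If the radius s of A/L exceeded r, a nonzero functional on A/L would extend to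
  \<open>M\<close> with growth at most \<omega>/s; but \<open>A\<close> lies in \<open>Wr s\<close>,
  the common kernel of such functionals.\<close>

lemma rad_eq_if_subset_Fr:
  assumes r: "0 < r" "r \<le> R" and irr: "irr A L" and A: "A \<subseteq> Fr r"
  shows "rad A L = r"
proof (rule antisym)
  note ir = irrD[OF irr]
  have "growth_mod (omega v / r) L x" if "x \<in> A" for x
  proof -
    have "growth_mod (omega v / r) {0} x" using that A by (auto simp: F_eq_def F_ge_eq[OF r(1)] slow_part_def)
    moreover have "{0} \<subseteq> L" using ir(2) by (auto simp: tsub_def subspace_0)
    ultimately show ?thesis by (rule growth_mod_mono) simp
  qed
  then show "r \<le> rad A L" using rad_ge_iff[OF irr r] by blast
  show "rad A L \<le> r"
  proof (rule ccontr)
    assume "\<not> rad A L \<le> r"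
    define s where "s = rad A L"
    have s: "r < s" "0 < s" "s \<le> R" using \<open>\<not> rad A L \<le> r\<close> rad_le_R[OF irr] by (auto simp: s_def)
    have spds: "spd \<le> omega v / s" using s by (simp add: spd_le_iff)
    have cvs: "\<forall>x\<in>A. growth_mod (omega v / s) L x" using rad_ge_iff[OF irr s(2,3)] by (simp add: s_def)
    obtain a where a: "a \<in> A" "a \<notin> L" using ir(3) by blast
    obtain f where f: "lin f" "\<And>y. y \<in> L \<Longrightarrow> f y = 0" "f a = 1"
      using separating_functional[OF tsub_subspace[OF ir(2)] a(2)] by blast
    have "growth (omega v / s) (\<lambda>i. f ((T ^^ i) x))" if "x \<in> A" for x
      using cvs that f by (auto simp: growth_mod_def)
    then obtain h where h: "lin h" "\<And>x. x \<in> A \<Longrightarrow> h x = f x" "\<And>x. growth (omega v / s) (\<lambda>i. h ((T ^^ i) x))"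
      using extend_functional[OF ir(1) spds f(1)] by blast
    have "a \<in> Wr s" using a A F_le_subset_Wr[OF r(1) s(1,3)] by (auto simp: F_eq_def)
    then have "h a = 0" using h by (auto simp: fast_part_def good_functionals_def)
    then show False using h(2)[OF a(1)] f(3) by simp
  qed
qed

text \<open>\<open>Fr r\<close> is admissible by \<open>rad_eq_if_subset_Fr\<close> along its own
  composition series, and contains every admissible submodule by
  \<open>subset_Fr_if_rad_eq\<close>.\<close>

lemma F_sp_eq:
  assumes r: "0 < r" "r \<le> R"
  shows "F_sp v act r = Fr r"
  unfolding F_sp_def
proof (rule Greatest_equality)
  obtain Ns where Ns: "composition_series act (Fr r) Ns"
    "{r'. spectral_mult v act (Fr r) r' \<noteq> 0} \<subseteq> {r} \<longleftrightarrow> (\<forall>i. Suc i < length Ns \<longrightarrow> rad (Ns ! Suc i) (Ns ! i) = r)"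
    using spectral_mult_subset_iff[OF Fr_tsub[OF r]] by blast
  have "rad (Ns ! Suc i) (Ns ! i) = r" if "Suc i < length Ns" for i
    using rad_eq_if_subset_Fr[OF r composition_seriesD(1)[OF Ns(1) that]]
      composition_series_subset[OF Ns(1) that] by blast
  then show "KT_submodule act (Fr r) \<and> {r'. spectral_mult v act (Fr r) r' \<noteq> 0} \<subseteq> {r}"
    using Ns(2) Fr_tsub[OF r] by (simp add: KT_submodule_iff)
next
  fix N assume N: "KT_submodule act N \<and> {r'. spectral_mult v act N r' \<noteq> 0} \<subseteq> {r}"
  then have "tsub N" by (simp add: KT_submodule_iff)
  then obtain Ns where Ns: "composition_series act N Ns"
    "{r'. spectral_mult v act N r' \<noteq> 0} \<subseteq> {r} \<longleftrightarrow> (\<forall>i. Suc i < length Ns \<longrightarrow> rad (Ns ! Suc i) (Ns ! i) = r)"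
    by (rule spectral_mult_subset_iff)
  then show "N \<subseteq> Fr r"
    using subset_Fr_if_rad_eq[OF r Ns(1)] N by blast
qed

text \<open>Left continuity of the filtration: convergence on the open disc of radius r is a
  condition on all smaller radii.\<close>

lemma Cr_sup:
  assumes "0 < r" "\<And>t. 0 < t \<Longrightarrow> t < r \<Longrightarrow> x \<in> Cr t"
  shows "x \<in> Cr r"
proof -
  have "s x \<in> fps_bdd v u" if s: "KT_hom act (fps_act d) s" and u: "0 < u" "u < r" for s u
  proof -
    have "x \<in> Cr ((u + r) / 2)" using u by (intro assms(2)) auto
    then have "x \<in> F_ge v d act ((u + r) / 2)" using u by (subst F_ge_eq) auto
    then have "s x \<in> fps_conv v ((u + r) / 2)" using s by (simp add: F_ge_def)
    then show ?thesis using u by (auto simp: fps_conv_def)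
  qed
  then have "x \<in> F_ge v d act r" by (auto simp: F_ge_def fps_conv_def)
  then show ?thesis by (simp add: F_ge_eq[OF assms(1)])
qed

text \<open>Growth on \<open>M\<close> is at most the spectral norm of \<open>T\<close>; the maximum
  with \<open>spd\<close> keeps the radius admissible. The zero module is separate since the
  spectral norm is only controlled on nonzero quotients.\<close>

lemma Cr_UNIV: "\<exists>r. 0 < r \<and> r \<le> R \<and> Cr r = UNIV"
proof (cases "(UNIV :: 'm set) = {0}")
  case True
  have "0 \<in> Cr R" using Cr_tsub[OF R_pos order_refl] by (auto simp: tsub_def subspace_0)
  then show ?thesis using True R_pos by (intro exI[of _ R]) (metis UNIV_eq_I order_refl singletonD UNIV_I)
next
  case False
  define \<rho> where "\<rho> = max spd (T_spectral_norm v act UNIV {0})"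
  have \<rho>: "0 < \<rho>" "spd \<le> \<rho>" using spd_pos[OF p_pos] by (auto simp: \<rho>_def)
  have "{0} \<subset> (UNIV :: 'm set)" using False by blast
  then have "\<forall>x. growth_mod \<rho> {0} x"
    using T_spectral_le_iff[OF tsub_UNIV tsub_0 _ \<rho>(2)] by (simp add: \<rho>_def)
  then have "Cr (omega v / \<rho>) = UNIV" using \<rho> om_pos by (auto simp: slow_part_def)
  moreover have "0 < omega v / \<rho>" "omega v / \<rho> \<le> R"
    using \<rho> om_pos spd_pos[OF p_pos] by (auto simp: radius_def intro: divide_left_mono)
  ultimately show ?thesis by blast
qed

section \<open>The direct sum decomposition\<close>

lemma direct_sum_map_eq:
  assumes "finite S" "{i. f i \<noteq> 0} \<subseteq> S"
  shows "direct_sum_map f = (\<Sum>i\<in>S. f i)"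
  unfolding direct_sum_map_def using assms by (intro sum.mono_neutral_left) auto

abbreviation "I \<equiv> {0<..R}"
abbreviation "DS \<equiv> direct_sum I Fr"

lemma direct_sum_map_add:
  assumes "finite {i. f i \<noteq> 0}" "finite {i. g i \<noteq> (0::'m)}"
  shows "direct_sum_map (\<lambda>i. f i + g i) = direct_sum_map f + direct_sum_map g"
proof -
  define S where "S = {i. f i \<noteq> 0} \<union> {i. g i \<noteq> 0}"
  have S: "finite S" using assms by (simp add: S_def)
  have "direct_sum_map (\<lambda>i. f i + g i) = (\<Sum>i\<in>S. f i + g i)"
    by (rule direct_sum_map_eq[OF S]) (auto simp: S_def)
  moreover have "direct_sum_map f = (\<Sum>i\<in>S. f i)"
    by (rule direct_sum_map_eq[OF S]) (auto simp: S_def)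
  moreover have "direct_sum_map g = (\<Sum>i\<in>S. g i)"
    by (rule direct_sum_map_eq[OF S]) (auto simp: S_def)
  ultimately show ?thesis by (simp add: sum.distrib)
qed

lemma direct_sum_add:
  assumes "f \<in> DS" "g \<in> DS"
  shows "(\<lambda>i. f i + g i) \<in> DS"
proof -
  have "finite {i. f i + g i \<noteq> 0}"
  proof (rule finite_subset)
    show "{i. f i + g i \<noteq> 0} \<subseteq> {i. f i \<noteq> 0} \<union> {i. g i \<noteq> 0}" by auto
    show "finite ({i. f i \<noteq> 0} \<union> {i. g i \<noteq> 0})" using assms by (simp add: direct_sum_def)
  qed
  moreover have "f i + g i \<in> Fr i" if "i \<in> I" for i
    using that assms Fr_tsub[of i] by (auto simp: direct_sum_def tsub_def subspace_add)
  ultimately show ?thesis using assms by (simp add: direct_sum_def)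
qed

text \<open>Induction over the jumps of r -> \<open>Cr r\<close>. The plateau containing r ends at q
  and includes q by left continuity; a radius s just beyond q splits x into a component in
  \<open>Fr q\<close> and one in the smaller space \<open>Cr s\<close>.\<close>

lemma Cr_in_sum:
  assumes "0 < r" "r \<le> R" "x \<in> Cr r"
  shows "\<exists>g\<in>DS. x = direct_sum_map g"
  using assms
proof (induction "dim (Cr r)" arbitrary: r x rule: less_induct)
  case less
  note r = less.prems(1,2)
  define S where "S = {t. 0 < t \<and> t \<le> R \<and> Cr t = Cr r}"
  define q where "q = Sup S"
  have rS: "r \<in> S" using r by (simp add: S_def)
  have bdd: "bdd_above S" by (auto simp: S_def intro: bdd_aboveI[of _ R])
  have q: "r \<le> q" "q \<le> R" "0 < q"
  proof -
    show "r \<le> q" unfolding q_def by (rule cSup_upper[OF rS bdd])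
    then show "0 < q" using r by simp
    show "q \<le> R" unfolding q_def using rS by (intro cSup_least) (auto simp: S_def)
  qed
  have "x \<in> Cr q"
  proof (rule Cr_sup[OF q(3)])
    fix t assume t: "0 < t" "t < q"
    then obtain t' where "t' \<in> S" "t < t'"
      unfolding q_def using less_cSup_iff[of S t] rS bdd by auto
    then show "x \<in> Cr t"
      using Cr_antimono[OF t(1), of t'] less.prems(3) by (auto simp: S_def)
  qed
  have single: "\<exists>g\<in>DS. y = direct_sum_map g" if y: "y \<in> Fr q" for y
  proof (rule bexI[of _ "\<lambda>i. if i = q then y else 0"])
    have "finite {i. (if i = q then y else 0) \<noteq> 0}"
      by (rule finite_subset[of _ "{q}"]) auto
    moreover have "0 \<in> Fr i" if "i \<in> I" for i
      using Fr_tsub[of i] that by (auto simp: tsub_def subspace_0)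
    ultimately show "(\<lambda>i. if i = q then y else 0) \<in> DS"
      using q y by (auto simp: direct_sum_def)
    show "y = direct_sum_map (\<lambda>i. if i = q then y else 0)"
      by (subst direct_sum_map_eq[of "{q}"]) auto
  qed
  show ?case
  proof (cases "q < R")
    case False
    then have "x \<in> Fr q"
      using \<open>x \<in> Cr q\<close> by (simp add: F_eq_def F_le_def F_ge_eq[OF q(3)])
    then show ?thesis by (rule single)
  next
    case True
    define P where "P s \<longleftrightarrow> q < s \<and> s \<le> R" for s
    \<comment> \<open>Largest dimension beyond q means that \<open>Cr\<close> is constant on (q,
      s].\<close>
    have "\<exists>s. P s \<and> (\<forall>t. P t \<longrightarrow> dim (Cr t) \<le> dim (Cr s))"
      using True dim_le[OF subset_UNIV]
      by (intro ex_has_greatest_nat[of P R "\<lambda>s. dim (Cr s)" "Suc (dim (UNIV :: 'm set))"])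
         (auto simp: P_def less_Suc_eq_le)
    then obtain s where s: "q < s" "s \<le> R" and smax: "\<And>t. q < t \<Longrightarrow> t \<le> R \<Longrightarrow> dim (Cr t) \<le> dim (Cr s)"
      by (auto simp: P_def)
    have s0: "0 < s" using s q by simp
    have spd_s: "spd \<le> omega v / t" if "0 < t" "t \<le> R" for t using that by (simp add: spd_le_iff)
    \<comment> \<open>Where \<open>Cr\<close> is constant, so is its complement \<open>Wr\<close>;
      hence \<open>Wr s\<close> is contained in the intersection that describes \<open>F_le\<close>
      at q.\<close>
    have WW: "Wr s \<subseteq> Wr t" if t: "q < t" "t \<le> R" for t
    proof (cases "t \<le> s")
      case False
      then show ?thesis using Wr_mono[OF s0, of t] by simp
    next
      case True
      have t0: "0 < t" using t q by simp
      have "Cr t = Cr s"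
      proof (rule ccontr)
        assume "Cr t \<noteq> Cr s"
        then have "Cr s \<subset> Cr t" using Cr_antimono[OF t0 True] by blast
        then have "dim (Cr s) < dim (Cr t)"
          using Cr_tsub[OF s0 s(2)] Cr_tsub[OF t0 t(2)] by (intro dim_strict_mono) (auto simp: tsub_def)
        then show False using smax[OF t] by simp
      qed
      show ?thesis
      proof
        fix w assume w: "w \<in> Wr s"
        obtain p where p: "p \<in> Wr t" "w - p \<in> Cr t" using slow_fast_sum[OF spd_s[OF t0 t(2)]] by blast
        have "w - p \<in> Wr s"
          using w p(1) Wr_mono[OF t0 True] Wr_tsub[OF s0 s(2)] by (intro subspace_diff) (auto simp: tsub_def)
        then have "w - p = 0" using slow_fast_int[OF spd_s[OF s0 s(2)]] p(2) \<open>Cr t = Cr s\<close> by blast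
        then show "w \<in> Wr t" using p(1) by simp
      qed
    qed
    obtain p where p: "p \<in> Wr s" "x - p \<in> Cr s" using slow_fast_sum[OF spd_s[OF s0 s(2)]] by blast
    have "x - p \<in> Cr q" using p(2) Cr_antimono[OF q(3), of s] s by auto
    then have "x - (x - p) \<in> Cr q"
      by (rule subspace_diff[OF tsub_subspace[OF Cr_tsub[OF q(3,2)]] \<open>x \<in> Cr q\<close>])
    moreover have "p \<in> F_le v d act q"
      unfolding F_le_eq[OF q(3) True] using p(1) WW by (auto simp: subset_iff)
    ultimately have "p \<in> Fr q"
      by (simp add: F_eq_def F_ge_eq[OF q(3)])
    then obtain g1 where g1: "g1 \<in> DS" "p = direct_sum_map g1" using single by blast
    have "s \<notin> S" using s(1) cSup_upper[OF _ bdd, of s] by (auto simp: q_def)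
    then have "Cr s \<subset> Cr r" using Cr_antimono[OF r(1), of s] s s0 q by (auto simp: S_def)
    then have "dim (Cr s) < dim (Cr r)"
      using Cr_tsub[OF s0 s(2)] Cr_tsub[OF r] by (intro dim_strict_mono) (auto simp: tsub_def)
    then obtain g2 where g2: "g2 \<in> DS" "x - p = direct_sum_map g2"
      using less.hyps[OF _ s0 s(2) p(2)] by blast
    have "x = p + (x - p)" by simp
    also have "\<dots> = direct_sum_map (\<lambda>i. g1 i + g2 i)"
      unfolding g1(2)[symmetric] g2(2) using g1 g2(1) direct_sum_map_add[of g1 g2]
      by (simp add: direct_sum_def)
    finally have "x = direct_sum_map (\<lambda>i. g1 i + g2 i)" .
    then show ?thesis using direct_sum_add[OF g1(1) g2(1)] by blast
  qed
qed

text \<open>For the smallest radius r in the support and the next one t, the component at r lies in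
  \<open>Wr t\<close> and, being minus the sum of the others, also in \<open>Cr t\<close>; these
  meet in 0.\<close>

lemma direct_sum_map_eq_0:
  assumes f: "f \<in> DS" "direct_sum_map f = 0"
  shows "f = (\<lambda>_. 0)"
proof (rule ccontr)
  assume "f \<noteq> (\<lambda>_. 0)"
  define S where "S = {i. f i \<noteq> 0}"
  have S: "finite S" "S \<noteq> {}" "S \<subseteq> I"
    using f \<open>f \<noteq> (\<lambda>_. 0)\<close> by (auto simp: S_def direct_sum_def)
  define r where "r = Min S"
  have r: "r \<in> S" "0 < r" "r \<le> R" using Min_in[OF S(1,2)] S(3) by (auto simp: r_def)
  define S' where "S' = S - {r}"
  have sum: "f r + (\<Sum>i\<in>S'. f i) = 0"
    using f(2) S(1) r(1) by (simp add: direct_sum_map_def S_def[symmetric] S'_def sum.remove)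
  show False
  proof (cases "S' = {}")
    case True
    then show ?thesis using sum r(1) by (simp add: S_def)
  next
    case False
    define t where "t = Min S'"
    have fS': "finite S'" using S by (simp add: S'_def)
    have t: "t \<in> S'" "\<And>i. i \<in> S' \<Longrightarrow> t \<le> i" using Min_in[OF fS' False] fS' by (auto simp: t_def)
    have tR: "0 < t" "t \<le> R" using t(1) S(3) by (auto simp: S'_def)
    have "r \<le> t" using t(1) S(1) by (auto simp: r_def S'_def)
    then have rt: "r < t" using t(1) by (auto simp: S'_def less_le)
    have fF: "f i \<in> Fr i" if "i \<in> S" for i using f(1) that S(3) by (auto simp: direct_sum_def)
    have st: "subspace (Cr t)" using Cr_tsub[OF tR] by (simp add: tsub_def)
    have "f i \<in> Cr t" if i: "i \<in> S'" for i
    proof -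
      have "f i \<in> Cr i" using fF[of i] i S(3) F_ge_eq[of i] by (auto simp: S'_def F_eq_def)
      then show ?thesis using Cr_antimono[OF tR(1) t(2)[OF i]] by blast
    qed
    then have "- (\<Sum>i\<in>S'. f i) \<in> Cr t" by (intro subspace_neg st subspace_sum)
    moreover have "f r = - (\<Sum>i\<in>S'. f i)" using sum by (simp add: add_eq_0_iff2)
    ultimately have "f r \<in> Cr t" by simp
    moreover have "f r \<in> Wr t" using fF[OF r(1)] F_le_subset_Wr[OF r(2) rt tR(2)] by (auto simp: F_eq_def)
    ultimately have "f r = 0" using slow_fast_int[of "omega v / t"] tR by (simp add: spd_le_iff)
    then show False using r(1) by (simp add: S_def)
  qed
qed

text \<open>A nonzero \<open>Fr r\<close> forces the dimension of \<open>Cr\<close> to drop strictly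
  after r, so this dimension tells such radii apart and takes only finitely many values.\<close>

lemma finite_Fr: "finite {r \<in> I. Fr r \<noteq> {0}}"
proof (rule inj_on_finite[of "\<lambda>r. dim (Cr r)"])
  have less: "dim (Cr s) < dim (Cr r)" if r: "r \<in> I" "Fr r \<noteq> {0}" and s: "s \<in> I" "r < s" for r s
  proof -
    have "0 \<in> Fr r" using Fr_tsub[of r] r by (auto simp: tsub_def subspace_0)
    then obtain x where x: "x \<in> Fr r" "x \<noteq> 0" using r(2) by blast
    have "x \<in> Cr r" "x \<in> Wr s"
      using x(1) r(1) s F_ge_eq[of r] F_le_subset_Wr[of r s] by (auto simp: F_eq_def)
    then have "x \<notin> Cr s" using slow_fast_int[of "omega v / s" x] x(2) s by (auto simp: spd_le_iff)
    then have "Cr s \<subset> Cr r" using Cr_antimono[of r s] r s \<open>x \<in> Cr r\<close> by auto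
    then show ?thesis
      using Cr_tsub[of s] Cr_tsub[of r] r(1) s(1) by (intro dim_strict_mono) (auto simp: tsub_def)
  qed
  show "inj_on (\<lambda>r. dim (Cr r)) {r \<in> I. Fr r \<noteq> {0}}"
  proof (rule inj_onI)
    fix r s assume "r \<in> {r \<in> I. Fr r \<noteq> {0}}" "s \<in> {r \<in> I. Fr r \<noteq> {0}}" "dim (Cr r) = dim (Cr s)"
    then show "r = s" using less[of r s] less[of s r] by (cases r s rule: linorder_cases) auto
  qed
  show "(\<lambda>r. dim (Cr r)) ` {r \<in> I. Fr r \<noteq> {0}} \<subseteq> {..dim (UNIV :: 'm set)}"
    using dim_le[OF subset_UNIV] by auto
qed simp

lemma direct_sum_iso_Fr: "direct_sum_iso act I Fr"
  unfolding direct_sum_iso_def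
proof (intro conjI ballI allI)
  fix f g assume "f \<in> DS" "g \<in> DS"
  then show "direct_sum_map (\<lambda>i. f i + g i) = direct_sum_map f + direct_sum_map g"
    by (intro direct_sum_map_add) (auto simp: direct_sum_def)
next
  fix p f assume f: "f \<in> DS"
  define S where "S = {i. f i \<noteq> 0}"
  have "finite S" using f by (simp add: direct_sum_def S_def)
  then have "direct_sum_map (\<lambda>i. act p (f i)) = (\<Sum>i\<in>S. act p (f i))"
    by (intro direct_sum_map_eq) (auto simp: S_def)
  also have "\<dots> = act p (\<Sum>i\<in>S. f i)"
    using \<open>finite S\<close> by (induction S rule: finite_induct) (simp_all add: M.act_add_right)
  finally show "direct_sum_map (\<lambda>i. act p (f i)) = act p (direct_sum_map f)"
    by (simp add: direct_sum_map_def S_def)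
next
  show "bij_betw direct_sum_map DS UNIV"
  proof (rule bij_betw_imageI)
    show "inj_on direct_sum_map DS"
    proof (rule inj_onI)
      fix f g assume fg: "f \<in> DS" "g \<in> DS" "direct_sum_map f = direct_sum_map g"
      have mg: "(\<lambda>i. - g i) \<in> DS"
        using fg(2) Fr_tsub by (auto simp: direct_sum_def tsub_def subspace_neg)
      have "direct_sum_map (\<lambda>i. - g i) = - direct_sum_map g"
        by (simp add: direct_sum_map_def sum_negf)
      then have "direct_sum_map (\<lambda>i. f i + - g i) = 0"
        using direct_sum_map_add[of f "\<lambda>i. - g i"] fg mg by (simp add: direct_sum_def)
      then have "(\<lambda>i. f i + - g i) = (\<lambda>_. 0)"
        using direct_sum_map_eq_0[OF direct_sum_add[OF fg(1) mg]] by blast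
      then show "f = g" by (simp add: fun_eq_iff)
    qed
    obtain r where "0 < r" "r \<le> R" "Cr r = UNIV" using Cr_UNIV by blast
    then have "\<exists>g\<in>DS. x = direct_sum_map g" for x using Cr_in_sum by blast
    then show "direct_sum_map ` DS = UNIV" by blast
  qed
qed

end

theorem theorem5p12:
  fixes v :: "'k::field_char_0 \<Rightarrow> real"
    and d :: "'k \<Rightarrow> 'k"
    and act :: "'k poly \<Rightarrow> 'm::ab_group_add \<Rightarrow> 'm"
  assumes "nonarch_diff_field v d"
    and "residue_char v > 0"
    and "KT_module_fd d act"
  shows "(\<forall>r\<in>{0<..radius v d}. F_sp v act r = F_eq v d act r) \<and>
    finite {r \<in> {0<..radius v d}. F_sp v act r \<noteq> {0}} \<and>
    direct_sum_iso act {0<..radius v d} (F_sp v act)"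
proof -
  interpret fd_module v d act
    using assms by (simp add: fd_module_def fd_module_axioms_def)
  have eq: "F_sp v act r = F_eq v d act r" if "r \<in> {0<..radius v d}" for r
    using that by (intro F_sp_eq) auto
  then have "{r \<in> {0<..radius v d}. F_sp v act r \<noteq> {0}} = {r \<in> {0<..radius v d}. F_eq v d act r \<noteq> {0}}"
    by blast
  \<comment> \<open>The families are compared on the index set only; outside it the elements of
    either direct sum vanish.\<close>
  moreover have "direct_sum {0<..radius v d} (F_sp v act) = direct_sum {0<..radius v d} (F_eq v d act)"
    using eq by (auto simp: direct_sum_def)
  ultimately show ?thesis
    using eq finite_Fr direct_sum_iso_Fr by (simp add: direct_sum_iso_def)
qed

end
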